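(* Let $k \in \mathbb{N}$, $k>0$, and let $\mathcal{P}$ be a parameterized program. Then an assertion of $\mathcal{P}$ is violated in some $k$-round execution of $\mathcal{P}$ if and only if an assertion is violated in some execution of the sequential program $\mathcal{P}^{\mathit{lazy}}_k$. Moreover, $\mathcal{P}^{\mathit{lazy}}_k$ is lazy: whenever $\mathcal{P}^{\mathit{lazy}}_k$ simulates a statement of $\mathcal{P}$ on a localized state, that localized state is reachable in some execution of $\mathcal{P}$.
   Context: Parameterized programs. A parameterized program $\mathcal{P}=(S,\mathtt{init},\{P_i\}_{i=1}^n)$ consists of a set $S$ of shared variables, a sequential block $\mathtt{init}$ initializing the shared variables, and processes $P_1,\dots,P_n$; each process is a (possibly recursive, nondeterministic) sequential program over integer/Boolean variables with its own global variables (global to a thread, not shared), local variables of procedures, a function $\mathtt{main}$, $\mathtt{assert}$ statements, and possibly $\mathtt{atomic}$ blocks. An execution starts by running $\mathtt{init}$, with an arbitrary finite number $m$ of threads $T_1,\dots,T_m$, each running a copy of some process (assignment $map:[1,m]\to\{P_1,\dots,P_n\}$), each starting in an initial local state. A state is $(map,i,s,\sigma_1,\dots,\sigma_m)$ where $T_i$ is the active thread, $s$ is the valuation of the shared variables (the shared state), and $\sigma_j$ is the local state of $T_j$ (program counter, valuation of its global and local variables, and its call stack). From a state one either executes a statement of the active thread or context-switches to another thread, except inside an atomic block. The localized state of a state is $(\widehat{\sigma_i},s)$ where $\widehat{\sigma_i}$ is the program counter and valuation of local and global variables of the active thread (without call stack). Assertions are predicates on localized states. A $k$-round schedule is one where,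 for some ordering $T_1,\dots,T_m$ of the threads, the threads are activated in $k$ rounds, each round scheduling each thread once in this order for an arbitrary number of steps; an execution following such a schedule is a $k$-round execution. Construction of $\mathcal{P}^{\mathit{lazy}}_k$. First the processes are merged into a single process $P$ that nondeterministically chooses at the start which $P_i$ to behave as, and functions returning values are replaced by void functions passing return values through (unshared) global variables. Let $s$ denote the shared variables and $g$ the global variables of $P$. $\mathcal{P}^{\mathit{lazy}}_k$ has as global variables $s$, $g$ and two Booleans $\mathit{atom},\mathit{terminate}$. Its function $\mathtt{main}$ has locals $q_1,\dots,q_k$ (each of the type of $s$) and $i:=1$; it sets $\mathit{atom}:=F$, calls $\mathtt{init}$, sets $q_1$ to the current shared state, and then while $i\le k$: sets $\mathit{terminate}:=F$, calls $\mathtt{linear\_int}(q_1,\dots,q_k,\ q_2,\dots,q_k,\ i)$, increments $i$, and if $i\le k$ sets $q_i:=s$. The function $\mathtt{linear\_int}(q_1,\dots,q_k,q'_1,\dots,q'_{k-1},\mathit{bound})$ is the body of $P$'s $\mathtt{main}$ starting from an initial local state of $P$ and shared state $q_1$, with a local Boolean $\mathit{last}$ assigned nondeterministically at entry, a local counter $j$ initialized to $1$, and a local $\mathit{save}$; each function $f$ of $P$ is replaced by $f^{\mathit{lazy}}$ (calls to $f$ becoming calls to $f^{\mathit{lazy}}$); $\mathit{atom}$ is set to $T$ on entering and $F$ on leaving an atomic block; every original return statement of $\mathtt{linear\_int}$ is preceded by $\mathtt{assume}(F)$. Between every two statements of $\mathtt{linear\_int}$ and of each $f^{\mathit{lazy}}$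 the following code is inserted: if $\mathit{terminate}$ then return; if $\neg\mathit{atom}$ then, while $( * )$ (nondeterministically many times): if $\mathit{last}$ then { if $j=\mathit{bound}$ then set $\mathit{terminate}:=T$ and return; else $\mathtt{assume}(q'_j=s)$; $j$++; $s:=q_j$ } else { $q_j:=s$; $\mathit{save}:=g$; call $\mathtt{linear\_int}(q_1,\dots,q_k,q'_1,\dots,q'_{k-1},j)$; if $j=\mathit{bound}$ then return; else $\mathtt{assume}(q'_j=s)$; $g:=\mathit{save}$; $\mathit{terminate}:=F$; $j$++; $s:=q_j$ }. A localized state of $\mathcal{P}$ simulated by $\mathcal{P}^{\mathit{lazy}}_k$ consists of the current values of $P$'s program counter, local and global variables and the shared variables $s$. *)

theory Defs
  imports "HOL-Library.Sublist"
begin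

section \<open>Sequential programs\<close>

text \<open>
  Programs are blocks (lists) of statements.  Data are handled through valuations: \<open>'v\<close> is the type
  of valuations of all variables that outlive a procedure call, \<open>'l\<close> the type of valuations of the
  local variables of a procedure; \<open>'f\<close> is the type of procedure names.  Every statement carries
  a label of type \<open>'p\<close>, and the value of the program counter is the label of the statement to be
  executed next.

  In \<open>Call p f args res\<close> the set \<open>args (v, l)\<close> contains the possible initial local valuations of the
  callee (several, when it has uninitialised variables), and \<open>res l' l\<close> is the local valuation of the
  caller after the call, where \<open>l'\<close> is the final local valuation of the callee and \<open>l\<close> that of the
  caller.  A void function with parameters passed by value has \<open>res = keep\<close>; other choices give
  returned values and parameters passed by reference (value-result).

  An atomic block is delimited by \<open>BeginAtomic\<close> and \<open>EndAtomic\<close>.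
\<close>

datatype 'st guard = Star | Expr "'st \<Rightarrow> bool"

fun may_eval :: "'st guard \<Rightarrow> 'st \<Rightarrow> bool \<Rightarrow> bool" where
  "may_eval Star st t \<longleftrightarrow> True"
| "may_eval (Expr b) st t \<longleftrightarrow> t = b st"

datatype ('v, 'l, 'f, 'p) com =
    Update (label: 'p) "'v \<times> 'l \<Rightarrow> ('v \<times> 'l) set"
  | Assume (label: 'p) "'v \<times> 'l \<Rightarrow> bool"
  | Assert (label: 'p) "'v \<times> 'l \<Rightarrow> bool"
  | Ite (label: 'p) "('v \<times> 'l) guard" "('v, 'l, 'f, 'p) com list" "('v, 'l, 'f, 'p) com list"
  | While (label: 'p) "('v \<times> 'l) guard" "('v, 'l, 'f, 'p) com list"
  | BeginAtomic (label: 'p)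
  | EndAtomic (label: 'p)
  | Call (label: 'p) 'f "'v \<times> 'l \<Rightarrow> 'l set" "'l \<Rightarrow> 'l \<Rightarrow> 'l"
  | Return (label: 'p)

type_synonym ('v, 'l, 'f, 'p) block = "('v, 'l, 'f, 'p) com list"

text \<open>
  A stack frame consists of the statements that remain to be executed, the local valuation, and the
  function \<open>res\<close> of the call that created it.  A configuration consists of a flag telling whether
  execution is inside an atomic block, the valuation of the non-local variables, and the call stack
  (top first); the run has terminated when the stack is empty.  The flag is set by entering and reset
  by leaving an atomic block, and it has no influence on the execution of a sequential program.
\<close>

type_synonym ('v, 'l, 'f, 'p) frame = "('v, 'l, 'f, 'p) block \<times> 'l \<times> ('l \<Rightarrow> 'l \<Rightarrow> 'l)"

type_synonym ('v, 'l, 'f, 'p) conf = "bool \<times> 'v \<times> ('v, 'l, 'f, 'p) frame list"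

definition keep :: "'l \<Rightarrow> 'l \<Rightarrow> 'l" where
  "keep callee caller = caller"

fun pop :: "'l \<Rightarrow> ('l \<Rightarrow> 'l \<Rightarrow> 'l) \<Rightarrow> ('v, 'l, 'f, 'p) frame list \<Rightarrow> ('v, 'l, 'f, 'p) frame list" where
  "pop l res [] = []"
| "pop l res ((cs, l', res') # fs) = (cs, res l l', res') # fs"

inductive step :: "('f \<Rightarrow> ('v, 'l, 'f, 'p) block) \<Rightarrow> ('v, 'l, 'f, 'p) conf \<Rightarrow> ('v, 'l, 'f, 'p) conf \<Rightarrow> bool"
  for body where
  update: "(v', l') \<in> u (v, l) \<Longrightarrow>
    step body (a, v, (Update p u # cs, l, r) # fs) (a, v', (cs, l', r) # fs)"
| assume_true: "b (v, l) \<Longrightarrow>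
    step body (a, v, (Assume p b # cs, l, r) # fs) (a, v, (cs, l, r) # fs)"
| assert_true: "b (v, l) \<Longrightarrow>
    step body (a, v, (Assert p b # cs, l, r) # fs) (a, v, (cs, l, r) # fs)"
| ite_true: "may_eval b (v, l) True \<Longrightarrow>
    step body (a, v, (Ite p b xs ys # cs, l, r) # fs) (a, v, (xs @ cs, l, r) # fs)"
| ite_false: "may_eval b (v, l) False \<Longrightarrow>
    step body (a, v, (Ite p b xs ys # cs, l, r) # fs) (a, v, (ys @ cs, l, r) # fs)"
| while_true: "may_eval b (v, l) True \<Longrightarrow>
    step body (a, v, (While p b xs # cs, l, r) # fs) (a, v, (xs @ While p b xs # cs, l, r) # fs)"
| while_false: "may_eval b (v, l) False \<Longrightarrow>
    step body (a, v, (While p b xs # cs, l, r) # fs) (a, v, (cs, l, r) # fs)"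
| begin_atomic:
    "step body (a, v, (BeginAtomic p # cs, l, r) # fs) (True, v, (cs, l, r) # fs)"
| end_atomic:
    "step body (a, v, (EndAtomic p # cs, l, r) # fs) (False, v, (cs, l, r) # fs)"
| call: "l' \<in> args (v, l) \<Longrightarrow>
    step body (a, v, (Call p f args res # cs, l, r) # fs)
      (a, v, (body f, l', res) # (cs, l, r) # fs)"
| return_stmt:
    "step body (a, v, (Return p # cs, l, r) # fs) (a, v, pop l r fs)"
| return_end:
    "step body (a, v, ([], l, r) # fs) (a, v, pop l r fs)"

fun conf_violates :: "('v, 'l, 'f, 'p) conf \<Rightarrow> bool" where
  "conf_violates (a, v, (Assert p b # cs, l, r) # fs) \<longleftrightarrow> \<not> b (v, l)"
| "conf_violates _ \<longleftrightarrow> False"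

record ('v, 'l, 'f, 'p) seq_program =
  sbody :: "'f \<Rightarrow> ('v, 'l, 'f, 'p) block"
  smain :: 'f
  sinits :: "('v \<times> 'l) set"

definition seq_initial :: "('v, 'l, 'f, 'p) seq_program \<Rightarrow> ('v, 'l, 'f, 'p) conf set" where
  "seq_initial Q = {(False, v, [(sbody Q (smain Q), l, keep)]) | v l. (v, l) \<in> sinits Q}"

definition seq_reachable :: "('v, 'l, 'f, 'p) seq_program \<Rightarrow> ('v, 'l, 'f, 'p) conf \<Rightarrow> bool" where
  "seq_reachable Q c \<longleftrightarrow> (\<exists>c0 \<in> seq_initial Q. (step (sbody Q))\<^sup>*\<^sup>* c0 c)"

definition seq_violation :: "('v, 'l, 'f, 'p) seq_program \<Rightarrow> bool" where
  "seq_violation Q \<longleftrightarrow> (\<exists>c. seq_reachable Q c \<and> conf_violates c)"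


section \<open>Parameterized programs\<close>

text \<open>
  \<open>'s\<close> and \<open>'g\<close> are the types of valuations of the shared variables and of the thread-global
  (unshared) variables.  The set \<open>inits\<close> contains the initial valuations of the global variables and
  of the local variables of \<open>main\<close>.  The block \<open>init\<close> has no access to thread-global variables.
\<close>

record ('s, 'g, 'l, 'f, 'p) process =
  body :: "'f \<Rightarrow> ('s \<times> 'g, 'l, 'f, 'p) block"
  main :: 'f
  inits :: "('g \<times> 'l) set"

record ('s, 'g, 'l, 'f, 'p) par_program =
  init :: "('s, 'l, 'f, 'p) seq_program"
  procs :: "('s, 'g, 'l, 'f, 'p) process list"

type_synonym ('s, 'g, 'l, 'f, 'p) thread_state = "'g \<times> ('s \<times> 'g, 'l, 'f, 'p) frame list"

text \<open>
  In \<open>Running pm i a s ts\<close>, the list \<open>pm\<close> maps threads to (indices of) processes, \<open>i\<close> is the active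
  thread, \<open>a\<close> tells whether it is inside an atomic block, \<open>s\<close> is the shared state and \<open>ts\<close> the list of
  local states.  Threads are numbered from 0.
\<close>

datatype ('s, 'g, 'l, 'f, 'p) state =
    Initializing "('s, 'l, 'f, 'p) conf"
  | Running "nat list" nat bool 's "('s, 'g, 'l, 'f, 'p) thread_state list"

definition thread_initial :: "('s, 'g, 'l, 'f, 'p) process \<Rightarrow> ('s, 'g, 'l, 'f, 'p) thread_state set" where
  "thread_initial P = {(g, [(body P (main P), l, keep)]) | g l. (g, l) \<in> inits P}"

text \<open>
  \<open>execution \<P> w \<sigma>\<close>: some (finite) execution of \<open>\<P>\<close> ends in the state \<open>\<sigma>\<close>, and \<open>w\<close> is the sequence of
  threads activated along it.  Reactivating the active thread is permitted (and changes nothing but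
  \<open>w\<close>), so that a single thread, too, can go through several rounds.
\<close>

inductive execution ::
  "('s, 'g, 'l, 'f, 'p) par_program \<Rightarrow> nat list \<Rightarrow> ('s, 'g, 'l, 'f, 'p) state \<Rightarrow> bool"
  for \<P> where
  start: "c \<in> seq_initial (init \<P>) \<Longrightarrow> execution \<P> [] (Initializing c)"
| init_step: "execution \<P> w (Initializing c) \<Longrightarrow> step (sbody (init \<P>)) c c' \<Longrightarrow>
    execution \<P> w (Initializing c')"
| spawn: "execution \<P> w (Initializing (a, s, [])) \<Longrightarrow>
    length ts = length pm \<Longrightarrow>
    (\<forall>t < length pm. pm ! t < length (procs \<P>) \<and> ts ! t \<in> thread_initial (procs \<P> ! (pm ! t))) \<Longrightarrow>
    i < length pm \<Longrightarrow>
    execution \<P> (w @ [i]) (Running pm i False s ts)"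
| thread_step: "execution \<P> w (Running pm i a s ts) \<Longrightarrow>
    ts ! i = (g, fs) \<Longrightarrow>
    step (body (procs \<P> ! (pm ! i))) (a, (s, g), fs) (a', (s', g'), fs') \<Longrightarrow>
    execution \<P> w (Running pm i a' s' (ts[i := (g', fs')]))"
| switch: "execution \<P> w (Running pm i False s ts) \<Longrightarrow>
    j < length pm \<Longrightarrow>
    execution \<P> (w @ [j]) (Running pm j False s ts)"

fun num_threads :: "('s, 'g, 'l, 'f, 'p) state \<Rightarrow> nat" where
  "num_threads (Initializing c) = 0"
| "num_threads (Running pm i a s ts) = length pm"

text \<open>
  Executions are finite and may stop anywhere, hence a prefix of the sequence of activations
  prescribed by \<open>k\<close> rounds is admitted.
\<close>

definition k_round_schedule :: "nat \<Rightarrow> nat \<Rightarrow> nat list \<Rightarrow> bool" where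
  "k_round_schedule k m w \<longleftrightarrow>
     (\<exists>ord. distinct ord \<and> set ord = {..<m} \<and> prefix w (concat (replicate k ord)))"

fun violates :: "('s, 'g, 'l, 'f, 'p) state \<Rightarrow> bool" where
  "violates (Initializing c) \<longleftrightarrow> conf_violates c"
| "violates (Running pm i a s ts) \<longleftrightarrow> conf_violates (a, (s, fst (ts ! i)), snd (ts ! i))"

definition k_round_violation :: "nat \<Rightarrow> ('s, 'g, 'l, 'f, 'p) par_program \<Rightarrow> bool" where
  "k_round_violation k \<P> \<longleftrightarrow>
     (\<exists>w \<sigma>. execution \<P> w \<sigma> \<and> k_round_schedule k (num_threads \<sigma>) w \<and> violates \<sigma>)"

text \<open>
  The program counter in a localized state is given as a pair of a process index and the label of
  a statement of that process; next come the global, the local and the shared valuation.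
\<close>

type_synonym ('s, 'g, 'l, 'p) localized = "(nat \<times> 'p) \<times> 'g \<times> 'l \<times> 's"

fun localized :: "('s, 'g, 'l, 'f, 'p) state \<Rightarrow> ('s, 'g, 'l, 'p) localized option" where
  "localized (Running pm i a s ts) =
     (case ts ! i of
        (g, (c # cs, l, r) # fs) \<Rightarrow> Some ((pm ! i, label c), g, l, s)
      | _ \<Rightarrow> None)"
| "localized (Initializing c) = None"

definition localized_reachable ::
  "('s, 'g, 'l, 'f, 'p) par_program \<Rightarrow> ('s, 'g, 'l, 'p) localized \<Rightarrow> bool" where
  "localized_reachable \<P> x \<longleftrightarrow> (\<exists>w \<sigma>. execution \<P> w \<sigma> \<and> localized \<sigma> = Some x)"


section \<open>Merging the processes\<close>

text \<open>
  From here on, labels are of type \<open>'p option\<close>, and \<open>None\<close> labels the statements added by the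
  constructions.  The procedures of the merged process are \<open>Some (n, f)\<close>, the procedure \<open>f\<close> of process
  \<open>n\<close>, and its main procedure \<open>None\<close>.  The latter chooses a process, establishes an initial valuation of
  it, and continues as the main procedure of the chosen process.
\<close>

definition merge ::
  "('s, 'g, 'l, 'f, 'p) process list \<Rightarrow> ('s, 'g, 'l, (nat \<times> 'f) option, (nat \<times> 'p) option) process" where
  "merge Ps =
     (let code = (\<lambda>n f. map (map_com (\<lambda>h. Some (n, h)) (\<lambda>p. Some (n, p))) (body (Ps ! n) f));
          start = (\<lambda>n. Update None (\<lambda>((s, g), l). {((s, g'), l') | g' l'. (g', l') \<in> inits (Ps ! n)}))
      in \<lparr> body = (\<lambda>h. case h of
             None \<Rightarrow> foldr (\<lambda>n rest. [Ite None Star (start n # code n (main (Ps ! n))) rest])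
                       [0..<length Ps] [Assume None (\<lambda>_. False)]
           | Some (n, f) \<Rightarrow> code n f),
         main = None,
         inits = UNIV \<rparr>)"


section \<open>The lazy sequential program\<close>

record ('s, 'g) lglobals =
  shared :: 's
  glob :: 'g
  atom :: bool
  terminate :: bool

text \<open>
  One record holds the local variables of all procedures: \<open>loc\<close> the local variables of the original
  procedures, \<open>qi r\<close> and \<open>qo r\<close> (for \<open>r = 1, 2, \<dots>\<close>) the variables \<open>q\<^sub>r\<close> and \<open>q'\<^sub>r\<close>, \<open>cnt\<close> the counter
  \<open>i\<close> of \<open>main\<close>, and \<open>jj\<close> the counter \<open>j\<close> of \<open>linear_int\<close>.  Only \<open>qi 1, \<dots>, qi k\<close> and
  \<open>qo 1, \<dots>, qo (k - 1)\<close> are ever used.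
\<close>

record ('s, 'g, 'l) llocals =
  loc :: 'l
  qi :: "nat \<Rightarrow> 's"
  qo :: "nat \<Rightarrow> 's"
  bound :: nat
  lst :: bool
  jj :: nat
  save :: 'g
  cnt :: nat

type_synonym ('s, 'g, 'l) lstate = "('s, 'g) lglobals \<times> ('s, 'g, 'l) llocals"

datatype ('f, 'h) lname = LMain | LInit 'f | LinearInt | LazyProc 'h

type_synonym ('s, 'g, 'l, 'f, 'h, 'p) lblock =
  "(('s, 'g) lglobals, ('s, 'g, 'l) llocals, ('f, 'h) lname, 'p option) block"

type_synonym ('s, 'g, 'l, 'f, 'h, 'p) lcom =
  "(('s, 'g) lglobals, ('s, 'g, 'l) llocals, ('f, 'h) lname, 'p option) com"

abbreviation setg :: "(('s, 'g, 'l) lstate \<Rightarrow> ('s, 'g) lglobals) \<Rightarrow> ('s, 'g, 'l, 'f, 'h, 'p) lcom" where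
  "setg e \<equiv> Update None (\<lambda>(V, L). {(e (V, L), L)})"

abbreviation setl :: "(('s, 'g, 'l) lstate \<Rightarrow> ('s, 'g, 'l) llocals) \<Rightarrow> ('s, 'g, 'l, 'f, 'h, 'p) lcom" where
  "setl e \<equiv> Update None (\<lambda>(V, L). {(V, e (V, L))})"

definition inserted :: "('s, 'g, 'l, 'f, 'h, 'p) lblock" where
  "inserted =
   [ Ite None (Expr (\<lambda>(V, L). terminate V)) [Return None] [],
     Ite None (Expr (\<lambda>(V, L). \<not> atom V))
       [ While None Star
         [ Ite None (Expr (\<lambda>(V, L). lst L))
             [ Ite None (Expr (\<lambda>(V, L). jj L = bound L))
                 [ setg (\<lambda>(V, L). V\<lparr>terminate := True\<rparr>),
                   Return None ]
                 [ Assume None (\<lambda>(V, L). qo L (jj L) = shared V),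
                   setl (\<lambda>(V, L). L\<lparr>jj := jj L + 1\<rparr>),
                   setg (\<lambda>(V, L). V\<lparr>shared := qi L (jj L)\<rparr>) ] ]
             [ setl (\<lambda>(V, L). L\<lparr>qi := (qi L)(jj L := shared V)\<rparr>),
               setl (\<lambda>(V, L). L\<lparr>save := glob V\<rparr>),
               Call None LinearInt
                 (\<lambda>(V, L). {L'. qi L' = qi L \<and> qo L' = qo L \<and> bound L' = jj L}) keep,
               Ite None (Expr (\<lambda>(V, L). jj L = bound L))
                 [ Return None ]
                 [ Assume None (\<lambda>(V, L). qo L (jj L) = shared V),
                   setg (\<lambda>(V, L). V\<lparr>glob := save L\<rparr>),
                   setg (\<lambda>(V, L). V\<lparr>terminate := False\<rparr>),
                   setl (\<lambda>(V, L). L\<lparr>jj := jj L + 1\<rparr>),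
                   setg (\<lambda>(V, L). V\<lparr>shared := qi L (jj L)\<rparr>) ] ] ] ]
       [] ]"

definition rd :: "('s, 'g, 'l) lstate \<Rightarrow> ('s \<times> 'g) \<times> 'l" where
  "rd = (\<lambda>(V, L). ((shared V, glob V), loc L))"

definition wr :: "('s, 'g, 'l) lstate \<Rightarrow> ('s \<times> 'g) \<times> 'l \<Rightarrow> ('s, 'g, 'l) lstate" where
  "wr = (\<lambda>(V, L) ((s, g), l). (V\<lparr>shared := s, glob := g\<rparr>, L\<lparr>loc := l\<rparr>))"

fun lift_guard :: "('a \<Rightarrow> 'b) \<Rightarrow> 'b guard \<Rightarrow> 'a guard" where
  "lift_guard get Star = Star"
| "lift_guard get (Expr b) = Expr (\<lambda>x. b (get x))"

text \<open>
  The code inserted into \<open>f\<^sup>l\<^sup>a\<^sup>z\<^sup>y\<close> refers to the variables \<open>q\<^sub>r\<close>, \<open>q'\<^sub>r\<close>, \<open>bound\<close>, \<open>last\<close>, \<open>j\<close> of the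
  activation of \<open>linear_int\<close> from which \<open>f\<^sup>l\<^sup>a\<^sup>z\<^sup>y\<close> was called, directly or not.  They are therefore
  copied into the frame of \<open>f\<^sup>l\<^sup>a\<^sup>z\<^sup>y\<close> at the call and copied back when it returns.
\<close>

definition lift_call ::
  "(('s, 'g, 'l) lstate \<Rightarrow> 'v \<times> 'l) \<Rightarrow> ('f, 'h) lname \<Rightarrow>
   ('v \<times> 'l \<Rightarrow> 'l set) \<Rightarrow> ('l \<Rightarrow> 'l \<Rightarrow> 'l) \<Rightarrow> 'p option \<Rightarrow> ('s, 'g, 'l, 'f, 'h, 'p) lcom" where
  "lift_call get f args res p =
     Call p f (\<lambda>(V, L). (\<lambda>l. L\<lparr>loc := l\<rparr>) ` args (get (V, L)))
              (\<lambda>L' L. L'\<lparr>loc := res (loc L') (loc L)\<rparr>)"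

text \<open>
  The translation of a statement of the process; \<open>outer\<close> tells whether it belongs to \<open>linear_int\<close>
  (as opposed to some \<open>f\<^sup>l\<^sup>a\<^sup>z\<^sup>y\<close>).  In the translation of a block, \<open>inserted\<close> precedes every statement;
  it is also put at the end of loop bodies and (below) of procedure bodies, so that it is executed
  between any two consecutively executed statements.
\<close>

fun lazy_com :: "bool \<Rightarrow> ('s \<times> 'g, 'l, 'h, 'p option) com \<Rightarrow> ('s, 'g, 'l, 'f, 'h, 'p) lblock" where
  "lazy_com outer (Update p u) = [Update p (\<lambda>x. wr x ` u (rd x))]"
| "lazy_com outer (Assume p b) = [Assume p (\<lambda>x. b (rd x))]"
| "lazy_com outer (Assert p b) = [Assert p (\<lambda>x. b (rd x))]"
| "lazy_com outer (Ite p b xs ys) =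
     [Ite p (lift_guard rd b)
        (concat (map (\<lambda>c. inserted @ lazy_com outer c) xs))
        (concat (map (\<lambda>c. inserted @ lazy_com outer c) ys))]"
| "lazy_com outer (While p b xs) =
     [While p (lift_guard rd b) (concat (map (\<lambda>c. inserted @ lazy_com outer c) xs) @ inserted)]"
| "lazy_com outer (BeginAtomic p) = [Update p (\<lambda>(V, L). {(V\<lparr>atom := True\<rparr>, L)})]"
| "lazy_com outer (EndAtomic p) = [Update p (\<lambda>(V, L). {(V\<lparr>atom := False\<rparr>, L)})]"
| "lazy_com outer (Call p f args res) = [lift_call rd (LazyProc f) args res p]"
| "lazy_com outer (Return p) = (if outer then [Assume None (\<lambda>_. False), Return p] else [Return p])"

definition lazy_block ::
  "bool \<Rightarrow> ('s \<times> 'g, 'l, 'h, 'p option) block \<Rightarrow> ('s, 'g, 'l, 'f, 'h, 'p) lblock" where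
  "lazy_block outer cs = concat (map (\<lambda>c. inserted @ lazy_com outer c) cs) @ inserted"

text \<open>The statements of the initialization block are kept as they are, up to the change of state space.\<close>

definition rd_init :: "('s, 'g, 'l) lstate \<Rightarrow> 's \<times> 'l" where
  "rd_init = (\<lambda>(V, L). (shared V, loc L))"

definition wr_init :: "('s, 'g, 'l) lstate \<Rightarrow> 's \<times> 'l \<Rightarrow> ('s, 'g, 'l) lstate" where
  "wr_init = (\<lambda>(V, L) (s, l). (V\<lparr>shared := s\<rparr>, L\<lparr>loc := l\<rparr>))"

fun init_com :: "('s, 'l, 'f, 'q) com \<Rightarrow> ('s, 'g, 'l, 'f, 'h, 'p) lcom" where
  "init_com (Update p u) = Update None (\<lambda>x. wr_init x ` u (rd_init x))"
| "init_com (Assume p b) = Assume None (\<lambda>x. b (rd_init x))"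
| "init_com (Assert p b) = Assert None (\<lambda>x. b (rd_init x))"
| "init_com (Ite p b xs ys) =
     Ite None (lift_guard rd_init b) (map init_com xs) (map init_com ys)"
| "init_com (While p b xs) = While None (lift_guard rd_init b) (map init_com xs)"
| "init_com (BeginAtomic p) = BeginAtomic None"
| "init_com (EndAtomic p) = EndAtomic None"
| "init_com (Call p f args res) = lift_call rd_init (LInit f) args res None"
| "init_com (Return p) = Return None"

definition linear_int :: "('s, 'g, 'l, 'h, 'p option) process \<Rightarrow> ('s, 'g, 'l, 'f, 'h, 'p) lblock" where
  "linear_int P =
   [ Update None (\<lambda>(V, L). {(V, L\<lparr>lst := b\<rparr>) | b. True}),
     setl (\<lambda>(V, L). L\<lparr>jj := 1\<rparr>),
     Update None (\<lambda>(V, L). {(V\<lparr>glob := g\<rparr>, L\<lparr>loc := l\<rparr>) | g l. (g, l) \<in> inits P}),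
     setg (\<lambda>(V, L). V\<lparr>shared := qi L 1\<rparr>) ]
   @ lazy_block True (body P (main P))
   @ [ Assume None (\<lambda>_. False), Return None ]"

definition lazy_main :: "nat \<Rightarrow> ('s, 'l, 'f, 'q) seq_program \<Rightarrow> ('s, 'g, 'l, 'f, 'h, 'p) lblock" where
  "lazy_main k I =
   [ setl (\<lambda>(V, L). L\<lparr>cnt := 1\<rparr>),
     setg (\<lambda>(V, L). V\<lparr>atom := False\<rparr>),
     Call None (LInit (smain I)) (\<lambda>(V, L). {L'. (shared V, loc L') \<in> sinits I}) keep,
     setl (\<lambda>(V, L). L\<lparr>qi := (qi L)(1 := shared V)\<rparr>),
     While None (Expr (\<lambda>(V, L). cnt L \<le> k))
     [ setg (\<lambda>(V, L). V\<lparr>terminate := False\<rparr>),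
       Call None LinearInt
         (\<lambda>(V, L). {L'. qi L' = qi L \<and> qo L' = (\<lambda>r. qi L (r + 1)) \<and> bound L' = cnt L}) keep,
       setl (\<lambda>(V, L). L\<lparr>cnt := cnt L + 1\<rparr>),
       Ite None (Expr (\<lambda>(V, L). cnt L \<le> k))
         [ setl (\<lambda>(V, L). L\<lparr>qi := (qi L)(cnt L := shared V)\<rparr>) ] [] ] ]"

text \<open>All variables of the sequential program are uninitialised at the start.\<close>

definition lazy_program ::
  "nat \<Rightarrow> ('s, 'g, 'l, 'f, 'p) par_program \<Rightarrow>
   (('s, 'g) lglobals, ('s, 'g, 'l) llocals, ('f, (nat \<times> 'f) option) lname, (nat \<times> 'p) option)
     seq_program" where
  "lazy_program k \<P> =
   \<lparr> sbody = (\<lambda>f. case f of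
        LMain \<Rightarrow> lazy_main k (init \<P>)
      | LInit f \<Rightarrow> map init_com (sbody (init \<P>) f)
      | LinearInt \<Rightarrow> linear_int (merge (procs \<P>))
      | LazyProc h \<Rightarrow> lazy_block False (body (merge (procs \<P>)) h)),
     smain = LMain,
     sinits = UNIV \<rparr>"

text \<open>
  The sequential program simulates a statement when the next statement carries a label of
  a process of the parameterized program.
\<close>

fun simulated ::
  "(('s, 'g) lglobals, ('s, 'g, 'l) llocals, 'f, (nat \<times> 'p) option) conf \<Rightarrow>
   ('s, 'g, 'l, 'p) localized option" where
  "simulated (a, V, (c # cs, L, r) # fs) =
     (case label c of Some x \<Rightarrow> Some (x, glob V, loc L, shared V) | None \<Rightarrow> None)"
| "simulated _ = None"

definition is_lazy ::
  "('s, 'g, 'l, 'f, 'p) par_program \<Rightarrow>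
   (('s, 'g) lglobals, ('s, 'g, 'l) llocals, 'h, (nat \<times> 'p) option) seq_program \<Rightarrow> bool" where
  "is_lazy \<P> Q \<longleftrightarrow>
     (\<forall>c x. seq_reachable Q c \<and> simulated c = Some x \<longrightarrow> localized_reachable \<P> x)"

end

(*
A call of linear_int with inputs q_1, ..., q_b and expected outputs q'_1, ..., q'_(b-1) simulates a
block of consecutive threads in rounds 1, ..., b, entering round r in shared state q_r.  It returns in
shared state t iff some block of threads admits the linear interface (q_1, ..., q_b) |->
(q'_1, ..., q'_(b-1), t): a thread of the block that is not the last one runs on its own inputs, and
its outputs are the inputs of the remaining block.  Stacking linear interfaces column by column (one
column per thread) or row by row (one row per round) is the same, which links the recursion depth of
the lazy program with the rounds of an execution.

For soundness, the stack of a reachable state of the lazy program decomposes into one segment per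
thread; the callers have run their first j rounds, j being the current round of the topmost thread,
and the last call from that thread which returned is an interface for all later threads in the
first j - 1 rounds.  Since the outputs for these rounds were checked, all threads together form
a real execution, interrupted in round j.  For completeness, the lazy program replays every round
with the choices of the given execution.
*)

theory Submission
  imports Defs
begin

text \<open>An execution and a run of the lazy program do not advance in step: at each switch of a
  thread the lazy program starts all later threads afresh and simulates their rounds again from the
  first. These repetitions may make other choices and may even involve another number of threads.
  This does no harm, because a finished call leaves nothing but an interface behind, and the next
  call from the same thread, with a larger bound, yields an interface for the earlier rounds as
  well, so the older one can be forgotten. Interfaces are therefore existential in the threads, and
  callers with different bounds are matched by truncation to fewer rounds. The output of the last
  round of a call is special: it is left in the shared variables and is compared with the expected
  one by the caller only, or passed on once more if the caller has reached its own bound. Merging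
  adds one mismatch: a merged thread may be stopped before it has chosen a process, and then it
  corresponds to no thread of the program.\<close>

lemma step_simps:
  "step B (a, v, (Update p u # cs, l, r) # fs) c \<longleftrightarrow> (\<exists>v' l'. (v', l') \<in> u (v, l) \<and> c = (a, v', (cs, l', r) # fs))"
  "step B (a, v, (Assume p b # cs, l, r) # fs) c \<longleftrightarrow> b (v, l) \<and> c = (a, v, (cs, l, r) # fs)"
  "step B (a, v, (Assert p b # cs, l, r) # fs) c \<longleftrightarrow> b (v, l) \<and> c = (a, v, (cs, l, r) # fs)"
  "step B (a, v, (Ite p e xs ys # cs, l, r) # fs) c \<longleftrightarrow>
     may_eval e (v, l) True \<and> c = (a, v, (xs @ cs, l, r) # fs) \<or>
     may_eval e (v, l) False \<and> c = (a, v, (ys @ cs, l, r) # fs)"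
  "step B (a, v, (While p e xs # cs, l, r) # fs) c \<longleftrightarrow>
     may_eval e (v, l) True \<and> c = (a, v, (xs @ While p e xs # cs, l, r) # fs) \<or>
     may_eval e (v, l) False \<and> c = (a, v, (cs, l, r) # fs)"
  "step B (a, v, (BeginAtomic p # cs, l, r) # fs) c \<longleftrightarrow> c = (True, v, (cs, l, r) # fs)"
  "step B (a, v, (EndAtomic p # cs, l, r) # fs) c \<longleftrightarrow> c = (False, v, (cs, l, r) # fs)"
  "step B (a, v, (Call p f args res # cs, l, r) # fs) c \<longleftrightarrow>
     (\<exists>l' \<in> args (v, l). c = (a, v, (B f, l', res) # (cs, l, r) # fs))"
  "step B (a, v, (Return p # cs, l, r) # fs) c \<longleftrightarrow> c = (a, v, pop l r fs)"
  "step B (a, v, ([], l, r) # fs) c \<longleftrightarrow> c = (a, v, pop l r fs)"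
  "step B (a, v, []) c \<longleftrightarrow> False"
  by (auto elim!: step.cases intro: step.intros)

section \<open>Linear interfaces\<close>

text \<open>
  Rounds are numbered from 1, so only the values of \<open>f\<close>, \<open>g\<close>, \<open>h\<close> at \<open>1, \<dots>, n\<close> matter;
  \<open>T u x v y\<close> says that one round leads a thread from \<open>x\<close> to \<open>y\<close> and the shared state from \<open>u\<close> to \<open>v\<close>.
\<close>

fun column :: "('s \<Rightarrow> 't \<Rightarrow> 's \<Rightarrow> 't \<Rightarrow> bool) \<Rightarrow> nat \<Rightarrow> (nat \<Rightarrow> 's) \<Rightarrow> (nat \<Rightarrow> 's) \<Rightarrow> 't \<Rightarrow> 't \<Rightarrow> bool" where
  "column T 0 f g x y \<longleftrightarrow> x = y"
| "column T (Suc n) f g x y \<longleftrightarrow> (\<exists>z. column T n f g x z \<and> T (f (Suc n)) z (g (Suc n)) y)"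

fun linear :: "('s \<Rightarrow> 't \<Rightarrow> 's \<Rightarrow> 't \<Rightarrow> bool) \<Rightarrow> nat \<Rightarrow> (nat \<Rightarrow> 's) \<Rightarrow> (nat \<Rightarrow> 's) \<Rightarrow> 't list \<Rightarrow> 't list \<Rightarrow> bool" where
  "linear T n f h [] [] \<longleftrightarrow> (\<forall>r \<in> {1..n}. f r = h r)"
| "linear T n f h (x # xs) (y # ys) \<longleftrightarrow> (\<exists>g. column T n f g x y \<and> linear T n g h xs ys)"
| "linear T n f h _ _ \<longleftrightarrow> False"

fun row :: "('s \<Rightarrow> 't \<Rightarrow> 's \<Rightarrow> 't \<Rightarrow> bool) \<Rightarrow> 's \<Rightarrow> 's \<Rightarrow> 't list \<Rightarrow> 't list \<Rightarrow> bool" where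
  "row T u v [] [] \<longleftrightarrow> u = v"
| "row T u v (x # xs) (y # ys) \<longleftrightarrow> (\<exists>w. T u x w y \<and> row T w v xs ys)"
| "row T u v _ _ \<longleftrightarrow> False"

lemma column_cong:
  assumes "column T n f g x y" "\<And>r. r \<in> {1..n} \<Longrightarrow> f r = f' r" "\<And>r. r \<in> {1..n} \<Longrightarrow> g r = g' r"
  shows "column T n f' g' x y"
  using assms
proof (induction n arbitrary: y)
  case (Suc n)
  then obtain z where "column T n f g x z" "T (f (Suc n)) z (g (Suc n)) y" by auto
  moreover have "column T n f' g' x z"
    using Suc.prems by (intro Suc.IH[OF \<open>column T n f g x z\<close>]) auto
  ultimately show ?case using Suc.prems(2,3)[of "Suc n"] by auto
qed simp

lemma column_mono:
  "column T n f g x y \<Longrightarrow> m \<le> n \<Longrightarrow> \<exists>z. column T m f g x z"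
proof (induction n arbitrary: y)
  case (Suc n)
  then show ?case by (cases "m = Suc n") auto
qed auto

lemma linear_length: "linear T n f h xs ys \<Longrightarrow> length ys = length xs"
  by (induction T n f h xs ys rule: linear.induct) auto

lemma row_length: "row T u v xs ys \<Longrightarrow> length ys = length xs"
  by (induction T u v xs ys rule: row.induct) auto

lemma linear_cong:
  assumes "linear T n f h xs ys" "\<And>r. r \<in> {1..n} \<Longrightarrow> f r = f' r" "\<And>r. r \<in> {1..n} \<Longrightarrow> h r = h' r"
  shows "linear T n f' h' xs ys"
  using assms
proof (induction T n f h xs ys arbitrary: f' rule: linear.induct)
  case (2 T n f h x xs y ys)
  then obtain g where g: "column T n f g x y" "linear T n g h xs ys" by auto
  have "column T n f' g x y" using column_cong[OF g(1)] 2 by auto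
  moreover have "linear T n g h' xs ys" using 2 g by blast
  ultimately show ?case by auto
qed auto

text \<open>What threads do in their first \<open>m\<close> rounds does not depend on later ones;
  this lets an interface with a large bound serve the calls with smaller bounds nested in
  it.\<close>

lemma linear_mono:
  "linear T n f h xs ys \<Longrightarrow> m \<le> n \<Longrightarrow> \<exists>zs. linear T m f h xs zs"
proof (induction T n f h xs ys rule: linear.induct)
  case (1 T n f h)
  then show ?case by (intro exI[of _ "[]"]) auto
next
  case (2 T n f h x xs y ys)
  then obtain g where g: "column T n f g x y" "linear T n g h xs ys" by auto
  from column_mono[OF g(1)] 2 obtain z where "column T m f g x z" by auto
  moreover from 2 g obtain zs where "linear T m g h xs zs" by auto
  ultimately show ?case by (intro exI[of _ "z # zs"]) auto
qed auto

lemma linear_append: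
  assumes "linear T n f g xs ys" "linear T n g h xs' ys'"
  shows "linear T n f h (xs @ xs') (ys @ ys')"
  using assms
proof (induction T n f g xs ys rule: linear.induct)
  case (1 T n f g)
  then show ?case using linear_cong[of T n g h xs' ys' f h] by auto
qed auto

lemma linear_appendE:
  assumes "linear T n f h (xs @ xs') (ys @ ys')" "length ys = length xs"
  obtains g where "linear T n f g xs ys" "linear T n g h xs' ys'"
proof -
  have "\<exists>g. linear T n f g xs ys \<and> linear T n g h xs' ys'"
    using assms(2)[symmetric] assms(1)
  proof (induction xs ys arbitrary: f rule: list_induct2)
    case Nil
    then show ?case by (intro exI[of _ f]) simp
  next
    case (Cons x xs y ys)
    then obtain g where g: "column T n f g x y" "linear T n g h (xs @ xs') (ys @ ys')" by auto
    from Cons.IH[OF g(2)] obtain g' where "linear T n g g' xs ys" "linear T n g' h xs' ys'" by blast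
    with g(1) show ?case by (intro exI[of _ g']) auto
  qed
  then show thesis using that by blast
qed

lemma linear_single: "linear T n f h [x] [y] \<longleftrightarrow> column T n f h x y"
  by (auto intro: column_cong)

lemma linear_0: "linear T 0 f h xs ys \<longleftrightarrow> xs = ys"
  by (induction T "0::nat" f h xs ys rule: linear.induct) auto

text \<open>The exchange of columns and rows. It works because an interface for \<open>n\<close>
  rounds leaves entry \<open>Suc n\<close> of every intermediate valuation free, so that a further
  row can fill it.\<close>

lemma linear_Suc:
  "linear T (Suc n) f h xs ys \<longleftrightarrow> (\<exists>zs. linear T n f h xs zs \<and> row T (f (Suc n)) (h (Suc n)) zs ys)"
proof (induction T n f h xs ys rule: linear.induct)
  case (1 T n f h)
  have "row T u v zs [] \<longleftrightarrow> zs = [] \<and> u = v" for u v zs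
    by (cases zs) auto
  then show ?case by (auto simp: atLeastAtMostSuc_conv)
next
  case (2 T n f h x xs y ys)
  show ?case
  proof
    assume "linear T (Suc n) f h (x # xs) (y # ys)"
    then obtain g z where g: "column T n f g x z" "T (f (Suc n)) z (g (Suc n)) y"
      "linear T (Suc n) g h xs ys" by auto
    with 2 obtain zs where "linear T n g h xs zs" "row T (g (Suc n)) (h (Suc n)) zs ys" by auto
    with g show "\<exists>zs. linear T n f h (x # xs) zs \<and> row T (f (Suc n)) (h (Suc n)) zs (y # ys)"
      by (intro exI[of _ "z # zs"]) auto
  next
    assume "\<exists>zs. linear T n f h (x # xs) zs \<and> row T (f (Suc n)) (h (Suc n)) zs (y # ys)"
    then obtain zs where "linear T n f h (x # xs) zs" "row T (f (Suc n)) (h (Suc n)) zs (y # ys)"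
      by auto
    then obtain z zs' where zs: "zs = z # zs'" by (cases zs) auto
    obtain g w where g: "column T n f g x z" "linear T n g h xs zs'" and
      w: "T (f (Suc n)) z w y" "row T w (h (Suc n)) zs' ys"
      using \<open>linear T n f h (x # xs) zs\<close> \<open>row T (f (Suc n)) (h (Suc n)) zs (y # ys)\<close> zs by auto
    \<comment> \<open>\<open>w\<close> is the shared state between the first thread and the others
      in the new round; this entry does not affect the first \<open>n\<close> rounds.\<close>
    let ?g = "g(Suc n := w)"
    have "column T n f ?g x z" by (rule column_cong[OF g(1)]) auto
    moreover have "linear T n ?g h xs zs'" by (rule linear_cong[OF g(2)]) auto
    moreover have "linear T (Suc n) ?g h xs ys"
      using 2 \<open>linear T n ?g h xs zs'\<close> w by (metis fun_upd_same)
    ultimately show "linear T (Suc n) f h (x # xs) (y # ys)" using w by (auto intro!: exI[of _ ?g])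
  qed
next
  case ("3_1" T n f h v va)
  then show ?case by (auto dest: linear_length row_length)
next
  case ("3_2" T n f h v va)
  then show ?case by (auto dest: linear_length row_length)
qed

lemma row_append:
  "row T u v (xs @ xs') (ys @ ys') \<longleftrightarrow> (\<exists>w. row T u w xs ys \<and> row T w v xs' ys')" if "length ys = length xs"
  using that[symmetric] by (induction xs ys arbitrary: u rule: list_induct2) auto

section \<open>Executions and linear interfaces\<close>

text \<open>The empty stack means that the block has terminated. The flag is forgotten because
  \<open>spawn\<close> accepts either value and continues with \<open>False\<close>.\<close>

definition init_final :: "('s, 'l, 'f, 'p) seq_program \<Rightarrow> 's \<Rightarrow> bool" where
  "init_final I s \<longleftrightarrow> (\<exists>a. seq_reachable I (a, s, []))"

text \<open>A thread is a triple of process index, global valuation and stack. Both ends of a round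
  carry the flag \<open>False\<close>, since no switch is possible inside an atomic block.\<close>

definition pround where
  "pround \<P> u x v y \<longleftrightarrow> fst y = fst x \<and>
     (step (body (procs \<P> ! fst x)))\<^sup>*\<^sup>* (False, (u, fst (snd x)), snd (snd x)) (False, (v, fst (snd y)), snd (snd y))"

definition pinitial where
  "pinitial \<P> = {(n, x). n < length (procs \<P>) \<and> x \<in> thread_initial (procs \<P> ! n)}"

text \<open>No thread has been activated yet when \<open>w = []\<close>, so readiness cannot refer to an active thread.\<close>

definition ready where
  "ready \<P> pm w s ts \<longleftrightarrow> (\<forall>i < length pm. execution \<P> (w @ [i]) (Running pm i False s ts))"

lemma execution_Initializing:
  "execution \<P> w (Initializing c) \<longleftrightarrow> w = [] \<and> seq_reachable (init \<P>) c"
proof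
  show "w = [] \<and> seq_reachable (init \<P>) c" if "execution \<P> w (Initializing c)"
    using that
  proof (induction w "Initializing c :: ('a, 'b, 'c, 'd, 'e) state" arbitrary: c rule: execution.induct)
    case (start c)
    then show ?case by (auto simp: seq_reachable_def)
  next
    case (init_step w c c')
    then show ?case by (auto simp: seq_reachable_def intro: rtranclp.rtrancl_into_rtrancl)
  qed
next
  assume "w = [] \<and> seq_reachable (init \<P>) c"
  then obtain c0 where c0: "c0 \<in> seq_initial (init \<P>)" "(step (sbody (init \<P>)))\<^sup>*\<^sup>* c0 c" and "w = []"
    by (auto simp: seq_reachable_def)
  from c0(2) have "execution \<P> [] (Initializing c)"
    by induction (use execution.start[OF c0(1)] execution.init_step in blast)+
  then show "execution \<P> w (Initializing c)" using \<open>w = []\<close> by simp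
qed

section \<open>From interfaces to executions\<close>

lemma execution_run:
  assumes "execution \<P> w (Running pm i a s ts)" "i < length ts" "ts ! i = (g, fs)"
    "(step (body (procs \<P> ! (pm ! i))))\<^sup>*\<^sup>* (a, (s, g), fs) (a', (s', g'), fs')"
  shows "execution \<P> w (Running pm i a' s' (ts[i := (g', fs')]))"
  using assms(4)
proof (induction "(a', (s', g'), fs')" arbitrary: a' s' g' fs' rule: rtranclp_induct)
  case base
  then show ?case using assms(1-3) by (metis list_update_id)
next
  case (step y)
  obtain a1 s1 g1 fs1 where y: "y = (a1, (s1, g1), fs1)" by (cases y) auto
  have "execution \<P> w (Running pm i a1 s1 (ts[i := (g1, fs1)]))" using step y by simp
  from execution.thread_step[OF this _ step(2)[unfolded y]] assms(2) show ?case by simp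
qed

text \<open>Induction on the threads that still have to run: the first of them, at position
  \<open>length A\<close>, runs its round, and \<open>switch\<close> makes every thread ready again.
  Generalizing over \<open>A\<close> moves the finished thread into the prefix.\<close>

lemma ready_row:
  assumes "ready \<P> (map fst (A @ xs @ C)) w u (map snd (A @ xs @ C))" "row (pround \<P>) u v xs ys"
  shows "map fst ys = map fst xs \<and>
    ready \<P> (map fst (A @ xs @ C)) (w @ [length A..<length A + length xs]) v (map snd (A @ ys @ C))"
  using assms
proof (induction xs arbitrary: A w u ys)
  case Nil
  then show ?case by (cases ys) auto
next
  case (Cons x xs A w u ys')
  obtain n g fs where x: "x = (n, g, fs)" by (cases x)
  from Cons.prems(2) obtain y ys u' where ys': "ys' = y # ys"
    and u': "pround \<P> u x u' y" "row (pround \<P>) u' v xs ys" by (cases ys') auto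
  then obtain g' fs' where y: "y = (n, g', fs')"
    and run: "(step (body (procs \<P> ! n)))\<^sup>*\<^sup>* (False, (u, g), fs) (False, (u', g'), fs')"
    by (cases y) (auto simp: pround_def x)
  let ?pm = "map fst (A @ (x # xs) @ C)" and ?ts = "map snd (A @ (x # xs) @ C)"
  have pm: "?pm = map fst ((A @ [y]) @ xs @ C)" by (simp add: x y)
  have 1: "execution \<P> (w @ [length A]) (Running ?pm (length A) False u ?ts)"
    using Cons.prems(1) by (simp add: ready_def)
  have 2: "length A < length ?ts" "?ts ! length A = (g, fs)" "?pm ! length A = n"
    by (simp_all add: x nth_append)
  have "execution \<P> (w @ [length A]) (Running ?pm (length A) False u' (?ts[length A := (g', fs')]))"
    using run by (intro execution_run[OF 1 2(1,2)]) (simp only: 2(3))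
  moreover have "?ts[length A := (g', fs')] = map snd ((A @ [y]) @ xs @ C)"
    by (simp add: y list_update_append)
  ultimately have "execution \<P> (w @ [length A]) (Running ?pm (length A) False u' (map snd ((A @ [y]) @ xs @ C)))"
    by (simp only:)
  then have "ready \<P> ?pm (w @ [length A]) u' (map snd ((A @ [y]) @ xs @ C))"
    unfolding ready_def by (metis execution.switch)
  moreover have "[length A..<length A + length (x # xs)] = length A # [length (A @ [y])..<length (A @ [y]) + length xs]"
    by (simp add: upt_conv_Cons del: upt_Suc)
  ultimately show ?case
    using Cons.IH[OF _ u'(2), of "A @ [y]" "w @ [length A]"] by (simp add: x y ys')
qed

text \<open>The output of round \<open>r\<close> is the input of round \<open>Suc r\<close>, so the
  rows can be run one after another without a gap. Threads are numbered in the order of the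
  schedule.\<close>

lemma ready_rounds:
  assumes "init_final (init \<P>) (q 1)" "set xs \<subseteq> pinitial \<P>"
    "linear (pround \<P>) n q (\<lambda>r. q (Suc r)) xs ys"
  shows "map fst ys = map fst xs \<and>
    ready \<P> (map fst xs) (concat (replicate n [0..<length xs])) (q (Suc n)) (map snd ys)"
  using assms(3)
proof (induction n arbitrary: ys)
  case 0
  from assms(1) obtain a where "execution \<P> [] (Initializing (a, q 1, []))"
    by (auto simp: init_final_def execution_Initializing)
  then have "execution \<P> ([] @ [i]) (Running (map fst xs) i False (q 1) (map snd xs))"
    if "i < length xs" for i
  proof (rule execution.spawn)
    have "xs ! t \<in> pinitial \<P>" if "t < length xs" for t
      using assms(2) that nth_mem by blast
    then show "\<forall>t<length (map fst xs). map fst xs ! t < length (procs \<P>) \<and>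
        map snd xs ! t \<in> thread_initial (procs \<P> ! (map fst xs ! t))"
      by (auto simp: pinitial_def split_beta)
  qed (use that in auto)
  then show ?case using 0 by (auto simp: linear_0 ready_def)
next
  case (Suc n)
  then obtain zs where zs: "linear (pround \<P>) n q (\<lambda>r. q (Suc r)) xs zs"
    "row (pround \<P>) (q (Suc n)) (q (Suc (Suc n))) zs ys" unfolding linear_Suc by auto
  have "concat (replicate (Suc n) [0..<length xs]) = concat (replicate n [0..<length xs]) @ [0..<length xs]"
    by (simp flip: replicate_append_same)
  with ready_row[of \<P> "[]" zs "[]" _ "q (Suc n)"] zs(2) Suc.IH[OF zs(1)]
    linear_length[OF zs(1)] show ?case by auto
qed

text \<open>The threads \<open>xs\<close> have finished round \<open>Suc j\<close>, the thread
  started as \<open>x0\<close> is interrupted in it, and \<open>zs\<close> have finished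
  \<open>j\<close> rounds. The first \<open>j\<close> rounds of all of them are complete rounds; the
  last row of \<open>xs\<close> and the partial run are appended.\<close>

lemma execution_of_linear:
  fixes \<P> :: "('s, 'g, 'l, 'f, 'p) par_program"
  assumes "init_final (init \<P>) (q 1)" "set xs \<subseteq> pinitial \<P>" "x0 \<in> pinitial \<P>" "set zs \<subseteq> pinitial \<P>"
    "linear (pround \<P>) (Suc j) q p xs ys" "column (pround \<P>) j p p' x0 (n, g0, fs0)"
    "linear (pround \<P>) j p' (\<lambda>r. q (Suc r)) zs zs'"
    "(step (body (procs \<P> ! n)))\<^sup>*\<^sup>* (False, (p (Suc j), g0), fs0) (a, (s, g), fs)" "Suc j \<le> k"
  obtains w pm i ts where "execution \<P> w (Running pm i a s ts)" "k_round_schedule k (length pm) w"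
    "pm ! i = n" "ts ! i = (g, fs)"
proof -
  obtain xs' where xs': "linear (pround \<P>) j q p xs xs'" "row (pround \<P>) (q (Suc j)) (p (Suc j)) xs' ys"
    using assms(5) unfolding linear_Suc by auto
  let ?x = "(n, g0, fs0)"
  define m where "m = length (xs @ x0 # zs)"
  let ?w = "concat (replicate j [0..<m])"
  have len: "length xs' = length xs" "length ys = length xs" "length zs' = length zs"
    using linear_length[OF xs'(1)] row_length[OF xs'(2)] linear_length[OF assms(7)] by auto
  \<comment> \<open>Gluing of the first \<open>j\<close> rounds: \<open>p\<close> and
    \<open>p'\<close> are the interfaces to the left and to the right of the interrupted
    thread.\<close>
  have "linear (pround \<P>) j q (\<lambda>r. q (Suc r)) (xs @ [x0] @ zs) (xs' @ [?x] @ zs')"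
    by (rule linear_append[OF xs'(1) linear_append[OF _ assms(7)]]) (simp only: linear_single assms(6))
  then have lin: "linear (pround \<P>) j q (\<lambda>r. q (Suc r)) (xs @ x0 # zs) (xs' @ ?x # zs')" by simp
  have "set (xs @ x0 # zs) \<subseteq> pinitial \<P>" using assms(2-4) by simp
  from ready_rounds[OF assms(1) this lin]
  have fst: "map fst (xs' @ ?x # zs') = map fst (xs @ x0 # zs)"
    and rdy: "ready \<P> (map fst (xs @ x0 # zs)) ?w (q (Suc j)) (map snd (xs' @ ?x # zs'))"
    unfolding m_def by blast+
  from rdy[folded fst] have "ready \<P> (map fst ([] @ xs' @ ?x # zs')) ?w (q (Suc j)) (map snd ([] @ xs' @ ?x # zs'))"
    by (simp only: append_Nil)
  from ready_row[OF this xs'(2)]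
  have "ready \<P> (map fst (xs' @ ?x # zs')) (?w @ [0..<length xs]) (p (Suc j)) (map snd (ys @ ?x # zs'))"
    by (simp add: len)
  then have ex: "execution \<P> ((?w @ [0..<length xs]) @ [length xs])
      (Running (map fst (xs' @ ?x # zs')) (length xs) False (p (Suc j)) (map snd (ys @ ?x # zs')))"
    unfolding ready_def by (rule allE[of _ "length xs"]) (simp add: len)
  have "execution \<P> ((?w @ [0..<length xs]) @ [length xs])
      (Running (map fst (xs' @ ?x # zs')) (length xs) a s ((map snd (ys @ ?x # zs'))[length xs := (g, fs)]))"
    by (rule execution_run[OF ex]) (use assms(8) len in \<open>simp_all add: nth_append\<close>)
  moreover have "k_round_schedule k m ((?w @ [0..<length xs]) @ [length xs])"
    unfolding k_round_schedule_def
  proof (intro exI[of _ "[0..<m]"] conjI)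
    have "replicate k [0..<m] = replicate j [0..<m] @ [0..<m] # replicate (k - Suc j) [0..<m]"
      using assms(9) replicate_add[of j "Suc (k - Suc j)" "[0..<m]"] by auto
    then have "concat (replicate k [0..<m]) = ?w @ [0..<m] @ concat (replicate (k - Suc j) [0..<m])"
      by simp
    moreover have "[0..<m] = ([0..<length xs] @ [length xs]) @ [Suc (length xs)..<m]"
      using upt_add_eq_append[of 0 "Suc (length xs)" "length zs"] by (simp add: m_def)
    ultimately have "concat (replicate k [0..<m]) = ((?w @ [0..<length xs]) @ [length xs]) @
      [Suc (length xs)..<m] @ concat (replicate (k - Suc j) [0..<m])"
      by (simp only: append.assoc)
    then show "prefix ((?w @ [0..<length xs]) @ [length xs]) (concat (replicate k [0..<m]))"
      by (rule prefixI)
  qed (auto simp: m_def)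
  moreover have "m = length (map fst (xs' @ ?x # zs'))" using len by (simp add: m_def)
  ultimately show thesis
    by (intro that[of _ "map fst (xs' @ ?x # zs')" "length xs" "(map snd (ys @ ?x # zs'))[length xs := (g, fs)]"])
      (simp_all add: nth_append len)
qed

text \<open>
  The threads, listed in the order of the schedule, are about to run \<open>Y @ x # Z\<close> at the beginning of
  the current round; \<open>Y\<close> has completed it and \<open>x\<close> is active.
\<close>

definition in_round where
  "in_round \<P> k ord w pm i a s ts \<longleftrightarrow>
    (\<exists>j q X Y n g0 fs0 Z u Y' g fs. Suc j \<le> k \<and> init_final (init \<P>) (q 1) \<and> set X \<subseteq> pinitial \<P> \<and>
      linear (pround \<P>) j q (\<lambda>r. q (Suc r)) X (Y @ (n, g0, fs0) # Z) \<and>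
      row (pround \<P>) (q (Suc j)) u Y Y' \<and>
      (step (body (procs \<P> ! n)))\<^sup>*\<^sup>* (False, (u, g0), fs0) (a, (s, g), fs) \<and>
      i = ord ! length Y \<and> w = concat (replicate j ord) @ take (Suc (length Y)) ord \<and>
      length ts = length pm \<and> length Y < length ord \<and>
      map (\<lambda>t. (pm ! t, ts ! t)) ord = Y' @ (n, g, fs) # Z)"

section \<open>From executions to interfaces\<close>

lemma in_roundI:
  assumes "Suc j \<le> k" "init_final (init \<P>) (q 1)" "set X \<subseteq> pinitial \<P>"
    "linear (pround \<P>) j q (\<lambda>r. q (Suc r)) X (Y @ (n, g0, fs0) # Z)"
    "row (pround \<P>) (q (Suc j)) u Y Y'"
    "(step (body (procs \<P> ! n)))\<^sup>*\<^sup>* (False, (u, g0), fs0) (a, (s, g), fs)"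
    "i = ord ! length Y" "w = concat (replicate j ord) @ take (Suc (length Y)) ord"
    "length ts = length pm" "length Y < length ord"
    "map (\<lambda>t. (pm ! t, ts ! t)) ord = Y' @ (n, g, fs) # Z"
  shows "in_round \<P> k ord w pm i a s ts"
  unfolding in_round_def using assms by blast

text \<open>Induction on the execution. The prefix condition dictates which thread is activated
  next: the successor in \<open>ord\<close>, or the first thread of the following round when
  \<open>ord\<close> is exhausted.\<close>

lemma execution_in_round:
  assumes "execution \<P> w (Running pm i a s ts)" "distinct ord" "set ord = {..<length pm}"
    "prefix w (concat (replicate k ord))"
  shows "in_round \<P> k ord w pm i a s ts"
  using assms
proof (induction w "Running pm i a s ts" arbitrary: i a s ts rule: execution.induct)
  case (spawn w b s ts i)
  have w: "w = []" and ini: "init_final (init \<P>) s"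
    using spawn.hyps(1) by (auto simp: execution_Initializing init_final_def)
  have "ord \<noteq> []" using spawn.hyps(4) spawn.prems(2) by (metis empty_set lessThan_iff empty_iff)
  then obtain o1 ord' where ord: "ord = o1 # ord'" by (cases ord) simp_all
  have pre: "prefix [i] (concat (replicate k ord))" using spawn.prems(3) w by simp
  then obtain k' where k: "k = Suc k'" by (cases k) simp_all
  have i: "i = o1" using pre by (simp add: ord k)
  define X where "X = map (\<lambda>t. (pm ! t, ts ! t)) ord"
  have X: "X = [] @ (pm ! o1, fst (ts ! o1), snd (ts ! o1)) # map (\<lambda>t. (pm ! t, ts ! t)) ord'"
    by (simp add: X_def ord)
  have "set X \<subseteq> pinitial \<P>"
    unfolding X_def set_map spawn.prems(2) using spawn.hyps(3) by (simp add: pinitial_def image_subset_iff)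
  moreover have "linear (pround \<P>) 0 (\<lambda>_. s) (\<lambda>r. (\<lambda>_. s) (Suc r)) X
      ([] @ (pm ! o1, fst (ts ! o1), snd (ts ! o1)) # map (\<lambda>t. (pm ! t, ts ! t)) ord')"
    unfolding linear_0 by (fact X)
  ultimately show ?case
  proof (intro in_roundI[where j = 0 and q = "\<lambda>_. s" and Y = "[]" and X = X and u = s and n = "pm ! o1"
      and ?g0.0 = "fst (ts ! o1)" and ?fs0.0 = "snd (ts ! o1)" and Z = "map (\<lambda>t. (pm ! t, ts ! t)) ord'"])
    show "map (\<lambda>t. (pm ! t, ts ! t)) ord = [] @ (pm ! o1, fst (ts ! o1), snd (ts ! o1)) # map (\<lambda>t. (pm ! t, ts ! t)) ord'"
      using X unfolding X_def .
    show "i = ord ! length []" by (simp add: i ord)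
    show "Suc 0 \<le> k" by (simp add: k)
  qed (use ini spawn.hyps(2) in \<open>simp_all add: ord w i\<close>)
next
  case (thread_step w i a s ts g fs a' s' g' fs')
  then have "in_round \<P> k ord w pm i a s ts" by simp
  then obtain j q X Y n g0 fs0 Z u Y' g1 fs1 where *: "Suc j \<le> k" "init_final (init \<P>) (q 1)" "set X \<subseteq> pinitial \<P>"
      "linear (pround \<P>) j q (\<lambda>r. q (Suc r)) X (Y @ (n, g0, fs0) # Z)"
      "row (pround \<P>) (q (Suc j)) u Y Y'"
      and run: "(step (body (procs \<P> ! n)))\<^sup>*\<^sup>* (False, (u, g0), fs0) (a, (s, g1), fs1)"
      and i: "i = ord ! length Y" and **: "w = concat (replicate j ord) @ take (Suc (length Y)) ord"
      "length ts = length pm" "length Y < length ord"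
      and m: "map (\<lambda>t. (pm ! t, ts ! t)) ord = Y' @ (n, g1, fs1) # Z"
    unfolding in_round_def by blast
  have len: "length Y' = length Y" using row_length[OF *(5)] .
  have "map (\<lambda>t. (pm ! t, ts ! t)) ord ! length Y = (pm ! i, g, fs)"
    using **(3) i thread_step.hyps(3) by simp
  then have n: "n = pm ! i" "g1 = g" "fs1 = fs" unfolding m by (auto simp: nth_append len)
  have "(step (body (procs \<P> ! n)))\<^sup>*\<^sup>* (False, (u, g0), fs0) (a', (s', g'), fs')"
    using run thread_step.hyps(4) unfolding n by (rule rtranclp.rtrancl_into_rtrancl)
  moreover have "map (\<lambda>t. (pm ! t, ts[i := (g', fs')] ! t)) ord = Y' @ (n, g', fs') # Z"
  proof -
    have "i < length ts" using i **(2,3) thread_step.prems(2) nth_mem by fastforce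
    \<comment> \<open>As \<open>ord\<close> is distinct, the update at \<open>i\<close> is visible
      at position \<open>length Y\<close> only.\<close>
    have "map (\<lambda>t. (pm ! t, ts[i := (g', fs')] ! t)) ord =
      (map (\<lambda>t. (pm ! t, ts ! t)) ord)[length Y := (n, g', fs')]"
      by (rule nth_equalityI) (use \<open>i < length ts\<close> **(3) thread_step.prems(1) in
        \<open>auto simp: i n nth_list_update nth_eq_iff_index_eq\<close>)
    then show ?thesis by (simp add: m len list_update_append)
  qed
  ultimately show ?case
    using i **(1,3) by (intro in_roundI[OF *]) (simp_all add: **(2))
next
  case (switch w i s ts i')
  from switch.prems(3) have "prefix w (concat (replicate k ord))" by (auto elim: append_prefixD)
  with switch have "in_round \<P> k ord w pm i False s ts" by simp
  then obtain j q X Y n g0 fs0 Z u Y' g fs where *: "Suc j \<le> k" "init_final (init \<P>) (q 1)" "set X \<subseteq> pinitial \<P>"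
      and lin: "linear (pround \<P>) j q (\<lambda>r. q (Suc r)) X (Y @ (n, g0, fs0) # Z)"
      and row: "row (pround \<P>) (q (Suc j)) u Y Y'"
      and run: "(step (body (procs \<P> ! n)))\<^sup>*\<^sup>* (False, (u, g0), fs0) (False, (s, g), fs)"
      and i: "i = ord ! length Y" and w: "w = concat (replicate j ord) @ take (Suc (length Y)) ord"
      and len: "length ts = length pm" "length Y < length ord"
      and m: "map (\<lambda>t. (pm ! t, ts ! t)) ord = Y' @ (n, g, fs) # Z"
    unfolding in_round_def by blast
  have lY: "length Y' = length Y" using row_length[OF row] .
  have row': "row (pround \<P>) (q (Suc j)) s (Y @ [(n, g0, fs0)]) (Y' @ [(n, g, fs)])"
    using row run by (subst row_append) (auto simp: lY pround_def)
  have lo: "length ord = Suc (length Y + length Z)"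
    using arg_cong[OF m, of length] lY by simp
  have "replicate k ord = replicate j ord @ replicate (k - j) ord"
    using *(1) by (simp flip: replicate_add)
  then have pre: "prefix (take (Suc (length Y)) ord @ [i']) (concat (replicate (k - j) ord))"
    using switch.prems(3) by (simp add: w)
  have kj: "replicate (k - j) ord = ord # replicate (k - Suc j) ord"
    using *(1) by (simp add: Suc_diff_le flip: replicate_Suc)
  show ?case
  proof (cases Z)
    \<comment> \<open>The round goes on: the finished thread joins \<open>Y\<close>, and the head of
      \<open>Z\<close>, still in its state from the beginning of the round, becomes active.\<close>
    case (Cons z Z')
    have "ord = take (Suc (length Y)) ord @ drop (Suc (length Y)) ord" by simp
    then have "prefix [i'] (drop (Suc (length Y)) ord @ concat (replicate (k - Suc j) ord))"
      using pre unfolding kj by (metis append.assoc concat.simps(2) same_prefix_prefix)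
    then have i': "i' = ord ! Suc (length Y)" "take (Suc (length Y)) ord @ [i'] = take (Suc (Suc (length Y))) ord"
      using Cons lo by (auto simp: take_Suc_conv_app_nth simp flip: Cons_nth_drop_Suc)
    have "map (\<lambda>t. (pm ! t, ts ! t)) ord ! Suc (length Y) = z"
      unfolding m by (simp add: Cons nth_append lY)
    then have z: "z = (pm ! i', ts ! i')" using Cons lo i' by simp
    have "map (\<lambda>t. (pm ! t, ts ! t)) ord = (Y' @ [(n, g, fs)]) @ (pm ! i', fst (ts ! i'), snd (ts ! i')) # Z'"
      using m by (simp add: Cons z)
    moreover have "linear (pround \<P>) j q (\<lambda>r. q (Suc r)) X ((Y @ [(n, g0, fs0)]) @ (pm ! i', fst (ts ! i'), snd (ts ! i')) # Z')"
      using lin by (simp add: Cons z)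
    ultimately show ?thesis
      using i' len lo by (intro in_roundI[OF * _ row', where n = "pm ! i'" and ?g0.0 = "fst (ts ! i')"
        and ?fs0.0 = "snd (ts ! i')" and Z = Z' and g = "fst (ts ! i')" and fs = "snd (ts ! i')"])
        (simp_all add: Cons w)
  next
    case Nil
    \<comment> \<open>The round is complete. Its final shared state \<open>s\<close> becomes the
      input of the next round, an entry of \<open>q\<close> that has been free so far.\<close>
    let ?q = "q(Suc (Suc j) := s)"
    from lin have "linear (pround \<P>) j ?q (\<lambda>r. ?q (Suc r)) X (Y @ [(n, g0, fs0)])"
      unfolding Nil by (rule linear_cong) auto
    then have lin': "linear (pround \<P>) (Suc j) ?q (\<lambda>r. ?q (Suc r)) X (map (\<lambda>t. (pm ! t, ts ! t)) ord)"
      using row' unfolding linear_Suc m Nil by auto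
    obtain o1 ord' where ord: "ord = o1 # ord'" using lo by (cases ord) auto
    have "take (Suc (length Y)) ord = ord" using lo Nil by simp
    with pre have pre': "prefix [i'] (concat (replicate (k - Suc j) ord))"
      unfolding kj by simp
    then obtain k' where k: "k - Suc j = Suc k'" by (cases "k - Suc j") auto
    have i': "i' = o1" using pre' by (simp add: k ord)
    have "concat (replicate (Suc j) ord) = concat (replicate j ord) @ ord"
      by (simp flip: replicate_append_same)
    then have w': "w @ [i'] = concat (replicate (Suc j) ord) @ take 1 ord"
      using \<open>take (Suc (length Y)) ord = ord\<close> i' by (simp add: w ord)
    have split: "map (\<lambda>t. (pm ! t, ts ! t)) ord = [] @ (pm ! i', fst (ts ! i'), snd (ts ! i')) # map (\<lambda>t. (pm ! t, ts ! t)) ord'"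
      by (simp add: ord i')
    show ?thesis
    proof (rule in_roundI[OF _ _ _ lin'[unfolded split], where g = "fst (ts ! i')" and fs = "snd (ts ! i')"])
      show "Suc (Suc j) \<le> k" using k by simp
      show "init_final (init \<P>) (?q 1)" using *(2) by simp
      show "row (pround \<P>) (?q (Suc (Suc j))) s [] []" by simp
      show "w @ [i'] = concat (replicate (Suc j) ord) @ take (Suc (length [])) ord"
        using w' by simp
    qed (use *(3) len lo i' ord split in simp_all)
  qed
qed

section \<open>Threads of the merged process\<close>

definition mround where
  "mround M u x v y \<longleftrightarrow>
     (step (body M))\<^sup>*\<^sup>* (False, (u, fst x), snd x) (False, (v, fst y), snd y)"

abbreviation mcom where
  "mcom n \<equiv> map_com (\<lambda>h. Some (n, h)) (\<lambda>p. Some (n, p))"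

fun mframe where
  "mframe n (cs, l, r) = (map (mcom n) cs, l, r)"

fun mthread where
  "mthread (n, g, fs) = (g, map (mframe n) fs)"

abbreviation pick where
  "pick Ps n \<equiv> Update None (\<lambda>((s, g), l). {((s, g'), l') | g' l'. (g', l') \<in> inits (Ps ! n)}) #
     map (mcom n) (body (Ps ! n) (main (Ps ! n)))"

text \<open>A start index other than 0 describes the code that remains after the processes before
  \<open>i\<close> have been declined.\<close>

definition picks where
  "picks Ps i = foldr (\<lambda>n rest. [Ite None Star (pick Ps n) rest]) [i..<length Ps] [Assume None (\<lambda>_. False)]"

lemma picks_simps:
  "i < length Ps \<Longrightarrow> picks Ps i = [Ite None Star (pick Ps i) (picks Ps (Suc i))]"
  "picks Ps (length Ps) = [Assume None (\<lambda>_. False)]"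
  by (auto simp: picks_def upt_conv_Cons)

lemma merge_simps:
  "body (merge Ps) (Some (n, f)) = map (mcom n) (body (Ps ! n) f)"
  "body (merge Ps) None = picks Ps 0"
  "main (merge Ps) = None"
  "inits (merge Ps) = UNIV"
  by (simp_all add: merge_def picks_def Let_def)

lemma pop_mframe: "pop l r (map (mframe n) fs) = map (mframe n) (pop l r fs)"
proof (cases fs)
  case (Cons f fs')
  then show ?thesis by (cases f) simp
qed simp

text \<open>Renaming procedures and labels touches no semantic ingredient of a statement, and a
  renamed call finds the renamed body. The right-hand side also says that a stack of process
  \<open>n\<close> never leaves the image of \<open>map (mframe n)\<close>.\<close>

lemma step_mframe:
  "step (body (merge Ps)) (a, v, map (mframe n) fs) c \<longleftrightarrow>
    (\<exists>a' v' fs'. c = (a', v', map (mframe n) fs') \<and> step (body (Ps ! n)) (a, v, fs) (a', v', fs'))"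
proof (cases fs)
  case Nil
  then show ?thesis by (simp add: step_simps)
next
  case (Cons f fs')
  obtain cs l r where f: "f = (cs, l, r)" by (cases f)
  obtain w m where v: "v = (w, m)" by (cases v)
  show ?thesis
  proof (cases cs)
    case Nil
    then show ?thesis by (auto simp: Cons f v step_simps pop_mframe)
  next
    case (Cons c' cs')
    note cs = this
    show ?thesis
    proof (cases c')
      case (Update p u)
      have "step (body (merge Ps)) (a, v, map (mframe n) fs) c \<longleftrightarrow>
        (\<exists>v' l'. (v', l') \<in> u (v, l) \<and> c = (a, v', map (mframe n) ((cs', l', r) # fs')))"
        by (simp add: \<open>fs = f # fs'\<close> f cs Update step_simps)
      also have "\<dots> \<longleftrightarrow> (\<exists>a' v' fs'. c = (a', v', map (mframe n) fs') \<and> step (body (Ps ! n)) (a, v, fs) (a', v', fs'))"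
        unfolding \<open>fs = f # fs'\<close> f cs Update step_simps by blast
      finally show ?thesis .
    next
      case (Ite p b xs ys)
      have "step (body (merge Ps)) (a, v, map (mframe n) fs) c \<longleftrightarrow>
        may_eval b (v, l) True \<and> c = (a, v, map (mframe n) ((xs @ cs', l, r) # fs')) \<or>
        may_eval b (v, l) False \<and> c = (a, v, map (mframe n) ((ys @ cs', l, r) # fs'))"
        by (simp add: \<open>fs = f # fs'\<close> f cs Ite step_simps)
      also have "\<dots> \<longleftrightarrow> (\<exists>a' v' fs'. c = (a', v', map (mframe n) fs') \<and> step (body (Ps ! n)) (a, v, fs) (a', v', fs'))"
        unfolding \<open>fs = f # fs'\<close> f cs Ite step_simps by blast
      finally show ?thesis .
    next
      case (While p b xs)
      have "step (body (merge Ps)) (a, v, map (mframe n) fs) c \<longleftrightarrow>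
        may_eval b (v, l) True \<and> c = (a, v, map (mframe n) ((xs @ While p b xs # cs', l, r) # fs')) \<or>
        may_eval b (v, l) False \<and> c = (a, v, map (mframe n) ((cs', l, r) # fs'))"
        by (simp add: \<open>fs = f # fs'\<close> f cs While step_simps)
      also have "\<dots> \<longleftrightarrow> (\<exists>a' v' fs'. c = (a', v', map (mframe n) fs') \<and> step (body (Ps ! n)) (a, v, fs) (a', v', fs'))"
        unfolding \<open>fs = f # fs'\<close> f cs While step_simps by blast
      finally show ?thesis .
    next
      case (Call p h args res)
      have "step (body (merge Ps)) (a, v, map (mframe n) fs) c \<longleftrightarrow>
        (\<exists>l' \<in> args (v, l). c = (a, v, map (mframe n) ((body (Ps ! n) h, l', res) # (cs', l, r) # fs')))"
        by (simp add: \<open>fs = f # fs'\<close> f cs Call step_simps merge_simps)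
      also have "\<dots> \<longleftrightarrow> (\<exists>a' v' fs'. c = (a', v', map (mframe n) fs') \<and> step (body (Ps ! n)) (a, v, fs) (a', v', fs'))"
        unfolding \<open>fs = f # fs'\<close> f cs Call step_simps by blast
      finally show ?thesis .
    next
      case (Assume p b)
      have "step (body (merge Ps)) (a, v, map (mframe n) fs) c \<longleftrightarrow>
        b (v, l) \<and> c = (a, v, map (mframe n) ((cs', l, r) # fs'))"
        by (simp add: \<open>fs = f # fs'\<close> f cs Assume step_simps)
      also have "\<dots> \<longleftrightarrow> (\<exists>a' v' fs'. c = (a', v', map (mframe n) fs') \<and> step (body (Ps ! n)) (a, v, fs) (a', v', fs'))"
        unfolding \<open>fs = f # fs'\<close> f cs Assume step_simps by blast
      finally show ?thesis .
    next
      case (Assert p b)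
      have "step (body (merge Ps)) (a, v, map (mframe n) fs) c \<longleftrightarrow>
        b (v, l) \<and> c = (a, v, map (mframe n) ((cs', l, r) # fs'))"
        by (simp add: \<open>fs = f # fs'\<close> f cs Assert step_simps)
      also have "\<dots> \<longleftrightarrow> (\<exists>a' v' fs'. c = (a', v', map (mframe n) fs') \<and> step (body (Ps ! n)) (a, v, fs) (a', v', fs'))"
        unfolding \<open>fs = f # fs'\<close> f cs Assert step_simps by blast
      finally show ?thesis .
    next
      case (BeginAtomic p)
      have "step (body (merge Ps)) (a, v, map (mframe n) fs) c \<longleftrightarrow>
        c = (True, v, map (mframe n) ((cs', l, r) # fs'))"
        by (simp add: \<open>fs = f # fs'\<close> f cs BeginAtomic step_simps)
      also have "\<dots> \<longleftrightarrow> (\<exists>a' v' fs'. c = (a', v', map (mframe n) fs') \<and> step (body (Ps ! n)) (a, v, fs) (a', v', fs'))"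
        unfolding \<open>fs = f # fs'\<close> f cs BeginAtomic step_simps by blast
      finally show ?thesis .
    next
      case (EndAtomic p)
      have "step (body (merge Ps)) (a, v, map (mframe n) fs) c \<longleftrightarrow>
        c = (False, v, map (mframe n) ((cs', l, r) # fs'))"
        by (simp add: \<open>fs = f # fs'\<close> f cs EndAtomic step_simps)
      also have "\<dots> \<longleftrightarrow> (\<exists>a' v' fs'. c = (a', v', map (mframe n) fs') \<and> step (body (Ps ! n)) (a, v, fs) (a', v', fs'))"
        unfolding \<open>fs = f # fs'\<close> f cs EndAtomic step_simps by blast
      finally show ?thesis .
    next
      case (Return p)
      have "step (body (merge Ps)) (a, v, map (mframe n) fs) c \<longleftrightarrow>
        c = (a, v, map (mframe n) (pop l r fs'))"
        by (simp add: \<open>fs = f # fs'\<close> f cs Return step_simps pop_mframe)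
      also have "\<dots> \<longleftrightarrow> (\<exists>a' v' fs'. c = (a', v', map (mframe n) fs') \<and> step (body (Ps ! n)) (a, v, fs) (a', v', fs'))"
        unfolding \<open>fs = f # fs'\<close> f cs Return step_simps by blast
      finally show ?thesis .
    qed
  qed
qed

lemma steps_mframe:
  "(step (body (merge Ps)))\<^sup>*\<^sup>* (a, v, map (mframe n) fs) c \<longleftrightarrow>
    (\<exists>a' v' fs'. c = (a', v', map (mframe n) fs') \<and> (step (body (Ps ! n)))\<^sup>*\<^sup>* (a, v, fs) (a', v', fs'))"
proof
  assume "(step (body (merge Ps)))\<^sup>*\<^sup>* (a, v, map (mframe n) fs) c"
  then show "\<exists>a' v' fs'. c = (a', v', map (mframe n) fs') \<and> (step (body (Ps ! n)))\<^sup>*\<^sup>* (a, v, fs) (a', v', fs')"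
  proof induction
    case base
    then show ?case by blast
  next
    case (step y z)
    then obtain a' v' fs' where y: "y = (a', v', map (mframe n) fs')"
      "(step (body (Ps ! n)))\<^sup>*\<^sup>* (a, v, fs) (a', v', fs')" by blast
    from step.hyps(2) show ?case
      unfolding y(1) step_mframe using rtranclp.rtrancl_into_rtrancl[OF y(2)] by blast
  qed
next
  have *: "(step (body (merge Ps)))\<^sup>*\<^sup>* (a, v, map (mframe n) fs) (a', v', map (mframe n) fs')"
    if "(step (body (Ps ! n)))\<^sup>*\<^sup>* (a, v, fs) (a', v', fs')" for a' v' fs'
    using that
  proof (induction "(a', v', fs')" arbitrary: a' v' fs' rule: rtranclp_induct)
    case (step y)
    obtain a1 v1 fs1 where y: "y = (a1, v1, fs1)" by (cases y)
    have "step (body (merge Ps)) (a1, v1, map (mframe n) fs1) (a', v', map (mframe n) fs')"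
      using step(2) unfolding y step_mframe by blast
    with step(3)[OF y] show ?case by (rule rtranclp.rtrancl_into_rtrancl)
  qed simp
  assume "\<exists>a' v' fs'. c = (a', v', map (mframe n) fs') \<and> (step (body (Ps ! n)))\<^sup>*\<^sup>* (a, v, fs) (a', v', fs')"
  with * show "(step (body (merge Ps)))\<^sup>*\<^sup>* (a, v, map (mframe n) fs) c" by blast
qed

section \<open>Removing the choice of a process\<close>

definition unpicked where
  "unpicked Ps fs \<longleftrightarrow> (\<exists>l cs. fs = [(cs, l, keep)] \<and>
     ((\<exists>i \<le> length Ps. cs = picks Ps i) \<or> (\<exists>n < length Ps. cs = pick Ps n)))"

text \<open>Accepting or declining a process changes no data; the update after it writes only the
  thread's own valuations and leaves the stack of a freshly started process.\<close>

lemma unpicked_step: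
  assumes "unpicked Ps fs" "step (body (merge Ps)) (a, (u, g), fs) (a', (v, g'), fs')"
  shows "a' = a \<and> v = u \<and> (unpicked Ps fs' \<or>
    (\<exists>n < length Ps. \<exists>fs0. (g', fs0) \<in> thread_initial (Ps ! n) \<and> fs' = map (mframe n) fs0))"
proof -
  from assms(1) consider l where "fs = [(picks Ps (length Ps), l, keep)]"
    | l i where "i < length Ps" "fs = [(picks Ps i, l, keep)]"
    | l n where "n < length Ps" "fs = [(pick Ps n, l, keep)]"
    unfolding unpicked_def le_less by blast
  then show ?thesis
  proof cases
    case 1
    then show ?thesis using assms(2) by (simp add: picks_simps step_simps)
  next
    case 2
    then have "a' = a \<and> v = u \<and> (fs' = [(pick Ps i, l, keep)] \<or> fs' = [(picks Ps (Suc i), l, keep)])"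
      using assms(2) by (simp add: picks_simps(1) step_simps) blast
    moreover have "unpicked Ps [(pick Ps i, l, keep)]" "unpicked Ps [(picks Ps (Suc i), l, keep)]"
      using 2(1) Suc_leI[OF 2(1)] unfolding unpicked_def by blast+
    ultimately show ?thesis by auto
  next
    case 3
    then obtain l' where "a' = a" "v = u" "(g', l') \<in> inits (Ps ! n)"
      "fs' = map (mframe n) [(body (Ps ! n) (main (Ps ! n)), l', keep)]"
      using assms(2) by (auto simp: step_simps)
    then show ?thesis using 3 unfolding thread_initial_def by blast
  qed
qed

text \<open>Cuts a run of a merged thread at its choice: the part before it leaves the shared state
  at \<open>u\<close>, and the part after it is a run of the chosen process from an initial
  state.\<close>

lemma unpicked_steps:
  assumes "(step (body (merge Ps)))\<^sup>*\<^sup>* (a, (u, g), fs) c" "unpicked Ps fs" "c = (a', (v, g'), fs')"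
  shows "a' = a \<and> v = u \<and> unpicked Ps fs' \<or>
    (\<exists>n < length Ps. \<exists>g0 fs0 fs''. (g0, fs0) \<in> thread_initial (Ps ! n) \<and>
       (step (body (Ps ! n)))\<^sup>*\<^sup>* (a, (u, g0), fs0) (a', (v, g'), fs'') \<and> fs' = map (mframe n) fs'')"
  using assms
proof (induction arbitrary: a' v g' fs' rule: rtranclp_induct)
  case base
  then show ?case by simp
next
  case (step y z)
  obtain a1 v1 g1 fs1 where y: "y = (a1, (v1, g1), fs1)" by (cases y) auto
  from step.IH[OF step.prems(1) y] show ?case
  proof (elim disjE exE conjE)
    assume *: "a1 = a" "v1 = u" "unpicked Ps fs1"
    have "step (body (merge Ps)) (a, (u, g1), fs1) (a', (v, g'), fs')"
      using step.hyps(2) step.prems(2) *(1,2) y by simp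
    from unpicked_step[OF *(3) this] show ?thesis
    proof (elim disjE exE conjE)
      fix n fs0
      assume "a' = a" "v = u" "n < length Ps" "(g', fs0) \<in> thread_initial (Ps ! n)" "fs' = map (mframe n) fs0"
      then show ?thesis by blast
    qed simp
  next
    fix n g0 fs0 fs''
    assume *: "n < length Ps" "(g0, fs0) \<in> thread_initial (Ps ! n)"
      "(step (body (Ps ! n)))\<^sup>*\<^sup>* (a, (u, g0), fs0) (a1, (v1, g1), fs'')" "fs1 = map (mframe n) fs''"
    from step.hyps(2) obtain fs2 where "fs' = map (mframe n) fs2"
      "step (body (Ps ! n)) (a1, (v1, g1), fs'') (a', (v, g'), fs2)"
      unfolding y *(4) step.prems(2) step_mframe by blast
    then show ?thesis using *(1,2) rtranclp.rtrancl_into_rtrancl[OF *(3)] by blast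
  qed
qed

lemma unpicked_initial: "x \<in> thread_initial (merge Ps) \<Longrightarrow> unpicked Ps (snd x)"
  by (auto simp: thread_initial_def merge_simps unpicked_def)

lemma column_idle:
  "(\<And>r. r \<in> {1..n} \<Longrightarrow> f r = g r) \<Longrightarrow> column (pround \<P>) n f g p p"
proof (induction n)
  case (Suc n)
  then have "column (pround \<P>) n f g p p" "f (Suc n) = g (Suc n)" by auto
  moreover have "pround \<P> u p u p" for u by (simp add: pround_def)
  ultimately show ?case by (metis column.simps(2))
qed simp

text \<open>If the choice falls into a late round, the real thread can be taken to idle in all
  earlier ones, because the undecided thread left the shared state as it was.\<close>

lemma column_unmerge:
  assumes "x \<in> thread_initial (merge (procs \<P>))" "column (mround (merge (procs \<P>))) n f g x y"
  shows "unpicked (procs \<P>) (snd y) \<and> (\<forall>r \<in> {1..n}. f r = g r) \<or>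
    (\<exists>p0 \<in> pinitial \<P>. \<exists>p. column (pround \<P>) n f g p0 p \<and> y = mthread p)"
  using assms(2)
proof (induction n arbitrary: y)
  case 0
  then show ?case using unpicked_initial[OF assms(1)] by simp
next
  case (Suc n)
  from Suc.prems obtain z where z: "column (mround (merge (procs \<P>))) n f g x z"
    and "mround (merge (procs \<P>)) (f (Suc n)) z (g (Suc n)) y" by auto
  then have run: "(step (body (merge (procs \<P>))))\<^sup>*\<^sup>* (False, (f (Suc n), fst z), snd z) (False, (g (Suc n), fst y), snd y)"
    by (simp add: mround_def)
  from Suc.IH[OF z] show ?case
  proof (elim disjE conjE bexE exE)
    assume *: "unpicked (procs \<P>) (snd z)" "\<forall>r \<in> {1..n}. f r = g r"
    from unpicked_steps[OF run *(1) refl] show ?thesis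
    proof (elim disjE exE conjE)
      assume "g (Suc n) = f (Suc n)" "unpicked (procs \<P>) (snd y)" 
      then show ?thesis using *(2) by (auto simp: le_Suc_eq)
    next
      fix m g0 fs0 fs''
      assume **: "m < length (procs \<P>)" "(g0, fs0) \<in> thread_initial (procs \<P> ! m)"
        "(step (body (procs \<P> ! m)))\<^sup>*\<^sup>* (False, (f (Suc n), g0), fs0) (False, (g (Suc n), fst y), fs'')"
        "snd y = map (mframe m) fs''"
      have "column (pround \<P>) n f g (m, g0, fs0) (m, g0, fs0)" using column_idle *(2) by blast
      then have "column (pround \<P>) (Suc n) f g (m, g0, fs0) (m, fst y, fs'')"
        using **(3) by (auto simp: pround_def)
      moreover have "y = mthread (m, fst y, fs'')" using **(4) by (cases y) simp
      moreover have "(m, g0, fs0) \<in> pinitial \<P>" using ** by (simp add: pinitial_def)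
      ultimately show ?thesis by blast
    qed
  next
    fix p0 p
    assume *: "p0 \<in> pinitial \<P>" "column (pround \<P>) n f g p0 p" "z = mthread p"
    obtain m g1 fs1 where p: "p = (m, g1, fs1)" by (cases p)
    from run obtain fs2 where fs2: "snd y = map (mframe m) fs2"
      "(step (body (procs \<P> ! m)))\<^sup>*\<^sup>* (False, (f (Suc n), g1), fs1) (False, (g (Suc n), fst y), fs2)"
      by (auto simp: *(3) p steps_mframe)
    then have "column (pround \<P>) (Suc n) f g p0 (m, fst y, fs2)"
      using *(2) by (auto simp: p pround_def)
    moreover have "y = mthread (m, fst y, fs2)" using fs2(1) by (cases y) simp
    ultimately show ?thesis using *(1) by blast
  qed
qed

text \<open>A thread that has not picked a process yet leaves the shared state alone, so it can be dropped.\<close>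

lemma linear_unmerge:
  assumes "set xs \<subseteq> thread_initial (merge (procs \<P>))" "linear (mround (merge (procs \<P>))) n f h xs ys"
  obtains ps qs where "set ps \<subseteq> pinitial \<P>" "linear (pround \<P>) n f h ps qs"
proof -
  have "\<exists>ps qs. set ps \<subseteq> pinitial \<P> \<and> linear (pround \<P>) n f h ps qs"
    using assms
  proof (induction xs arbitrary: f ys)
    case Nil
    then show ?case by (cases ys) (auto intro!: exI[of _ "[]"])
  next
    case (Cons x xs)
    then obtain y ys' where ys: "ys = y # ys'" by (cases ys) auto
    with Cons.prems obtain g where g: "column (mround (merge (procs \<P>))) n f g x y"
      "linear (mround (merge (procs \<P>))) n g h xs ys'" by auto
    from Cons.IH[OF _ g(2)] Cons.prems(1) obtain ps qs
      where pq: "set ps \<subseteq> pinitial \<P>" "linear (pround \<P>) n g h ps qs" by auto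
    have "x \<in> thread_initial (merge (procs \<P>))" using Cons.prems(1) by simp
    from column_unmerge[OF this g(1)] show ?case
    proof (elim disjE conjE bexE exE)
      assume "\<forall>r\<in>{1..n}. f r = g r"
      then have "linear (pround \<P>) n f h ps qs" by (intro linear_cong[OF pq(2)]) auto
      then show ?thesis using pq(1) by blast
    next
      fix p0 p
      assume "p0 \<in> pinitial \<P>" "column (pround \<P>) n f g p0 p"
      then show ?thesis using pq by (intro exI[of _ "p0 # ps"] exI[of _ "p # qs"]) auto
    qed
  qed
  then show thesis using that by blast
qed

section \<open>Inserting the choice of a process\<close>

definition munstarted where
  "munstarted \<P> = (undefined, [(picks (procs \<P>) 0, undefined, keep)])"

lemma munstarted_initial: "munstarted \<P> \<in> thread_initial (merge (procs \<P>))"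
  by (auto simp: munstarted_def thread_initial_def merge_simps)

text \<open>Before its first round a merged thread cannot have chosen a process. The second
  alternative pairs it with an arbitrary initial thread; the choice is then made at the start of the
  first round.\<close>

definition merged where
  "merged \<P> y p \<longleftrightarrow> y = mthread p \<or> y = munstarted \<P> \<and> p \<in> pinitial \<P>"

lemma picks_steps:
  assumes "i \<le> n" "n < length Ps"
  shows "(step (body (merge Ps)))\<^sup>*\<^sup>* (a, v, (picks Ps i, l, keep) # fs) (a, v, (pick Ps n, l, keep) # fs)"
  using assms
proof (induction i rule: inc_induct)
  case base
  have "step (body (merge Ps)) (a, v, (picks Ps n, l, keep) # fs) (a, v, (pick Ps n, l, keep) # fs)"
    using base by (cases v) (simp add: picks_simps step_simps)
  then show ?case by blast
next
  case (step i)
  have "step (body (merge Ps)) (a, v, (picks Ps i, l, keep) # fs) (a, v, (picks Ps (Suc i), l, keep) # fs)"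
    using step by (cases v) (simp add: picks_simps step_simps)
  then show ?case using step by (meson converse_rtranclp_into_rtranclp)
qed

lemma merged_run:
  assumes "merged \<P> y (n, g0, fs0)" "(step (body (procs \<P> ! n)))\<^sup>*\<^sup>* (a, (u, g0), fs0) (a', (v, g), fs)"
  shows "(step (body (merge (procs \<P>))))\<^sup>*\<^sup>* (a, (u, fst y), snd y) (a', (v, g), map (mframe n) fs)"
proof -
  have 1: "(step (body (merge (procs \<P>))))\<^sup>*\<^sup>* (a, (u, g0), map (mframe n) fs0) (a', (v, g), map (mframe n) fs)"
    using assms(2) unfolding steps_mframe by blast
  from assms(1) show ?thesis
    unfolding merged_def
  proof (elim disjE conjE)
    assume "y = mthread (n, g0, fs0)"
    then show ?thesis using 1 by simp
  next
    assume *: "y = munstarted \<P>" "(n, g0, fs0) \<in> pinitial \<P>"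
    then obtain l where l: "n < length (procs \<P>)" "(g0, l) \<in> inits (procs \<P> ! n)"
      "fs0 = [(body (procs \<P> ! n) (main (procs \<P> ! n)), l, keep)]"
      by (auto simp: pinitial_def thread_initial_def)
    have "(step (body (merge (procs \<P>))))\<^sup>*\<^sup>* (a, (u, fst y), snd y) (a, (u, fst y), [(pick (procs \<P>) n, undefined, keep)])"
      using picks_steps[of 0 n "procs \<P>"] l(1) by (simp add: *(1) munstarted_def)
    also have "step (body (merge (procs \<P>))) (a, (u, fst y), [(pick (procs \<P>) n, undefined, keep)])
      (a, (u, g0), map (mframe n) fs0)"
      using l by (simp add: step_simps)
    also note 1
    finally show ?thesis .
  qed
qed

lemma merged_round:
  "merged \<P> y p \<Longrightarrow> pround \<P> u p v q \<Longrightarrow> mround (merge (procs \<P>)) u y v (mthread q)"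
  using merged_run[of \<P> y "fst p" "fst (snd p)" "snd (snd p)" False u False v "fst (snd q)" "snd (snd q)"]
  by (cases q) (auto simp: pround_def mround_def)

lemma row_merge:
  assumes "row (pround \<P>) u v ps qs" "list_all2 (merged \<P>) ys ps"
  obtains zs where "row (mround (merge (procs \<P>))) u v ys zs" "list_all2 (merged \<P>) zs qs"
proof -
  have "\<exists>zs. row (mround (merge (procs \<P>))) u v ys zs \<and> list_all2 (merged \<P>) zs qs"
    using assms(2,1)
  proof (induction arbitrary: u qs rule: list_all2_induct)
    case Nil
    then show ?case by (cases qs) (auto intro!: exI[of _ "[]"])
  next
    case (Cons y ys p ps)
    from Cons.prems obtain q qs' w where q: "qs = q # qs'" "pround \<P> u p w q" "row (pround \<P>) w v ps qs'"
      by (cases qs) auto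
    from Cons.IH[OF q(3)] obtain zs
      where "row (mround (merge (procs \<P>))) w v ys zs" "list_all2 (merged \<P>) zs qs'" by blast
    then show ?case using merged_round[OF Cons.hyps(1) q(2)]
      by (intro exI[of _ "mthread q # zs"]) (auto simp: q(1) intro: merged_def[THEN iffD2])
  qed
  then show thesis using that by blast
qed

text \<open>Induction on the rounds, row by row, because one round turns the second alternative of
  \<open>merged\<close> into the first. All threads start as the same \<open>munstarted\<close>,
  whatever process they are going to choose.\<close>

lemma linear_merge:
  assumes "set ps \<subseteq> pinitial \<P>" "linear (pround \<P>) n f h ps qs"
  obtains xs ys where "set xs \<subseteq> thread_initial (merge (procs \<P>))"
    "linear (mround (merge (procs \<P>))) n f h xs ys" "list_all2 (merged \<P>) ys qs"
proof -
  let ?xs = "map (\<lambda>_. munstarted \<P>) ps"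
  have "\<exists>ys. linear (mround (merge (procs \<P>))) n f h ?xs ys \<and> list_all2 (merged \<P>) ys qs"
    using assms(2)
  proof (induction n arbitrary: qs)
    case 0
    have "merged \<P> (munstarted \<P>) p" if "p \<in> set ps" for p
      using that assms(1) by (auto simp: merged_def)
    then show ?case using 0 by (auto simp: linear_0 list_all2_conv_all_nth)
  next
    case (Suc n)
    then show ?case unfolding linear_Suc by (meson row_merge)
  qed
  then show thesis using that[of ?xs] munstarted_initial by (auto simp: image_subset_iff)
qed

section \<open>Code of the lazy program\<close>

abbreviation loop_body :: "('s, 'g, 'l, 'f, 'h, 'p) lblock" where
  "loop_body \<equiv> (case inserted of [_, Ite _ _ [While _ _ xs] _] \<Rightarrow> xs)"

definition loop :: "('s, 'g, 'l, 'f, 'h, 'p) lcom" where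
  "loop = While None Star loop_body"

definition switch :: "('s, 'g, 'l, 'f, 'h, 'p) lcom" where
  "switch = hd loop_body"

text \<open>What is left of \<open>switch\<close> when a nested call of \<open>linear_int\<close> returns.\<close>

definition resume :: "('s, 'g, 'l, 'f, 'h, 'p) lcom" where
  "resume = (case loop_body of [Ite _ _ _ ys] \<Rightarrow> last ys)"

lemma inserted_eq:
  "inserted = [Ite None (Expr (\<lambda>(V, L). terminate V)) [Return None] [],
     Ite None (Expr (\<lambda>(V, L). \<not> atom V)) [loop] []]"
  by (simp add: inserted_def loop_def)

lemma loop_eq: "loop = While None Star [switch]"
  by (simp add: inserted_def loop_def switch_def)

lemma switch_eq:
  "switch =
     Ite None (Expr (\<lambda>(V, L). lst L))
       [ Ite None (Expr (\<lambda>(V, L). jj L = bound L))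
           [ setg (\<lambda>(V, L). V\<lparr>terminate := True\<rparr>),
             Return None ]
           [ Assume None (\<lambda>(V, L). qo L (jj L) = shared V),
             setl (\<lambda>(V, L). L\<lparr>jj := jj L + 1\<rparr>),
             setg (\<lambda>(V, L). V\<lparr>shared := qi L (jj L)\<rparr>) ] ]
       [ setl (\<lambda>(V, L). L\<lparr>qi := (qi L)(jj L := shared V)\<rparr>),
         setl (\<lambda>(V, L). L\<lparr>save := glob V\<rparr>),
         Call None LinearInt
           (\<lambda>(V, L). {L'. qi L' = qi L \<and> qo L' = qo L \<and> bound L' = jj L}) keep,
         resume ]"
  by (simp add: inserted_def switch_def resume_def)

lemma resume_eq:
  "resume = Ite None (Expr (\<lambda>(V, L). jj L = bound L))
                 [ Return None ]
                 [ Assume None (\<lambda>(V, L). qo L (jj L) = shared V),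
                   setg (\<lambda>(V, L). V\<lparr>glob := save L\<rparr>),
                   setg (\<lambda>(V, L). V\<lparr>terminate := False\<rparr>),
                   setl (\<lambda>(V, L). L\<lparr>jj := jj L + 1\<rparr>),
                   setg (\<lambda>(V, L). V\<lparr>shared := qi L (jj L)\<rparr>) ]"
  by (simp add: inserted_def resume_def)

text \<open>The code that remains when the inserted code in front of the next statement has been
  passed. In \<open>linear_int\<close> it ends in a blocking assumption, so a simulated thread never
  returns from its main procedure.\<close>

fun rest_code :: "bool \<Rightarrow> ('s \<times> 'g, 'l, 'h, 'p option) block \<Rightarrow> ('s, 'g, 'l, 'f, 'h, 'p) lblock" where
  "rest_code outer [] = (if outer then [Assume None (\<lambda>_. False), Return None] else [])"
| "rest_code outer (c # cs) = lazy_com outer c @ inserted @ rest_code outer cs"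

lemma rest_code_append:
  "concat (map (\<lambda>c. inserted @ lazy_com outer c) xs) @ inserted @ rest_code outer cs =
   inserted @ rest_code outer (xs @ cs)"
  by (induction xs) auto

lemma lazy_block_eq:
  "lazy_block outer cs @ (if outer then [Assume None (\<lambda>_. False), Return None] else []) =
   inserted @ rest_code outer cs"
  using rest_code_append[of outer cs "[]"] by (simp add: lazy_block_def)

lemma lazy_block_False: "lazy_block False cs = inserted @ rest_code False cs"
  using lazy_block_eq[of False cs] by simp

lemma linear_int_eq:
  "linear_int M =
   [ Update None (\<lambda>(V, L). {(V, L\<lparr>lst := b\<rparr>) | b. True}),
     setl (\<lambda>(V, L). L\<lparr>jj := 1\<rparr>),
     Update None (\<lambda>(V, L). {(V\<lparr>glob := g\<rparr>, L\<lparr>loc := l\<rparr>) | g l. (g, l) \<in> inits M}),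
     setg (\<lambda>(V, L). V\<lparr>shared := qi L 1\<rparr>) ] @ inserted @ rest_code True (body M (main M))"
  using lazy_block_eq[of True "body M (main M)"] by (simp add: linear_int_def)

text \<open>\<open>linear_int\<close> is called with \<open>keep\<close>, so its caller finds its
  own control variables again, whereas a translated procedure carries the current values of
  \<open>q\<close>, \<open>j\<close> and \<open>last\<close> back to the frame below.\<close>

definition retn :: "bool \<Rightarrow> ('l \<Rightarrow> 'l \<Rightarrow> 'l) \<Rightarrow> ('s, 'g, 'l) llocals \<Rightarrow> ('s, 'g, 'l) llocals \<Rightarrow> ('s, 'g, 'l) llocals" where
  "retn outer r = (if outer then keep else (\<lambda>L' L. L'\<lparr>loc := r (loc L') (loc L)\<rparr>))"

text \<open>The test \<open>fs = []\<close> singles out the bottom frame, which stems from a call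
  with \<open>keep\<close>. Nothing but \<open>loc\<close> is tied to the original stack: the
  control variables of a frame waiting below another one are overwritten on return.\<close>

fun frames where
  "frames C [] Fs \<longleftrightarrow> Fs = []"
| "frames C ((cs, l, r) # fs) Fs \<longleftrightarrow> (\<exists>L Gs. Fs = (C (fs = []) cs, L, retn (fs = []) r) # Gs \<and>
     loc L = l \<and> frames C fs Gs)"

abbreviation "suspended \<equiv> frames (\<lambda>outer cs. inserted @ rest_code outer cs)"

abbreviation "init_frames \<equiv> frames (\<lambda>_. map init_com)"

lemma may_eval_lift [simp]: "may_eval (lift_guard get b) x t \<longleftrightarrow> may_eval b (get x) t"
  by (cases b) auto

section \<open>Soundness of the lazy program\<close>

text \<open>
  Every path from a safe configuration reaches \<open>Hd\<close> after finitely many steps through configurations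
  that neither violate an assertion nor simulate a statement.  If successors of \<open>Hd\<close> are safe again,
  \<open>Hd\<close> describes all visible reachable configurations, and the points in the middle of the inserted
  code need no invariant of their own.
\<close>

inductive safe for B Hd where
  head: "Hd c \<Longrightarrow> safe B Hd c"
| silent: "\<not> conf_violates c \<Longrightarrow> simulated c = None \<Longrightarrow> (\<And>c'. step B c c' \<Longrightarrow> safe B Hd c') \<Longrightarrow> safe B Hd c"

lemma safe_reachable:
  assumes "(step B)\<^sup>*\<^sup>* c0 c" "Hd c0" "\<And>c c'. Hd c \<Longrightarrow> step B c c' \<Longrightarrow> safe B Hd c'"
  shows "safe B Hd c"
  using assms(1)
proof induction
  case base
  then show ?case using assms(2) by (rule safe.head)
next
  case (step y z)
  from step.IH step.hyps(2) show ?case by cases (auto intro: assms(3))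
qed

lemma safe_update:
  "(\<And>v' l'. (v', l') \<in> u (v, l) \<Longrightarrow> safe B Hd (a, v', (cs, l', r) # fs)) \<Longrightarrow>
   safe B Hd (a, v, (Update None u # cs, l, r) # fs)"
  by (rule safe.silent) (auto simp: step_simps)

lemma safe_assume:
  "(b (v, l) \<Longrightarrow> safe B Hd (a, v, (cs, l, r) # fs)) \<Longrightarrow> safe B Hd (a, v, (Assume None b # cs, l, r) # fs)"
  by (rule safe.silent) (auto simp: step_simps)

lemma safe_ite:
  "(may_eval b (v, l) True \<Longrightarrow> safe B Hd (a, v, (xs @ cs, l, r) # fs)) \<Longrightarrow>
   (may_eval b (v, l) False \<Longrightarrow> safe B Hd (a, v, (ys @ cs, l, r) # fs)) \<Longrightarrow>
   safe B Hd (a, v, (Ite None b xs ys # cs, l, r) # fs)"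
  by (rule safe.silent) (auto simp: step_simps)

lemma safe_call:
  "(\<And>l'. l' \<in> args (v, l) \<Longrightarrow> safe B Hd (a, v, (B f, l', res) # (cs, l, r) # fs)) \<Longrightarrow>
   safe B Hd (a, v, (Call None f args res # cs, l, r) # fs)"
  by (rule safe.silent) (auto simp: step_simps)

lemma safe_return:
  "safe B Hd (a, v, pop l r fs) \<Longrightarrow> safe B Hd (a, v, (Return None # cs, l, r) # fs)"
  by (rule safe.silent) (auto simp: step_simps)

lemma safe_end:
  "safe B Hd (a, v, pop l r fs) \<Longrightarrow> safe B Hd (a, v, ([], l, r) # fs)"
  by (rule safe.silent) (auto simp: step_simps)

abbreviation main_body :: "nat \<Rightarrow> ('s, 'g, 'l, 'f, 'h, 'p) lblock" where
  "main_body k \<equiv> [ setg (\<lambda>(V, L). V\<lparr>terminate := False\<rparr>),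
       Call None LinearInt
         (\<lambda>(V, L). {L'. qi L' = qi L \<and> qo L' = (\<lambda>r. qi L (r + 1)) \<and> bound L' = cnt L}) keep,
       setl (\<lambda>(V, L). L\<lparr>cnt := cnt L + 1\<rparr>),
       Ite None (Expr (\<lambda>(V, L). cnt L \<le> k))
         [ setl (\<lambda>(V, L). L\<lparr>qi := (qi L)(cnt L := shared V)\<rparr>) ] [] ]"

abbreviation main_loop :: "nat \<Rightarrow> ('s, 'g, 'l, 'f, 'h, 'p) lcom" where
  "main_loop k \<equiv> While None (Expr (\<lambda>(V, L). cnt L \<le> k)) (main_body k)"

lemma lazy_main_eq:
  "lazy_main k I =
   [ setl (\<lambda>(V, L). L\<lparr>cnt := 1\<rparr>),
     setg (\<lambda>(V, L). V\<lparr>atom := False\<rparr>),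
     Call None (LInit (smain I)) (\<lambda>(V, L). {L'. (shared V, loc L') \<in> sinits I}) keep,
     setl (\<lambda>(V, L). L\<lparr>qi := (qi L)(1 := shared V)\<rparr>),
     main_loop k ]"
  by (simp add: lazy_main_def)

declare split_paired_Ex [simp del] split_paired_All [simp del]

text \<open>The merged process is replaced by an arbitrary process \<open>M\<close>, which keeps the
  choice of processes out of both simulations.\<close>

locale lazy =
  fixes M :: "('s, 'g, 'l, 'h, (nat \<times> 'p) option) process" and I :: "('s, 'l, 'f, 'q) seq_program" and k :: nat
begin

definition lbody :: "('f, 'h) lname \<Rightarrow> ('s, 'g, 'l, 'f, 'h, nat \<times> 'p) lblock" where
  "lbody f = (case f of
        LMain \<Rightarrow> lazy_main k I
      | LInit f \<Rightarrow> map init_com (sbody I f)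
      | LinearInt \<Rightarrow> linear_int M
      | LazyProc h \<Rightarrow> lazy_block False (body M h))"

lemma lbody_simps [simp]:
  "lbody LMain = lazy_main k I" "lbody (LInit f) = map init_com (sbody I f)"
  "lbody LinearInt = linear_int M" "lbody (LazyProc h) = inserted @ rest_code False (body M h)"
  by (simp_all add: lbody_def lazy_block_False)

definition interface where
  "interface n f h \<longleftrightarrow> (\<exists>xs ys. set xs \<subseteq> thread_initial M \<and> linear (mround M) n f h xs ys)"

lemma interface_cong:
  "interface n f h \<Longrightarrow> (\<And>r. r \<in> {1..n} \<Longrightarrow> f r = f' r) \<Longrightarrow> (\<And>r. r \<in> {1..n} \<Longrightarrow> h r = h' r) \<Longrightarrow> interface n f' h'"
  unfolding interface_def using linear_cong[of "mround M" n f h] by blast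

lemma interface_refl: "(\<And>r. r \<in> {1..n} \<Longrightarrow> f r = h r) \<Longrightarrow> interface n f h"
  unfolding interface_def by (intro exI[of _ "[]"]) auto

lemma interface_Cons:
  "x \<in> thread_initial M \<Longrightarrow> column (mround M) n f g x y \<Longrightarrow> interface n g h \<Longrightarrow> interface n f h"
proof -
  assume x: "x \<in> thread_initial M" and col: "column (mround M) n f g x y" and "interface n g h"
  then obtain xs ys where "set xs \<subseteq> thread_initial M" "linear (mround M) n g h xs ys"
    unfolding interface_def by blast
  then have "set (x # xs) \<subseteq> thread_initial M \<and> linear (mround M) n f h (x # xs) (y # ys)"
    using x col by auto
  then show "interface n f h" unfolding interface_def by blast
qed

text \<open>
  \<open>callers b f h Fs\<close>: the frames \<open>Fs\<close> wait for a call of \<open>linear_int\<close> with bound \<open>b\<close>, inputs \<open>f\<close> and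
  expected outputs \<open>h\<close>.  A caller overwrites its input for round \<open>r\<close> by its output in that round; the
  untouched inputs survive as \<open>f\<close> of the premise.
\<close>

inductive callers where
  main: "init_final I (qi L 1) \<Longrightarrow> 1 \<le> cnt L \<Longrightarrow> cnt L \<le> k \<Longrightarrow>
    callers (cnt L) (qi L) (\<lambda>r. qi L (r + 1)) [(drop 2 (main_body k) @ [main_loop k], L, keep)]"
| thread: "callers b f h Fs \<Longrightarrow> 1 \<le> jj L \<Longrightarrow> jj L \<le> b \<Longrightarrow> bound L = b \<Longrightarrow> qo L = h \<Longrightarrow> \<not> lst L \<Longrightarrow>
    \<forall>r > jj L. qi L r = f r \<Longrightarrow> x \<in> thread_initial M \<Longrightarrow>
    column (mround M) (jj L) f (qi L) x (save L, (cs, loc L, r) # fs) \<Longrightarrow>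
    interface (jj L - 1) (qi L) h \<Longrightarrow> suspended fs Gs \<Longrightarrow>
    callers (jj L) (qi L) h ((resume # loop # rest_code (fs = []) cs, L, retn (fs = []) r) # Gs @ Fs)"

text \<open>
  The last thread does not record its outputs in \<open>qi\<close>: they were compared with \<open>h\<close> directly.
\<close>

definition active where
  "active b f h V L fs \<longleftrightarrow> bound L = b \<and> 1 \<le> jj L \<and> jj L \<le> b \<and> qo L = h \<and> (\<forall>r \<ge> jj L. qi L r = f r) \<and>
    \<not> terminate V \<and> (lst L \<or> interface (jj L - 1) (qi L) h) \<and>
    (\<exists>x \<in> thread_initial M. \<exists>y. column (mround M) (jj L - 1) f (if lst L then h else qi L) x y \<and>
       (step (body M))\<^sup>*\<^sup>* (False, (f (jj L), fst y), snd y) (atom V, (shared V, glob V), fs))"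

text \<open>While \<open>terminate\<close> is set, every frame of a thread stands at inserted code
  and returns there at once. The \<open>keep\<close> of the bottom frame protects the variables of
  the caller of \<open>linear_int\<close>.\<close>

definition unwinding where
  "unwinding Us \<longleftrightarrow> (\<forall>F \<in> set Us. \<exists>cs L R. F = (inserted @ cs, L, R)) \<and> (Us \<noteq> [] \<longrightarrow> snd (snd (last Us)) = keep)"

text \<open>The flag \<open>a\<close> is arbitrary because the lazy program represents atomic blocks
  of threads by \<open>atom\<close>. In \<open>unwind\<close>, entry \<open>b\<close> of the outputs
  is the current shared state, which no one has checked yet.\<close>

inductive lhead where
  sync: "callers b f h Fs \<Longrightarrow> active b f h V L ((cs, loc L, r) # fs) \<Longrightarrow> suspended fs Gs \<Longrightarrow>
    lhead (a, V, (inserted @ rest_code (fs = []) cs, L, retn (fs = []) r) # Gs @ Fs)"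
| loop: "callers b f h Fs \<Longrightarrow> active b f h V L ((cs, loc L, r) # fs) \<Longrightarrow> suspended fs Gs \<Longrightarrow> \<not> atom V \<Longrightarrow>
    lhead (a, V, (loop # rest_code (fs = []) cs, L, retn (fs = []) r) # Gs @ Fs)"
| ready: "callers b f h Fs \<Longrightarrow> active b f h V L ((cs, loc L, r) # fs) \<Longrightarrow> suspended fs Gs \<Longrightarrow>
    lhead (a, V, (rest_code (fs = []) cs, L, retn (fs = []) r) # Gs @ Fs)"
| unwind: "callers b f h Fs \<Longrightarrow> terminate V \<Longrightarrow> \<not> atom V \<Longrightarrow> interface b f (h(b := shared V)) \<Longrightarrow>
    unwinding Us \<Longrightarrow> lhead (a, V, Us @ Fs)"
| main_loop: "1 \<le> cnt L \<Longrightarrow> init_final I (qi L 1) \<Longrightarrow> \<not> atom V \<Longrightarrow> lhead (a, V, [([main_loop k], L, keep)])"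
| start: "lhead (a, V, [(lazy_main k I, L, keep)])"
| initializing: "seq_reachable I (a', shared V, fs) \<Longrightarrow> init_frames fs Fs \<Longrightarrow> \<not> atom V \<Longrightarrow> cnt L = 1 \<Longrightarrow>
    lhead (a, V, Fs @ [(drop 3 (lazy_main k I), L, keep)])"

section \<open>Preservation of the soundness invariant\<close>

lemma activeI:
  "bound L = b \<Longrightarrow> 1 \<le> jj L \<Longrightarrow> jj L \<le> b \<Longrightarrow> qo L = h \<Longrightarrow> (\<And>r. jj L \<le> r \<Longrightarrow> qi L r = f r) \<Longrightarrow>
    \<not> terminate V \<Longrightarrow> lst L \<or> interface (jj L - 1) (qi L) h \<Longrightarrow> x \<in> thread_initial M \<Longrightarrow>
    column (mround M) (jj L - 1) f (if lst L then h else qi L) x y \<Longrightarrow>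
    (step (body M))\<^sup>*\<^sup>* (False, (f (jj L), fst y), snd y) (atom V, (shared V, glob V), fs) \<Longrightarrow>
    active b f h V L fs"
  unfolding active_def by blast

lemma active_step:
  assumes "active b f h V L fs" "step (body M) (atom V, (shared V, glob V), fs) (atom V', (shared V', glob V'), fs')"
    "terminate V' = terminate V" "bound L' = bound L" "jj L' = jj L" "qi L' = qi L" "qo L' = qo L" "lst L' = lst L"
  shows "active b f h V' L' fs'"
proof -
  from assms(1) obtain x y where x: "x \<in> thread_initial M" "column (mround M) (jj L - 1) f (if lst L then h else qi L) x y"
    "(step (body M))\<^sup>*\<^sup>* (False, (f (jj L), fst y), snd y) (atom V, (shared V, glob V), fs)"
    unfolding active_def by blast
  have "(step (body M))\<^sup>*\<^sup>* (False, (f (jj L'), fst y), snd y) (atom V', (shared V', glob V'), fs')"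
    using rtranclp.rtrancl_into_rtrancl[OF x(3) assms(2)] assms(5) by simp
  moreover from assms(1) have "bound L = b" "1 \<le> jj L" "jj L \<le> b" "qo L = h" "\<forall>r \<ge> jj L. qi L r = f r"
    "\<not> terminate V" "lst L \<or> interface (jj L - 1) (qi L) h" unfolding active_def by simp_all
  ultimately show ?thesis
    using x(1,2) assms(3-) by (intro activeI[where x = x and y = y]) auto
qed

lemma callers_nonempty: "callers b f h Fs \<Longrightarrow> Fs \<noteq> []"
  by (auto elim: callers.cases)

lemma suspended_unwinding: "suspended fs Gs \<Longrightarrow> unwinding Gs \<and> (Gs = [] \<longleftrightarrow> fs = [])"
proof (induction fs arbitrary: Gs)
  case (Cons a fs)
  obtain cs l r where a: "a = (cs, l, r)" by (cases a)
  from Cons.prems obtain L Gs' where Gs: "Gs = (inserted @ rest_code (fs = []) cs, L, retn (fs = []) r) # Gs'"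
    "suspended fs Gs'" by (auto simp: a)
  from Cons.IH[OF Gs(2)] show ?case by (auto simp: Gs(1) unwinding_def retn_def)
qed (auto simp: unwinding_def)

lemma pop_unwinding:
  assumes "unwinding Gs" "Gs = [] \<Longrightarrow> R = keep" "Fs \<noteq> []"
  obtains Us where "pop L R (Gs @ Fs) = Us @ Fs" "unwinding Us"
proof (cases Gs)
  case Nil
  obtain cs L' R' Fs' where "Fs = (cs, L', R') # Fs'" using assms(3) by (cases Fs) auto
  then have "pop L R (Gs @ Fs) = [] @ Fs" using Nil assms(2) by (simp add: keep_def)
  then show thesis by (rule that) (simp add: unwinding_def)
next
  case (Cons G Gs')
  obtain cs L' R' where G: "G = (inserted @ cs, L', R')"
    using assms(1) unfolding Cons unwinding_def by auto
  have "pop L R (Gs @ Fs) = ((inserted @ cs, R L L', R') # Gs') @ Fs" by (simp add: Cons G)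
  moreover have "unwinding ((inserted @ cs, R L L', R') # Gs')"
    using assms(1) unfolding Cons G unwinding_def by (auto split: if_splits)
  ultimately show thesis by (rule that)
qed

lemma step_sync:
  assumes "callers b f h Fs" "active b f h V L ((cs, loc L, r) # fs)" "suspended fs Gs"
    "step lbody (a, V, (inserted @ rest_code (fs = []) cs, L, retn (fs = []) r) # Gs @ Fs) c'"
  shows "safe lbody lhead c'"
proof -
  have "\<not> terminate V" using assms(2) by (simp add: active_def)
  have "safe lbody lhead (a, V, (loop # rest_code (fs = []) cs, L, retn (fs = []) r) # Gs @ Fs)" if "\<not> atom V"
    using lhead.loop[OF assms(1-3) that] by (rule safe.head)
  moreover have "safe lbody lhead (a, V, (rest_code (fs = []) cs, L, retn (fs = []) r) # Gs @ Fs)"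
    using lhead.ready[OF assms(1-3)] by (rule safe.head)
  ultimately have "safe lbody lhead (a, V, (Ite None (Expr (\<lambda>(V, L). \<not> atom V)) [loop] [] # rest_code (fs = []) cs, L, retn (fs = []) r) # Gs @ Fs)"
    by (intro safe_ite) simp_all
  then show ?thesis using assms(4) \<open>\<not> terminate V\<close> by (simp add: inserted_eq step_simps)
qed

lemma safe_unwind:
  assumes "callers b f h Fs" "terminate V" "\<not> atom V" "interface b f (h(b := shared V))"
    "suspended fs Gs"
  shows "safe lbody lhead (a, V, pop L (retn (fs = []) r) (Gs @ Fs))"
proof -
  obtain Us where "pop L (retn (fs = []) r) (Gs @ Fs) = Us @ Fs" "unwinding Us"
    using pop_unwinding[of Gs "retn (fs = []) r" Fs L] suspended_unwinding[OF assms(5)] callers_nonempty[OF assms(1)]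
    by (auto simp: retn_def)
  then show ?thesis using lhead.unwind[OF assms(1-4) \<open>unwinding Us\<close>, of a] by (auto intro: safe.head)
qed

text \<open>A fresh thread has completed no round, so its column and the interface of the threads
  after it are both trivial.\<close>

lemma safe_linear_int:
  assumes "callers b f h Fs" "qi L = f" "qo L = h" "bound L = b" "1 \<le> b" "\<not> atom V" "\<not> terminate V"
  shows "safe lbody lhead (a, V, (linear_int M, L, keep) # Fs)"
proof -
  have "safe lbody lhead (a, V\<lparr>glob := g, shared := f 1\<rparr>,
      (inserted @ rest_code True (body M (main M)), L\<lparr>lst := lt, jj := 1, loc := l\<rparr>, keep) # Fs)"
    if "(g, l) \<in> inits M" for lt g l
  proof -
    let ?L = "L\<lparr>lst := lt, jj := 1, loc := l\<rparr>" and ?V = "V\<lparr>glob := g, shared := f 1\<rparr>"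
    have "(g, [(body M (main M), l, keep)]) \<in> thread_initial M"
      using that by (auto simp: thread_initial_def)
    then have "active b f h ?V ?L [(body M (main M), loc ?L, keep)]"
      using assms(2-7)
      by (intro activeI[where y = "(g, [(body M (main M), l, keep)])"]) (auto intro!: interface_refl)
    from lhead.sync[OF assms(1) this, of "[]" a] show ?thesis by (intro safe.head) (simp add: retn_def)
  qed
  then show ?thesis
    unfolding linear_int_eq by (auto intro!: safe_update simp: assms(2))
qed

text \<open>A switch ends a round and extends the column of the thread by one entry. The last thread
  checks its output or returns with it; any other thread stores it in \<open>qi\<close> and calls
  the threads after it.\<close>

lemma step_loop:
  assumes "callers b f h Fs" "active b f h V L ((cs, loc L, r) # fs)" "suspended fs Gs" "\<not> atom V"
    "step lbody (a, V, (loop # rest_code (fs = []) cs, L, retn (fs = []) r) # Gs @ Fs) c'"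
  shows "safe lbody lhead c'"
proof -
  let ?K = "rest_code (fs = []) cs" and ?R = "retn (fs = []) r"
  let ?j = "jj L"
  from assms(2,4) have act: "bound L = b" "1 \<le> ?j" "?j \<le> b" "qo L = h" "\<forall>r \<ge> ?j. qi L r = f r"
    "\<not> terminate V" "lst L \<or> interface (?j - 1) (qi L) h" unfolding active_def by auto
  from assms(2,4) obtain x y where x: "x \<in> thread_initial M"
    "column (mround M) (?j - 1) f (if lst L then h else qi L) x y"
    "mround M (f ?j) y (shared V) (glob V, (cs, loc L, r) # fs)"
    unfolding active_def mround_def by auto
  obtain j' where j': "?j = Suc j'" using act(2) by (cases ?j) auto
  have ready: "safe lbody lhead (a, V, (?K, L, ?R) # Gs @ Fs)"
    using lhead.ready[OF assms(1-3)] by (rule safe.head)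
  have terminate: "safe lbody lhead (a, V\<lparr>terminate := True\<rparr>, pop L ?R (Gs @ Fs))" if "lst L" "?j = b"
  proof (rule safe_unwind[OF assms(1) _ _ _ assms(3)])
    \<comment> \<open>Nothing runs behind the last thread, so its outputs are those of the whole
      block; the output of round \<open>b\<close> is the shared state.\<close>
    let ?h = "h(b := shared V)"
    have "column (mround M) j' f ?h x y"
      using x(2) that j' by (auto intro: column_cong)
    then have "column (mround M) b f ?h x (glob V, (cs, loc L, r) # fs)"
      using x(3) that j' by auto
    then show "interface b f (h(b := shared (V\<lparr>terminate := True\<rparr>)))"
      using interface_Cons[OF x(1) _ interface_refl] by simp
  qed (use assms(4) in simp_all)
  have next_round: "safe lbody lhead (a, V\<lparr>shared := qi L (Suc ?j)\<rparr>, (loop # ?K, L\<lparr>jj := Suc ?j\<rparr>, ?R) # Gs @ Fs)"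
    if "lst L" "?j \<noteq> b" "h ?j = shared V"
  proof -
    let ?L = "L\<lparr>jj := Suc ?j\<rparr>" and ?V = "V\<lparr>shared := qi L (Suc ?j)\<rparr>"
    have "column (mround M) (Suc j') f h x (glob V, (cs, loc L, r) # fs)"
      using x(2,3) that j' by auto
    then have "active b f h ?V ?L ((cs, loc ?L, r) # fs)"
      using that act j' assms(4) x(1) by (intro activeI[where x = x]) auto
    from lhead.loop[OF assms(1) this assms(3)] assms(4) show ?thesis by (intro safe.head) simp
  qed
  have call: "safe lbody lhead (a, V, (linear_int M, L', keep) # (resume # loop # ?K,
      L\<lparr>qi := (qi L)(?j := shared V), save := glob V\<rparr>, ?R) # Gs @ Fs)"
    if "\<not> lst L" "qi L' = (qi L)(?j := shared V)" "qo L' = qo L" "bound L' = ?j" for L'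
  proof -
    let ?L = "L\<lparr>qi := (qi L)(?j := shared V), save := glob V\<rparr>"
    have "column (mround M) j' f (qi ?L) x y"
      using x(2) that(1) j' by (auto intro: column_cong)
    then have col: "column (mround M) (jj ?L) f (qi ?L) x (save ?L, (cs, loc ?L, r) # fs)"
      using x(3) j' by auto
    have "interface (?j - 1) (qi L) h" using act(7) that(1) by simp
    \<comment> \<open>Storing the output in entry \<open>jj L\<close> does not disturb the interface
      of the later threads, which covers smaller rounds.\<close>
    then have int: "interface (jj ?L - 1) (qi ?L) h"
    proof -
      have "qi L r = qi ?L r" if "r \<in> {1..?j - 1}" for r using that act(2) by auto
      with \<open>interface (?j - 1) (qi L) h\<close> show ?thesis using interface_cong by fastforce
    qed
    have "callers (jj ?L) (qi ?L) h ((resume # loop # ?K, ?L, ?R) # Gs @ Fs)"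
      by (rule callers.thread[OF assms(1) _ _ _ _ _ _ x(1) col int assms(3)]) (use act that in auto)
    from safe_linear_int[OF this, of L' V a] show ?thesis
      using act assms(4) that by simp
  qed
  have "safe lbody lhead (a, V, (switch # loop # ?K, L, ?R) # Gs @ Fs)"
  proof (cases "lst L")
    case True
    show ?thesis
      unfolding switch_eq
      apply (rule safe_ite)
       apply (simp_all add: True)
      apply (rule safe_ite)
       apply simp_all
       apply (rule safe_update, simp)
       apply (rule safe_return)
      using terminate[OF True] act(1) apply simp
      apply (rule safe_assume)
      apply (rule safe_update, simp)
      apply (rule safe_update, simp)
      using next_round[OF True] act(1,4) by simp
  next
    case False
    show ?thesis
      unfolding switch_eq
      apply (rule safe_ite)
       apply (simp_all add: False)
      apply (rule safe_update, simp)
      apply (rule safe_update, simp)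
      apply (rule safe_call)
      using call[OF False] by simp
  qed
  then show ?thesis
    using assms(5) ready unfolding loop_eq step_simps by (auto simp: loop_eq)
qed

text \<open>When the frames of the thread are gone, control is back in the caller, and the interface
  just returned replaces the caller's older one. At its own bound the caller puts its column in
  front and returns too; otherwise the output is checked and its next round begins.\<close>

lemma step_unwind:
  assumes "callers b f h Fs" "terminate V" "\<not> atom V" "interface b f (h(b := shared V))" "unwinding Us"
    "step lbody (a, V, Us @ Fs) c'"
  shows "safe lbody lhead c'"
proof (cases Us)
  case (Cons U Us')
  obtain cs L R where U: "U = (inserted @ cs, L, R)" using assms(5) unfolding Cons unwinding_def by auto
  have "unwinding Us'" "Us' = [] \<Longrightarrow> R = keep"
    using assms(5) unfolding Cons unwinding_def by (auto simp: U)
  then obtain Us'' where Us'': "pop L R (Us' @ Fs) = Us'' @ Fs" "unwinding Us''"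
    using pop_unwinding[of Us' R Fs L] callers_nonempty[OF assms(1)] by blast
  have "safe lbody lhead (a, V, Us'' @ Fs)"
    using lhead.unwind[OF assms(1-4) Us''(2)] by (rule safe.head)
  moreover have "c' = (a, V, (Return None # Ite None (Expr (\<lambda>(V, L). \<not> atom V)) [loop] [] # cs, L, R) # Us' @ Fs)"
    using assms(2,6) by (simp add: Cons U inserted_eq step_simps)
  ultimately show ?thesis using Us''(1) by (simp add: safe_return)
next
  case Nil
  from assms(1) show ?thesis
  proof cases
    case (main L)
    let ?L = "L\<lparr>cnt := cnt L + 1\<rparr>"
    have "safe lbody lhead (a, V, [([main_loop k], ?L, keep)])"
      using main assms(3) by (intro safe.head lhead.main_loop) auto
    moreover have "safe lbody lhead (a, V, [([main_loop k], ?L\<lparr>qi := (qi L)(cnt ?L := shared V)\<rparr>, keep)])"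
      using main assms(3) by (intro safe.head lhead.main_loop) auto
    ultimately have "safe lbody lhead (a, V, [(drop 3 (main_body k) @ [main_loop k], ?L, keep)])"
      by (auto intro!: safe_ite safe_update)
    then show ?thesis using assms(6) by (simp add: Nil main step_simps)
  next
    case (thread b' f' Fs' L x cs r fs Gs)
    let ?K = "rest_code (fs = []) cs" and ?R = "retn (fs = []) r"
    have "safe lbody lhead (a, V, pop L ?R (Gs @ Fs'))" if "b = b'"
    proof (rule safe_unwind[OF thread(4) assms(2,3) _ thread(14)])
      have "interface b' (qi L) (h(b' := shared V))" using assms(4) thread that by simp
      moreover have "column (mround M) b' f' (qi L) x (save L, (cs, loc L, r) # fs)" using thread that by simp
      ultimately show "interface b' f' (h(b' := shared V))" using interface_Cons thread(11) by blast
    qed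
    moreover
    let ?L = "L\<lparr>jj := Suc b\<rparr>" and ?V = "V\<lparr>glob := save L, terminate := False, shared := qi L (Suc b)\<rparr>"
    have "safe lbody lhead (a, ?V, (loop # ?K, ?L, ?R) # Gs @ Fs')" if "b \<noteq> b'" "h b = shared V"
    proof -
      \<comment> \<open>The assumption in \<open>resume\<close> has compared the output of round
        \<open>b\<close> with \<open>h\<close>, so the returned interface now matches
        \<open>h\<close> in every entry.\<close>
      have "h(b := shared V) = h" using that(2) by (simp flip: that(2))
      then have "interface b (qi L) h" using assms(4) thread by simp
      then have "active b' f' h ?V ?L ((cs, loc ?L, r) # fs)"
        using thread that assms(3) by (intro activeI[where x = x and y = "(save L, (cs, loc L, r) # fs)"]) auto
      from lhead.loop[OF thread(4) this thread(14), of a] assms(3) show ?thesis by (intro safe.head) simp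
    qed
    ultimately have "safe lbody lhead (a, V, ((if jj L = bound L then [Return None] else
        [ Assume None (\<lambda>(V, L). qo L (jj L) = shared V),
          setg (\<lambda>(V, L). V\<lparr>glob := save L\<rparr>),
          setg (\<lambda>(V, L). V\<lparr>terminate := False\<rparr>),
          setl (\<lambda>(V, L). L\<lparr>jj := jj L + 1\<rparr>),
          setg (\<lambda>(V, L). V\<lparr>shared := qi L (jj L)\<rparr>) ]) @ loop # ?K, L, ?R) # Gs @ Fs')"
      using thread by (auto intro!: safe_return safe_assume safe_update)
    then show ?thesis using assms(6) by (auto simp: Nil thread(3) resume_eq step_simps split: if_splits)
  qed
qed

text \<open>The translation of a statement is followed by inserted code, so every step leads to
  \<open>sync\<close>. At the return from the main procedure the code blocks and there is no step to
  consider.\<close>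

lemma step_ready:
  assumes "callers b f h Fs" "active b f h V L ((cs, loc L, r) # fs)" "suspended fs Gs"
    "step lbody (a, V, (rest_code (fs = []) cs, L, retn (fs = []) r) # Gs @ Fs) c'"
  shows "safe lbody lhead c'"
proof -
  have sync: "safe lbody lhead (a, V', (inserted @ rest_code (fs' = []) cs', L', retn (fs' = []) r') # Gs' @ Fs)"
    if "step (body M) (atom V, (shared V, glob V), (cs, loc L, r) # fs) (atom V', (shared V', glob V'), (cs', loc L', r') # fs')"
      "terminate V' = terminate V" "bound L' = bound L" "jj L' = jj L" "qi L' = qi L" "qo L' = qo L" "lst L' = lst L"
      "suspended fs' Gs'" for V' L' cs' r' fs' Gs'
    using lhead.sync[OF assms(1) active_step[OF assms(2) that(1-7)] that(8)] by (rule safe.head)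
  note st = assms(4)
  \<comment> \<open>The frame below continues with the control variables of the popped one and with
    its own updated \<open>loc\<close>.\<close>
  have pop: "safe lbody lhead (a, V, pop L (retn False r) (Gs @ Fs))"
    if ne: "fs \<noteq> []" and st: "step (body M) (atom V, (shared V, glob V), (cs, loc L, r) # fs) (atom V, (shared V, glob V), pop (loc L) r fs)"
  proof -
    obtain cs1 l1 r1 fs1 where fs: "fs = (cs1, l1, r1) # fs1" using ne by (cases fs) auto
    then obtain L1 Gs1 where Gs: "Gs = (inserted @ rest_code (fs1 = []) cs1, L1, retn (fs1 = []) r1) # Gs1"
      "loc L1 = l1" "suspended fs1 Gs1" using assms(3) by auto
    have "safe lbody lhead (a, V, (inserted @ rest_code (fs1 = []) cs1, L\<lparr>loc := r (loc L) (loc L1)\<rparr>, retn (fs1 = []) r1) # Gs1 @ Fs)"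
      using st Gs by (intro sync) (simp_all add: fs)
    then show ?thesis by (simp add: Gs(1) retn_def)
  qed
  show ?thesis
  proof (cases cs)
    case Nil
    then show ?thesis
      using st pop by (cases "fs = []") (auto simp: step_simps)
  next
    case (Cons c cs')
    show ?thesis
    proof (cases c)
      case (Update p u)
      from st obtain s g l where 1: "((s, g), l) \<in> u ((shared V, glob V), loc L)"
        and c': "c' = (a, V\<lparr>shared := s, glob := g\<rparr>, (inserted @ rest_code (fs = []) cs', L\<lparr>loc := l\<rparr>, retn (fs = []) r) # Gs @ Fs)"
        by (auto simp: Cons Update step_simps wr_def rd_def)
      show ?thesis unfolding c'
        using 1 assms(3) by (intro sync) (auto simp: Cons Update step_simps)
    next
      case (Assume p e)
      with st show ?thesis
        using assms(3) by (auto simp: Cons step_simps rd_def intro!: sync)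
    next
      case (Assert p e)
      with st show ?thesis
        using assms(3) by (auto simp: Cons step_simps rd_def intro!: sync)
    next
      case (Ite p e xs ys)
      have "c' = (a, V, (inserted @ rest_code (fs = []) (xs @ cs'), L, retn (fs = []) r) # Gs @ Fs) \<and> may_eval e ((shared V, glob V), loc L) True \<or>
        c' = (a, V, (inserted @ rest_code (fs = []) (ys @ cs'), L, retn (fs = []) r) # Gs @ Fs) \<and> may_eval e ((shared V, glob V), loc L) False"
        using st unfolding Cons Ite by (auto simp: step_simps rd_def rest_code_append)
      then show ?thesis
        using assms(3) by (auto simp: Cons Ite step_simps intro!: sync)
    next
      case (While p e xs)
      have "c' = (a, V, (inserted @ rest_code (fs = []) (xs @ While p e xs # cs'), L, retn (fs = []) r) # Gs @ Fs) \<and> may_eval e ((shared V, glob V), loc L) True \<or>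
        c' = (a, V, (inserted @ rest_code (fs = []) cs', L, retn (fs = []) r) # Gs @ Fs) \<and> may_eval e ((shared V, glob V), loc L) False"
        using st unfolding Cons While by (auto simp: step_simps rd_def simp flip: rest_code_append)
      then show ?thesis
        using assms(3) by (auto simp: Cons While step_simps intro!: sync)
    next
      case (BeginAtomic p)
      with st show ?thesis
        using assms(3) by (auto simp: Cons step_simps intro!: sync)
    next
      case (EndAtomic p)
      with st show ?thesis
        using assms(3) by (auto simp: Cons step_simps intro!: sync)
    next
      case (Call p m args res)
      from st obtain l where l: "l \<in> args ((shared V, glob V), loc L)"
        and c': "c' = (a, V, (inserted @ rest_code False (body M m), L\<lparr>loc := l\<rparr>, retn False res) #
          ((inserted @ rest_code (fs = []) cs', L, retn (fs = []) r) # Gs) @ Fs)"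
        by (auto simp: Cons Call step_simps lift_call_def rd_def retn_def)
      have "safe lbody lhead (a, V, (inserted @ rest_code ((cs', loc L, r) # fs = []) (body M m), L\<lparr>loc := l\<rparr>, retn ((cs', loc L, r) # fs = []) res) #
          ((inserted @ rest_code (fs = []) cs', L, retn (fs = []) r) # Gs) @ Fs)"
        by (rule sync) (use l assms(3) in \<open>auto simp: Cons Call step_simps\<close>)
      then show ?thesis unfolding c' by simp
    next
      case (Return p)
      then show ?thesis
        using st pop by (cases "fs = []") (auto simp: Cons step_simps)
    qed
  qed
qed

lemma step_main_loop:
  assumes "1 \<le> cnt L" "init_final I (qi L 1)" "\<not> atom V" "step lbody (a, V, [([main_loop k], L, keep)]) c'"
  shows "safe lbody lhead c'"
proof (cases "cnt L \<le> k")
  case True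
  let ?V = "V\<lparr>terminate := False\<rparr>"
  have "safe lbody lhead (a, ?V, [(linear_int M, L', keep), (drop 2 (main_body k) @ [main_loop k], L, keep)])"
    if "qi L' = qi L" "qo L' = (\<lambda>r. qi L (r + 1))" "bound L' = cnt L" for L'
    by (rule safe_linear_int[OF callers.main[OF assms(2,1) True]]) (use that assms in auto)
  then have "safe lbody lhead (a, V, [(main_body k @ [main_loop k], L, keep)])"
    by (auto intro!: safe_update safe_call)
  then show ?thesis using assms(4) True by (simp add: step_simps)
next
  case False
  have "safe lbody lhead (a, V, [])" by (rule safe.silent) (simp_all add: step_simps)
  then have "safe lbody lhead (a, V, [([], L, keep)])" by (intro safe_end) simp
  with assms(4) False show ?thesis by (simp add: step_simps)
qed

lemma seq_reachable_step: "seq_reachable I c \<Longrightarrow> step (sbody I) c c' \<Longrightarrow> seq_reachable I c'"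
  unfolding seq_reachable_def by (meson rtranclp.rtrancl_into_rtrancl)

lemma step_start:
  assumes "step lbody (a, V, [(lazy_main k I, L, keep)]) c'"
  shows "safe lbody lhead c'"
proof -
  let ?V = "V\<lparr>atom := False\<rparr>" and ?L = "L\<lparr>cnt := 1\<rparr>"
  have "safe lbody lhead (a, ?V, [(map init_com (sbody I (smain I)), L', keep), (drop 3 (lazy_main k I), ?L, keep)])"
    if "(shared V, loc L') \<in> sinits I" for L'
  proof -
    have "seq_reachable I (False, shared ?V, [(sbody I (smain I), loc L', keep)])"
      using that unfolding seq_reachable_def seq_initial_def by auto
    from lhead.initializing[OF this, of "[(map init_com (sbody I (smain I)), L', keep)]" ?L a]
    show ?thesis by (intro safe.head) (simp add: retn_def)
  qed
  then have "safe lbody lhead (a, V, [(drop 1 (lazy_main k I), ?L, keep)])"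
    unfolding lazy_main_eq by (auto intro!: safe_update safe_call)
  then show ?thesis using assms by (simp add: lazy_main_eq step_simps)
qed

text \<open>Atomic statements of the initialization block act on the flag of the configuration and
  leave \<open>atom\<close> alone; the flags \<open>a\<close> and \<open>a'\<close> are not
  compared.\<close>

lemma step_initializing:
  assumes "seq_reachable I (a', shared V, fs)" "init_frames fs Fs" "\<not> atom V" "cnt L0 = 1"
    "step lbody (a, V, Fs @ [(drop 3 (lazy_main k I), L0, keep)]) c'"
  shows "safe lbody lhead c'"
proof (cases fs)
  case Nil
  have "init_final I (shared V)" using assms(1) by (auto simp: Nil init_final_def)
  then have "safe lbody lhead (a, V, [([main_loop k], L0\<lparr>qi := (qi L0)(1 := shared V)\<rparr>, keep)])"
    using assms(3,4) by (intro safe.head lhead.main_loop) auto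
  moreover have "Fs = []" using assms(2) Nil by simp
  ultimately show ?thesis
    using assms(5) by (simp add: lazy_main_eq step_simps)
next
  case (Cons F fs1)
  obtain cs l r where F: "F = (cs, l, r)" by (cases F)
  obtain L Gs where Fs: "Fs = (map init_com cs, L, retn (fs1 = []) r) # Gs" "loc L = l" "init_frames fs1 Gs"
    using assms(2) by (auto simp: Cons F)
  let ?base = "[(drop 3 (lazy_main k I), L0, keep)]"
  have go: "safe lbody lhead (a2, V', Fs' @ ?base)"
    if "step (sbody I) (a', shared V, (cs, loc L, r) # fs1) (a1, shared V', fs')" "init_frames fs' Fs'" "\<not> atom V'"
    for a1 V' fs' Fs' a2
    using lhead.initializing[OF seq_reachable_step[OF assms(1)[unfolded Cons F Fs(2)[symmetric]] that(1)] that(2,3) assms(4)]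
    by (rule safe.head)
  have pop: "safe lbody lhead (a, V, pop L (retn (fs1 = []) r) (Gs @ ?base))"
    if "step (sbody I) (a', shared V, (cs, loc L, r) # fs1) (a', shared V, pop (loc L) r fs1)"
  proof (cases fs1)
    case Nil
    with Fs have "pop L (retn (fs1 = []) r) (Gs @ ?base) = [] @ ?base" by (simp add: retn_def keep_def)
    then show ?thesis using go[OF that, of "[]"] Nil assms(3) by simp
  next
    case (Cons F1 fs2)
    obtain cs2 l2 r2 where F1: "F1 = (cs2, l2, r2)" by (cases F1)
    obtain L2 Gs2 where Gs: "Gs = (map init_com cs2, L2, retn (fs2 = []) r2) # Gs2" "loc L2 = l2" "init_frames fs2 Gs2"
      using Fs(3) by (auto simp: Cons F1)
    have "safe lbody lhead (a, V, ((map init_com cs2, L\<lparr>loc := r (loc L) (loc L2)\<rparr>, retn (fs2 = []) r2) # Gs2) @ ?base)"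
      by (rule go[OF that]) (use Gs assms(3) in \<open>auto simp: Cons F1\<close>)
    then show ?thesis by (simp add: Gs(1) Cons retn_def)
  qed
  have st: "step lbody (a, V, (map init_com cs, L, retn (fs1 = []) r) # Gs @ ?base) c'"
    using assms(5) by (simp add: Fs(1))
  show ?thesis
  proof (cases cs)
    case Nil
    then show ?thesis using st pop by (simp add: step_simps)
  next
    case (Cons c cs')
    have frame: "safe lbody lhead (a2, V', (map init_com cs1, L', retn (fs1 = []) r) # Gs @ ?base)"
      if "step (sbody I) (a', shared V, (cs, loc L, r) # fs1) (a1, shared V', (cs1, loc L', r) # fs1)" "\<not> atom V'"
      for a1 V' cs1 L' a2
      using go[OF that(1), of "(map init_com cs1, L', retn (fs1 = []) r) # Gs"] Fs(3) that(2) by simp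
    show ?thesis
    proof (cases c)
      case (Update p u)
      from st obtain s l' where 1: "(s, l') \<in> u (shared V, loc L)"
        and c': "c' = (a, V\<lparr>shared := s\<rparr>, (map init_com cs', L\<lparr>loc := l'\<rparr>, retn (fs1 = []) r) # Gs @ ?base)"
        by (auto simp: Cons Update step_simps wr_init_def rd_init_def)
      show ?thesis unfolding c'
        using 1 assms(3) by (intro frame[of a']) (auto simp: Cons Update step_simps)
    next
      case (Assume p e)
      with st show ?thesis
        using assms(3) by (auto simp: Cons step_simps rd_init_def intro!: frame)
    next
      case (Assert p e)
      with st show ?thesis
        using assms(3) by (auto simp: Cons step_simps rd_init_def intro!: frame)
    next
      case (Ite p e xs ys)
      have "c' = (a, V, (map init_com (xs @ cs'), L, retn (fs1 = []) r) # Gs @ ?base) \<and> may_eval e (shared V, loc L) True \<or>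
        c' = (a, V, (map init_com (ys @ cs'), L, retn (fs1 = []) r) # Gs @ ?base) \<and> may_eval e (shared V, loc L) False"
        using st unfolding Cons Ite by (auto simp: step_simps rd_init_def)
      then show ?thesis
        using assms(3) by (auto simp: Cons Ite step_simps simp del: map_append intro!: frame[of a'])
    next
      case (While p e xs)
      have "c' = (a, V, (map init_com (xs @ While p e xs # cs'), L, retn (fs1 = []) r) # Gs @ ?base) \<and> may_eval e (shared V, loc L) True \<or>
        c' = (a, V, (map init_com cs', L, retn (fs1 = []) r) # Gs @ ?base) \<and> may_eval e (shared V, loc L) False"
        using st unfolding Cons While by (auto simp: step_simps rd_init_def)
      then show ?thesis
        using assms(3) by (auto simp: Cons While step_simps simp del: map_append intro!: frame[of a'])
    next
      case (BeginAtomic p)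
      with st show ?thesis
        using assms(3) by (auto simp: Cons step_simps intro!: frame)
    next
      case (EndAtomic p)
      with st show ?thesis
        using assms(3) by (auto simp: Cons step_simps intro!: frame)
    next
      case (Call p m args res)
      from st obtain l' where l': "l' \<in> args (shared V, loc L)"
        and c': "c' = (a, V, ((map init_com (sbody I m), L\<lparr>loc := l'\<rparr>, retn False res) #
          (map init_com cs', L, retn (fs1 = []) r) # Gs) @ ?base)"
        by (auto simp: Cons Call step_simps lift_call_def rd_init_def retn_def)
      show ?thesis unfolding c'
        by (rule go[of a' V "(sbody I m, l', res) # (cs', loc L, r) # fs1"])
          (use l' assms(3) Fs(3) in \<open>auto simp: Cons Call step_simps\<close>)
    next
      case (Return p)
      then show ?thesis using st pop by (simp add: Cons step_simps)
    qed
  qed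
qed

lemma lhead_step: "lhead c \<Longrightarrow> step lbody c c' \<Longrightarrow> safe lbody lhead c'"
  by (induction rule: lhead.induct)
    (blast intro: step_sync step_loop step_ready step_unwind step_main_loop step_start step_initializing)+

text \<open>These are the hypotheses of \<open>execution_of_linear\<close>, stated for
  \<open>M\<close>: the form in which the invariant is handed over to the parameterized
  program.\<close>

definition witness where
  "witness a s g fs \<longleftrightarrow> (\<exists>j q p w xs ys x y zs zs'. Suc j \<le> k \<and> init_final I (q 1) \<and>
     set xs \<subseteq> thread_initial M \<and> x \<in> thread_initial M \<and> set zs \<subseteq> thread_initial M \<and>
     linear (mround M) (Suc j) q p xs ys \<and> column (mround M) j p w x y \<and>
     linear (mround M) j w (\<lambda>r. q (Suc r)) zs zs' \<and>
     (step (body M))\<^sup>*\<^sup>* (False, (p (Suc j), fst y), snd y) (a, (s, g), fs))"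

text \<open>The columns of all waiting threads are concatenated, from the outermost call inwards. A
  caller contributes \<open>jj L\<close> rounds, so the columns of the threads that called it are
  truncated to that number.\<close>

lemma callers_prefix:
  "callers b f h Fs \<Longrightarrow> \<exists>q xs ys. init_final I (q 1) \<and> 1 \<le> b \<and> b \<le> k \<and> set xs \<subseteq> thread_initial M \<and>
     linear (mround M) b q f xs ys \<and> (\<forall>r. 1 \<le> r \<and> r < b \<longrightarrow> h r = q (Suc r))"
proof (induction rule: callers.induct)
  case (main L)
  then show ?case by (intro exI[of _ "qi L"] exI[of _ "[]"]) auto
next
  case (thread b f h Fs L x cs r fs Gs)
  then obtain q xs ys where q: "init_final I (q 1)" "b \<le> k" "set xs \<subseteq> thread_initial M"
    "linear (mround M) b q f xs ys" "\<forall>r. 1 \<le> r \<and> r < b \<longrightarrow> h r = q (Suc r)" by blast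
  obtain zs where "linear (mround M) (jj L) q f xs zs"
    using linear_mono[OF q(4)] thread.hyps by blast
  moreover have "linear (mround M) (jj L) f (qi L) [x] [(save L, (cs, loc L, r) # fs)]"
    using thread.hyps unfolding linear_single by blast
  ultimately have "linear (mround M) (jj L) q (qi L) (xs @ [x]) (zs @ [(save L, (cs, loc L, r) # fs)])"
    by (rule linear_append)
  then show ?case
    using q thread.hyps by (intro exI[of _ q] exI[of _ "xs @ [x]"] exI[of _ "zs @ [(save L, (cs, loc L, r) # fs)]"]) auto
qed

lemma witnessI:
  "Suc j \<le> k \<Longrightarrow> init_final I (q 1) \<Longrightarrow> set xs \<subseteq> thread_initial M \<Longrightarrow> x \<in> thread_initial M \<Longrightarrow>
   set zs \<subseteq> thread_initial M \<Longrightarrow> linear (mround M) (Suc j) q p xs ys \<Longrightarrow> column (mround M) j p w x y \<Longrightarrow>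
   linear (mround M) j w (\<lambda>r. q (Suc r)) zs zs' \<Longrightarrow>
   (step (body M))\<^sup>*\<^sup>* (False, (p (Suc j), fst y), snd y) (a, (s, g), fs) \<Longrightarrow> witness a s g fs"
  unfolding witness_def by blast

text \<open>To the left of the active thread stand its callers, to the right the threads of the last
  call that returned, or none behind the last thread. The outputs \<open>h r\<close> agree with the
  inputs \<open>q (Suc r)\<close>, which links the rounds.\<close>

lemma active_witness:
  assumes "callers b f h Fs" "active b f h V L fs"
  shows "witness (atom V) (shared V) (glob V) fs"
proof -
  obtain q xs ys where q: "init_final I (q 1)" "b \<le> k" "set xs \<subseteq> thread_initial M"
    "linear (mround M) b q f xs ys" "\<forall>r. 1 \<le> r \<and> r < b \<longrightarrow> h r = q (Suc r)"
    using callers_prefix[OF assms(1)] by blast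
  have jb: "1 \<le> jj L" "jj L \<le> b" and L: "lst L \<or> interface (jj L - 1) (qi L) h"
    using assms(2) unfolding active_def by auto
  obtain x y where x: "x \<in> thread_initial M" "column (mround M) (jj L - 1) f (if lst L then h else qi L) x y"
    "(step (body M))\<^sup>*\<^sup>* (False, (f (jj L), fst y), snd y) (atom V, (shared V, glob V), fs)"
    using assms(2) unfolding active_def by blast
  let ?w = "if lst L then h else qi L"
  obtain j where j: "jj L = Suc j" using jb by (cases "jj L") auto
  have "interface j ?w h" using L j interface_refl by auto
  then have "interface j ?w (\<lambda>r. q (Suc r))"
    by (rule interface_cong) (use q(5) jb j in auto)
  then obtain zs zs' where zs: "set zs \<subseteq> thread_initial M" "linear (mround M) j ?w (\<lambda>r. q (Suc r)) zs zs'"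
    unfolding interface_def by blast
  obtain ys' where ys': "linear (mround M) (Suc j) q f xs ys'"
    using linear_mono[OF q(4), of "Suc j"] jb j by auto
  have k: "Suc j \<le> k" using jb j q(2) by simp
  have col: "column (mround M) j f ?w x y" using x(2) j by simp
  have run: "(step (body M))\<^sup>*\<^sup>* (False, (f (Suc j), fst y), snd y) (atom V, (shared V, glob V), fs)"
    using x(3) j by simp
  show ?thesis
    by (rule witnessI[OF k q(1,3) x(1) zs(1) ys' col zs(2) run])
qed

text \<open>In every other case of \<open>lhead\<close> the next statement has the label
  \<open>None\<close> and is no assertion.\<close>

lemma visible_cases:
  assumes "(step lbody)\<^sup>*\<^sup>* (False, V0, [(lazy_main k I, L0, keep)]) c" "conf_violates c \<or> simulated c \<noteq> None"
  obtains (initializing) a a' V fs Fs L where "c = (a, V, Fs @ [(drop 3 (lazy_main k I), L, keep)])"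
      "seq_reachable I (a', shared V, fs)" "init_frames fs Fs"
  | (ready) a V cs L r Gs fs where "c = (a, V, (rest_code (fs = []) cs, L, retn (fs = []) r) # Gs)"
      "witness (atom V) (shared V) (glob V) ((cs, loc L, r) # fs)"
proof -
  have "safe lbody lhead c"
    using assms(1) lhead.start lhead_step by (rule safe_reachable)
  then have "lhead c" using assms(2) by cases auto
  then show thesis
  proof cases
    case (sync b f h Fs V L cs r fs Gs a)
    then show ?thesis using assms(2) by (simp add: inserted_eq)
  next
    case (loop b f h Fs V L cs r fs Gs a)
    then show ?thesis using assms(2) by (simp add: loop_eq)
  next
    case (ready b f h Fs V L cs r fs Gs a)
    show ?thesis by (rule that(2)[OF ready(1) active_witness[OF ready(2,3)]])
  next
    case (unwind b f h Fs V Us a)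
    show ?thesis
    proof (cases Us)
      case Nil
      from unwind(2) show ?thesis
        by cases (use unwind(1) Nil assms(2) in \<open>simp_all add: resume_eq\<close>)
    next
      case (Cons U Us')
      then obtain cs L R where "U = (inserted @ cs, L, R)" using unwind(6) unfolding unwinding_def by auto
      then show ?thesis using Cons unwind(1) assms(2) by (simp add: inserted_eq)
    qed
  next
    case (main_loop L V a)
    then show ?thesis using assms(2) by simp
  next
    case (start a V L)
    then show ?thesis using assms(2) by (simp add: lazy_main_eq)
  next
    case (initializing a' V fs Fs L a)
    show ?thesis by (rule that(1)[OF initializing(1-3)])
  qed
qed

lemma init_frames_violates:
  assumes "init_frames fs Fs" "conf_violates (a, V, Fs @ [(drop 3 (lazy_main k I), L, keep)])"
  shows "conf_violates (a', shared V, fs)"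
proof (cases fs)
  case Nil
  then show ?thesis using assms by (simp add: lazy_main_eq)
next
  case (Cons F fs1)
  obtain cs l r where "F = (cs, l, r)" by (cases F)
  then show ?thesis
    using assms Cons by (cases cs; cases "hd cs") (auto simp: rd_init_def lift_call_def)
qed

lemma init_frames_simulated:
  assumes "init_frames fs Fs"
  shows "simulated (a, V, Fs @ [(drop 3 (lazy_main k I), L, keep)]) = None"
proof (cases fs)
  case Nil
  then show ?thesis using assms by (simp add: lazy_main_eq)
next
  case (Cons F fs1)
  obtain cs l r where "F = (cs, l, r)" by (cases F)
  then show ?thesis
    using assms Cons by (cases cs; cases "hd cs") (auto simp: lazy_main_eq lift_call_def)
qed

lemma lazy_violation:
  assumes "(step lbody)\<^sup>*\<^sup>* (False, V0, [(lazy_main k I, L0, keep)]) c" "conf_violates c"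
  shows "seq_violation I \<or> (\<exists>a s g fs. witness a s g fs \<and> conf_violates (a, (s, g), fs))"
proof -
  have "conf_violates c \<or> simulated c \<noteq> None" using assms(2) by simp
  from assms(1) this show ?thesis
  proof (cases rule: visible_cases)
    case (initializing a a' V fs Fs L)
    then show ?thesis using init_frames_violates assms(2) unfolding seq_violation_def by blast
  next
    case (ready a V cs L r Gs fs)
    have "conf_violates (atom V, (shared V, glob V), (cs, loc L, r) # fs)"
      using assms(2) unfolding ready(1)
      by (cases cs; cases "hd cs") (auto simp: rd_def lift_call_def split: if_splits)
    then show ?thesis using ready(2) by blast
  qed
qed

lemma lazy_simulated:
  assumes "(step lbody)\<^sup>*\<^sup>* (False, V0, [(lazy_main k I, L0, keep)]) c" "simulated c = Some z"
  obtains a s g c1 cs l r fs p where "witness a s g ((c1 # cs, l, r) # fs)" "label c1 = Some p" "z = (p, g, l, s)"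
proof -
  have "conf_violates c \<or> simulated c \<noteq> None" using assms(2) by simp
  from assms(1) this show thesis
  proof (cases rule: visible_cases)
    case (initializing a a' V fs Fs L)
    then show ?thesis using init_frames_simulated assms(2) by (metis option.distinct(1))
  next
    case (ready a V cs L r Gs fs)
    then obtain c1 cs' where cs: "cs = c1 # cs'"
      using assms(2) by (cases cs) (auto split: if_splits)
    have "\<exists>p. label c1 = Some p \<and> z = (p, glob V, loc L, shared V)"
      using assms(2) unfolding ready(1) cs
      by (cases c1) (auto simp: lift_call_def split: if_splits option.splits)
    then show ?thesis using ready(2) that unfolding cs by blast
  qed
qed

end

section \<open>Completeness of the lazy program\<close>

text \<open>Variables on which the switching code relies and which simulated statements must
  preserve. \<open>save\<close> is left out: it is written just before the call after which it is
  read.\<close>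

definition control where
  "control L = (qi L, qo L, bound L, lst L, jj L)"

lemma control_eq: "control L' = control L \<longleftrightarrow>
  qi L' = qi L \<and> qo L' = qo L \<and> bound L' = bound L \<and> lst L' = lst L \<and> jj L' = jj L"
  by (simp add: control_def)

abbreviation top_locals where
  "top_locals Us \<equiv> fst (snd (hd Us))"

lemma pop_empty: "pop l r fs = [] \<longleftrightarrow> fs = []"
  by (cases fs) auto

text \<open>The return from the main procedure has no counterpart in the simulation. Since it
  changes nothing but the stack, the simulation may stand still instead.\<close>

lemma step_to_empty:
  assumes "step B (a, v, (cs, l, r) # fs) (a', v', [])"
  shows "fs = [] \<and> a' = a \<and> v' = v"
proof (cases cs)
  case Nil
  then show ?thesis using assms by (simp add: step_simps eq_commute[of "[]"] pop_empty)
next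
  case (Cons c cs')
  then show ?thesis using assms by (cases c) (simp_all add: step_simps eq_commute[of "[]"] pop_empty)
qed

context lazy
begin

section \<open>Forward simulation of a single thread\<close>

abbreviation lsteps where "lsteps \<equiv> (step lbody)\<^sup>*\<^sup>*"

lemma lsteps_step: "step lbody c c' \<Longrightarrow> lsteps c' c'' \<Longrightarrow> lsteps c c''"
  by (rule converse_rtranclp_into_rtranclp)

text \<open>The assumption \<open>ne\<close> excludes the return from the main procedure, the one
  step without a counterpart in the translated code.\<close>

lemma ready_step:
  assumes st: "step (body M) (atom V, (shared V, glob V), (cs, loc L, r) # fs) (a1, (s1, g1), fs1)"
    and Gs: "suspended fs Gs" and ne: "fs1 \<noteq> []"
  obtains Us where "suspended fs1 Us" "control (top_locals Us) = control L"
    "step lbody (a, V, (rest_code (fs = []) cs, L, retn (fs = []) r) # Gs @ Fs)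
       (a, V\<lparr>atom := a1, shared := s1, glob := g1\<rparr>, Us @ Fs)"
proof -
  note found = that
  have frame: thesis
    if "step lbody (a, V, (rest_code (fs = []) cs, L, retn (fs = []) r) # Gs @ Fs)
       (a, V\<lparr>atom := a1, shared := s1, glob := g1\<rparr>, (inserted @ rest_code (fs = []) cs1, L1, retn (fs = []) r) # Gs @ Fs)"
      "fs1 = (cs1, loc L1, r) # fs" "control L1 = control L" for cs1 L1
    by (rule found[of "(inserted @ rest_code (fs = []) cs1, L1, retn (fs = []) r) # Gs"]) (use that Gs in simp_all)
  have pop: thesis
    if "step lbody (a, V, (rest_code (fs = []) cs, L, retn (fs = []) r) # Gs @ Fs) (a, V, pop L (retn (fs = []) r) (Gs @ Fs))"
      "fs1 = pop (loc L) r fs" "a1 = atom V" "s1 = shared V" "g1 = glob V"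
  proof -
    obtain cs2 l2 r2 fs2 where fs: "fs = (cs2, l2, r2) # fs2" using ne \<open>fs1 = pop (loc L) r fs\<close> by (cases fs) auto
    then obtain L2 Gs2 where Gs2: "Gs = (inserted @ rest_code (fs2 = []) cs2, L2, retn (fs2 = []) r2) # Gs2"
      "loc L2 = l2" "suspended fs2 Gs2" using Gs by auto
    let ?Us = "(inserted @ rest_code (fs2 = []) cs2, L\<lparr>loc := r (loc L) (loc L2)\<rparr>, retn (fs2 = []) r2) # Gs2"
    have "pop L (retn (fs = []) r) (Gs @ Fs) = ?Us @ Fs" by (simp add: fs Gs2(1) retn_def)
    moreover have "suspended fs1 ?Us" using Gs2 \<open>fs1 = pop (loc L) r fs\<close> by (simp add: fs)
    ultimately show thesis
      using found[of ?Us] that by (simp add: control_def)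
  qed
  show thesis
  proof (cases cs)
    case Nil
    with st ne have "fs \<noteq> []" by (auto simp: step_simps)
    with st Nil show ?thesis by (intro pop) (auto simp: step_simps)
  next
    case (Cons c cs')
    show ?thesis
    proof (cases c)
      case (Update p u)
      from st obtain l1 where 1: "((s1, g1), l1) \<in> u ((shared V, glob V), loc L)" "a1 = atom V" "fs1 = (cs', l1, r) # fs"
        unfolding Cons Update step_simps by blast
      then have "((V\<lparr>shared := s1, glob := g1\<rparr>, L\<lparr>loc := l1\<rparr>)) \<in> wr (V, L) ` u (rd (V, L))"
        by (force simp: wr_def rd_def)
      then show ?thesis using 1
        by (intro frame[of cs' "L\<lparr>loc := l1\<rparr>"]) (auto simp: Cons Update step_simps control_def)
    next
      case (Assume p e)
      with st show ?thesis
        by (intro frame[of cs' L]) (auto simp: Cons step_simps control_def rd_def)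
    next
      case (Assert p e)
      with st show ?thesis
        by (intro frame[of cs' L]) (auto simp: Cons step_simps control_def rd_def)
    next
      case (Ite p e xs ys)
      from st consider "may_eval e ((shared V, glob V), loc L) True" "a1 = atom V" "s1 = shared V" "g1 = glob V" "fs1 = (xs @ cs', loc L, r) # fs"
        | "may_eval e ((shared V, glob V), loc L) False" "a1 = atom V" "s1 = shared V" "g1 = glob V" "fs1 = (ys @ cs', loc L, r) # fs"
        unfolding Cons Ite step_simps by auto
      then show ?thesis
      proof cases
        case 1
        then show ?thesis
          by (intro frame[of "xs @ cs'" L]) (simp_all add: Cons Ite step_simps control_def rd_def rest_code_append)
      next
        case 2
        then show ?thesis
          by (intro frame[of "ys @ cs'" L]) (simp_all add: Cons Ite step_simps control_def rd_def rest_code_append)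
      qed
    next
      case (While p e xs)
      from st consider "may_eval e ((shared V, glob V), loc L) True" "a1 = atom V" "s1 = shared V" "g1 = glob V" "fs1 = (xs @ While p e xs # cs', loc L, r) # fs"
        | "may_eval e ((shared V, glob V), loc L) False" "a1 = atom V" "s1 = shared V" "g1 = glob V" "fs1 = (cs', loc L, r) # fs"
        unfolding Cons While step_simps by auto
      then show ?thesis
      proof cases
        case 1
        then show ?thesis
          by (intro frame[of "xs @ While p e xs # cs'" L])
            (simp_all add: Cons While step_simps control_def rd_def flip: rest_code_append)
      next
        case 2
        then show ?thesis
          by (intro frame[of cs' L]) (simp_all add: Cons While step_simps control_def rd_def)
      qed
    next
      case (BeginAtomic p)
      with st show ?thesis
        by (intro frame[of cs' L]) (auto simp: Cons step_simps control_def)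
    next
      case (EndAtomic p)
      with st show ?thesis
        by (intro frame[of cs' L]) (auto simp: Cons step_simps control_def)
    next
      case (Call p m args res)
      from st obtain l where l: "l \<in> args ((shared V, glob V), loc L)"
        and c': "a1 = atom V" "s1 = shared V" "g1 = glob V" "fs1 = (body M m, l, res) # (cs', loc L, r) # fs"
        unfolding Cons Call step_simps by auto
      let ?Us = "(inserted @ rest_code False (body M m), L\<lparr>loc := l\<rparr>, retn False res) #
          (inserted @ rest_code (fs = []) cs', L, retn (fs = []) r) # Gs"
      show ?thesis
        by (rule found[of ?Us]) (use l c' Gs in \<open>auto simp: Cons Call step_simps control_def lift_call_def rd_def retn_def\<close>)
    next
      case (Return p)
      with st ne have "fs \<noteq> []" by (auto simp: Cons step_simps)
      with st Return show ?thesis by (intro pop) (auto simp: Cons step_simps)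
    qed
  qed
qed

text \<open>After a switch a thread resumes at \<open>loop\<close> and not at the start of the
  inserted code. From either position it can go on with the next statement or, outside atomic
  blocks, switch again.\<close>

definition poised where
  "poised fs Us \<longleftrightarrow> (\<exists>cs r fs' X L Gs. fs = (cs, loc L, r) # fs' \<and> (X = inserted \<or> X = [loop]) \<and>
     Us = (X @ rest_code (fs' = []) cs, L, retn (fs' = []) r) # Gs \<and> suspended fs' Gs)"

lemma suspended_poised: "suspended fs Us \<Longrightarrow> fs \<noteq> [] \<Longrightarrow> poised fs Us"
  by (cases fs) (auto simp: poised_def)

lemma inserted_skip:
  assumes "\<not> terminate V" "X = inserted \<or> X = [loop]"
  shows "lsteps (a, V, (X @ cs, L, R) # Fs) (a, V, (cs, L, R) # Fs)"
proof -
  have loop: "lsteps (a, V, (loop # cs, L, R) # Fs) (a, V, (cs, L, R) # Fs)"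
    by (rule r_into_rtranclp) (simp add: loop_eq step_simps)
  then have "lsteps (a, V, (Ite None (Expr (\<lambda>(V, L). \<not> atom V)) [loop] [] # cs, L, R) # Fs) (a, V, (cs, L, R) # Fs)"
    by (cases "atom V") (auto simp: step_simps intro: lsteps_step)
  then have "lsteps (a, V, (inserted @ cs, L, R) # Fs) (a, V, (cs, L, R) # Fs)"
    using assms(1) by (auto simp: inserted_eq step_simps intro!: lsteps_step[where c' = "(a, V, (Ite None (Expr (\<lambda>(V, L). \<not> atom V)) [loop] [] # cs, L, R) # Fs)"])
  with loop assms(2) show ?thesis by auto
qed

lemma inserted_switch:
  assumes "\<not> terminate V" "\<not> atom V" "X = inserted \<or> X = [loop]"
  shows "lsteps (a, V, (X @ cs, L, R) # Fs) (a, V, (switch # loop # cs, L, R) # Fs)"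
proof -
  have loop: "lsteps (a, V, (loop # cs, L, R) # Fs) (a, V, (switch # loop # cs, L, R) # Fs)"
    by (rule r_into_rtranclp) (simp add: loop_eq step_simps)
  then have "lsteps (a, V, (Ite None (Expr (\<lambda>(V, L). \<not> atom V)) [loop] [] # cs, L, R) # Fs) (a, V, (switch # loop # cs, L, R) # Fs)"
    using assms(2) by (auto simp: step_simps intro: lsteps_step)
  then have "lsteps (a, V, (inserted @ cs, L, R) # Fs) (a, V, (switch # loop # cs, L, R) # Fs)"
    using assms(1) by (auto simp: inserted_eq step_simps intro!: lsteps_step[where c' = "(a, V, (Ite None (Expr (\<lambda>(V, L). \<not> atom V)) [loop] [] # cs, L, R) # Fs)"])
  with loop assms(3) show ?thesis by auto
qed

text \<open>
  A thread that has returned from its main procedure has an empty stack, whereas its simulation stays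
  in front of the final return statement, which the lazy program cannot execute.
\<close>

definition tracks where
  "tracks fs g V Us \<longleftrightarrow> (\<exists>fs1. poised fs1 Us \<and> (fs = [] \<or> fs = fs1 \<and> glob V = g))"

text \<open>The inserted code in front of each statement is skipped. An empty stack admits no
  further step, so the simulation can fall behind only at the very end.\<close>

lemma tracks_steps:
  assumes "(step (body M))\<^sup>*\<^sup>* (atom V, (shared V, g), fs) c" "c = (a1, (s1, g1), fs1)"
    "tracks fs g V Us" "\<not> terminate V"
  shows "\<exists>V1 Us1. lsteps (a, V, Us @ Fs) (a, V1, Us1 @ Fs) \<and> tracks fs1 g1 V1 Us1 \<and>
    atom V1 = a1 \<and> shared V1 = s1 \<and> \<not> terminate V1 \<and> control (top_locals Us1) = control (top_locals Us)"
  using assms(1,2)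
proof (induction arbitrary: a1 s1 g1 fs1 rule: rtranclp_induct)
  case base
  then show ?case using assms(3,4) by (intro exI[of _ V] exI[of _ Us]) auto
next
  case (step c1 c2)
  obtain a2 s2 g2 fs2 where c1: "c1 = (a2, (s2, g2), fs2)" by (cases c1) auto
  from step.IH[OF c1] obtain V2 Us2 where 2: "lsteps (a, V, Us @ Fs) (a, V2, Us2 @ Fs)" "tracks fs2 g2 V2 Us2"
    "atom V2 = a2" "shared V2 = s2" "\<not> terminate V2" "control (top_locals Us2) = control (top_locals Us)" by blast
  from step.hyps(2) have "fs2 \<noteq> []" unfolding c1 by (auto simp: step_simps)
  with 2(2) have g2: "glob V2 = g2" and "poised fs2 Us2" unfolding tracks_def by auto
  then obtain cs r fs' X L Gs where fs2: "fs2 = (cs, loc L, r) # fs'" "X = inserted \<or> X = [loop]"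
     "Us2 = (X @ rest_code (fs' = []) cs, L, retn (fs' = []) r) # Gs" "suspended fs' Gs"
    unfolding poised_def by blast
  have st: "step (body M) (atom V2, (shared V2, glob V2), (cs, loc L, r) # fs') (a1, (s1, g1), fs1)"
    using step.hyps(2) unfolding c1 step.prems fs2(1) 2(3,4) g2 .
  show ?case
  proof (cases "fs1 = []")
    case True
    have "a1 = a2" "s1 = s2" using step_to_empty[OF st[unfolded True]] 2(3,4) by simp_all
    moreover have "tracks fs1 g1 V2 Us2" using \<open>poised fs2 Us2\<close> True unfolding tracks_def by blast
    ultimately show ?thesis
      using 2 by (intro exI[of _ V2] exI[of _ Us2]) simp
  next
    case False
    obtain Us1 where 1: "suspended fs1 Us1" "control (top_locals Us1) = control L"
      "step lbody (a, V2, (rest_code (fs' = []) cs, L, retn (fs' = []) r) # Gs @ Fs)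
        (a, V2\<lparr>atom := a1, shared := s1, glob := g1\<rparr>, Us1 @ Fs)"
      by (rule ready_step[OF st fs2(4) False])
    have "lsteps (a, V2, Us2 @ Fs) (a, V2, (rest_code (fs' = []) cs, L, retn (fs' = []) r) # Gs @ Fs)"
      unfolding fs2(3) using inserted_skip[OF 2(5) fs2(2)] by simp
    from rtranclp_trans[OF 2(1) rtranclp.rtrancl_into_rtrancl[OF this 1(3)]]
    have "lsteps (a, V, Us @ Fs) (a, V2\<lparr>atom := a1, shared := s1, glob := g1\<rparr>, Us1 @ Fs)" .
    moreover have "tracks fs1 g1 (V2\<lparr>atom := a1, shared := s1, glob := g1\<rparr>) Us1"
      unfolding tracks_def using suspended_poised[OF 1(1) False] by auto
    ultimately show ?thesis
      using 1(2) 2(5,6) by (intro exI[of _ "V2\<lparr>atom := a1, shared := s1, glob := g1\<rparr>"] exI[of _ Us1]) (simp add: fs2(3))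
  qed
qed

lemma unwind_steps:
  assumes "terminate V" "unwinding Gs" "Gs = [] \<Longrightarrow> R = keep" "Fs \<noteq> []"
  shows "lsteps (a, V, pop L R (Gs @ Fs)) (a, V, Fs)"
  using assms(2,3)
proof (induction Gs arbitrary: L R)
  case Nil
  obtain cs L' R' Fs' where "Fs = (cs, L', R') # Fs'" using assms(4) by (cases Fs) auto
  then show ?case using Nil by (simp add: keep_def)
next
  case (Cons G Gs)
  obtain cs L' R' where G: "G = (inserted @ cs, L', R')"
    using Cons.prems(1) unfolding unwinding_def by auto
  have "unwinding Gs" "Gs = [] \<Longrightarrow> R' = keep"
    using Cons.prems(1) unfolding unwinding_def by (auto simp: G)
  note IH = Cons.IH[OF this]
  let ?c = "(Return None # Ite None (Expr (\<lambda>(V, L). \<not> atom V)) [loop] [] # cs, R L L', R') # Gs @ Fs"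
  have "step lbody (a, V, (inserted @ cs, R L L', R') # Gs @ Fs) (a, V, ?c)"
    using assms(1) by (simp add: inserted_eq step_simps)
  moreover have "step lbody (a, V, ?c) (a, V, pop (R L L') R' (Gs @ Fs))"
    by (simp add: step_simps)
  ultimately have "lsteps (a, V, (inserted @ cs, R L L', R') # Gs @ Fs) (a, V, Fs)"
    using IH by (blast intro: lsteps_step)
  then show ?case by (simp add: G)
qed

section \<open>Calls of \<open>linear_int\<close> that return\<close>

lemma linear_int_start:
  assumes "x \<in> thread_initial M"
  obtains Us where "lsteps (a, V, (linear_int M, L, keep) # Fs) (a, V\<lparr>glob := fst x, shared := qi L 1\<rparr>, Us @ Fs)"
    "suspended (snd x) Us" "snd x \<noteq> []" "control (top_locals Us) = (qi L, qo L, bound L, lt, 1)"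
proof -
  obtain g l where x: "x = (g, [(body M (main M), l, keep)])" "(g, l) \<in> inits M"
    using assms by (auto simp: thread_initial_def)
  let ?c = "inserted @ rest_code True (body M (main M))"
  let ?L1 = "L\<lparr>lst := lt\<rparr>" and ?L2 = "L\<lparr>lst := lt, jj := 1\<rparr>" and ?L3 = "L\<lparr>lst := lt, jj := 1, loc := l\<rparr>"
  let ?U = "Update None (\<lambda>(V, L). {(V\<lparr>glob := g\<rparr>, L\<lparr>loc := l\<rparr>) |g l. (g, l) \<in> inits M})"
  let ?W = "setg (\<lambda>(V, L). V\<lparr>shared := qi L 1\<rparr>)"
  have "step lbody (a, V, (linear_int M, L, keep) # Fs) (a, V, (setl (\<lambda>(V, L). L\<lparr>jj := 1\<rparr>) # ?U # ?W # ?c, ?L1, keep) # Fs)"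
    by (auto simp: linear_int_eq step_simps)
  moreover have "step lbody (a, V, (setl (\<lambda>(V, L). L\<lparr>jj := 1\<rparr>) # ?U # ?W # ?c, ?L1, keep) # Fs) (a, V, (?U # ?W # ?c, ?L2, keep) # Fs)"
    by (simp add: step_simps)
  moreover have "step lbody (a, V, (?U # ?W # ?c, ?L2, keep) # Fs) (a, V\<lparr>glob := g\<rparr>, (?W # ?c, ?L3, keep) # Fs)"
    using x(2) by (auto simp: step_simps)
  moreover have "step lbody (a, V\<lparr>glob := g\<rparr>, (?W # ?c, ?L3, keep) # Fs) (a, V\<lparr>glob := g, shared := qi L 1\<rparr>, (?c, ?L3, keep) # Fs)"
    by (simp add: step_simps)
  ultimately have "lsteps (a, V, (linear_int M, L, keep) # Fs) (a, V\<lparr>glob := g, shared := qi L 1\<rparr>, [(?c, ?L3, keep)] @ Fs)"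
    by (auto intro: lsteps_step)
  then show thesis
    by (intro that[of "[(?c, ?L3, keep)]"]) (simp_all add: retn_def x(1) control_def)
qed

text \<open>Expected outputs are prescribed for rounds below \<open>b\<close>; \<open>h b\<close>
  shows up as the shared state on return, for the caller to check or to pass on. Only the existence
  of a suitable run is claimed.\<close>

definition returns where
  "returns g h b \<longleftrightarrow> (\<forall>a V L Fs. (\<forall>r \<in> {1..b}. qi L r = g r) \<longrightarrow> (\<forall>r \<in> {1..<b}. qo L r = h r) \<longrightarrow>
     bound L = b \<longrightarrow> \<not> terminate V \<longrightarrow> \<not> atom V \<longrightarrow> Fs \<noteq> [] \<longrightarrow>
     (\<exists>V'. lsteps (a, V, (linear_int M, L, keep) # Fs) (a, V', Fs) \<and>
       shared V' = h b \<and> terminate V' \<and> \<not> atom V'))"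

lemma poised_switch:
  assumes "poised fs Us" "\<not> terminate V" "\<not> atom V"
  obtains cs R Gs where "lsteps (a, V, Us @ Fs) (a, V, (switch # loop # cs, top_locals Us, R) # Gs @ Fs)"
    "\<And>L'. loc L' = loc (top_locals Us) \<Longrightarrow> poised fs ((loop # cs, L', R) # Gs)"
    "unwinding Gs" "Gs = [] \<Longrightarrow> R = keep"
proof -
  from assms(1) obtain cs r fs' X L Gs where fs: "fs = (cs, loc L, r) # fs'" "X = inserted \<or> X = [loop]"
     "Us = (X @ rest_code (fs' = []) cs, L, retn (fs' = []) r) # Gs" "suspended fs' Gs"
    unfolding poised_def by blast
  show thesis
  proof (rule that)
    show "lsteps (a, V, Us @ Fs) (a, V, (switch # loop # rest_code (fs' = []) cs, top_locals Us, retn (fs' = []) r) # Gs @ Fs)"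
      using inserted_switch[OF assms(2,3) fs(2)] by (simp add: fs(3))
    show "poised fs ((loop # rest_code (fs' = []) cs, L', retn (fs' = []) r) # Gs)"
      if "loc L' = loc (top_locals Us)" for L'
      unfolding poised_def using that fs
      by (intro exI[of _ cs] exI[of _ r] exI[of _ fs'] exI[of _ "[loop]"] exI[of _ L'] exI[of _ Gs]) simp
    show "unwinding Gs" "Gs = [] \<Longrightarrow> retn (fs' = []) r = keep"
      using suspended_unwinding[OF fs(4)] by (auto simp: retn_def)
  qed
qed

lemma switch_last:
  assumes "lst L" "jj L \<noteq> bound L" "qo L (jj L) = shared V"
  shows "lsteps (a, V, (switch # cs, L, R) # Fs) (a, V\<lparr>shared := qi L (Suc (jj L))\<rparr>, (cs, L\<lparr>jj := Suc (jj L)\<rparr>, R) # Fs)"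
proof -
  let ?A = "Assume None (\<lambda>(V, L). qo L (jj L) = shared V)"
  let ?J = "setl (\<lambda>(V, L). L\<lparr>jj := jj L + 1\<rparr>)"
  let ?S = "setg (\<lambda>(V, L). V\<lparr>shared := qi L (jj L)\<rparr>)"
  let ?i = "Ite None (Expr (\<lambda>(V, L). jj L = bound L)) [setg (\<lambda>(V, L). V\<lparr>terminate := True\<rparr>), Return None] [?A, ?J, ?S]"
  let ?L = "L\<lparr>jj := Suc (jj L)\<rparr>"
  have "step lbody (a, V, (switch # cs, L, R) # Fs) (a, V, (?i # cs, L, R) # Fs)"
    using assms by (simp add: switch_eq step_simps)
  moreover have "step lbody (a, V, (?i # cs, L, R) # Fs) (a, V, (?A # ?J # ?S # cs, L, R) # Fs)"
    using assms by (simp add: step_simps)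
  moreover have "step lbody (a, V, (?A # ?J # ?S # cs, L, R) # Fs) (a, V, (?J # ?S # cs, L, R) # Fs)"
    using assms by (simp add: step_simps)
  moreover have "step lbody (a, V, (?J # ?S # cs, L, R) # Fs) (a, V, (?S # cs, ?L, R) # Fs)"
    by (simp add: step_simps)
  moreover have "step lbody (a, V, (?S # cs, ?L, R) # Fs) (a, V\<lparr>shared := qi L (Suc (jj L))\<rparr>, (cs, ?L, R) # Fs)"
    by (simp add: step_simps)
  ultimately show ?thesis by (auto intro: lsteps_step)
qed

lemma switch_terminate:
  assumes "lst L" "jj L = bound L"
  shows "lsteps (a, V, (switch # cs, L, R) # Fs) (a, V\<lparr>terminate := True\<rparr>, pop L R Fs)"
proof -
  let ?A = "Assume None (\<lambda>(V, L). qo L (jj L) = shared V)"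
  let ?J = "setl (\<lambda>(V, L). L\<lparr>jj := jj L + 1\<rparr>)"
  let ?S = "setg (\<lambda>(V, L). V\<lparr>shared := qi L (jj L)\<rparr>)"
  let ?T = "setg (\<lambda>(V, L). V\<lparr>terminate := True\<rparr>)"
  let ?i = "Ite None (Expr (\<lambda>(V, L). jj L = bound L)) [?T, Return None] [?A, ?J, ?S]"
  let ?V = "V\<lparr>terminate := True\<rparr>"
  have "step lbody (a, V, (switch # cs, L, R) # Fs) (a, V, (?i # cs, L, R) # Fs)"
    using assms by (simp add: switch_eq step_simps)
  moreover have "step lbody (a, V, (?i # cs, L, R) # Fs) (a, V, (?T # Return None # cs, L, R) # Fs)"
    using assms by (simp add: step_simps)
  moreover have "step lbody (a, V, (?T # Return None # cs, L, R) # Fs) (a, ?V, (Return None # cs, L, R) # Fs)"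
    by (simp add: step_simps)
  moreover have "step lbody (a, ?V, (Return None # cs, L, R) # Fs) (a, ?V, pop L R Fs)"
    by (simp add: step_simps)
  ultimately show ?thesis by (auto intro: lsteps_step)
qed

abbreviation calling where
  "calling V L \<equiv> L\<lparr>qi := (qi L)(jj L := shared V), save := glob V\<rparr>"

lemma switch_call:
  assumes "\<not> lst L" "qi L' = (qi L)(jj L := shared V)" "qo L' = qo L" "bound L' = jj L"
  shows "lsteps (a, V, (switch # cs, L, R) # Fs) (a, V, (linear_int M, L', keep) # (resume # cs, calling V L, R) # Fs)"
proof -
  let ?Q = "setl (\<lambda>(V, L). L\<lparr>qi := (qi L)(jj L := shared V)\<rparr>)"
  let ?S = "setl (\<lambda>(V, L). L\<lparr>save := glob V\<rparr>)"
  let ?C = "Call None LinearInt (\<lambda>(V, L). {L'. qi L' = qi L \<and> qo L' = qo L \<and> bound L' = jj L}) keep"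
  let ?L = "L\<lparr>qi := (qi L)(jj L := shared V)\<rparr>"
  have "step lbody (a, V, (switch # cs, L, R) # Fs) (a, V, (?Q # ?S # ?C # resume # cs, L, R) # Fs)"
    using assms by (simp add: switch_eq step_simps)
  moreover have "step lbody (a, V, (?Q # ?S # ?C # resume # cs, L, R) # Fs) (a, V, (?S # ?C # resume # cs, ?L, R) # Fs)"
    by (simp add: step_simps)
  moreover have "step lbody (a, V, (?S # ?C # resume # cs, ?L, R) # Fs) (a, V, (?C # resume # cs, calling V L, R) # Fs)"
    by (simp add: step_simps)
  moreover have "step lbody (a, V, (?C # resume # cs, calling V L, R) # Fs) (a, V, (linear_int M, L', keep) # (resume # cs, calling V L, R) # Fs)"
    using assms(2-4) by (simp add: step_simps)
  ultimately show ?thesis by (auto intro: lsteps_step)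
qed

lemma resume_return:
  assumes "jj L = bound L"
  shows "lsteps (a, V, (resume # cs, L, R) # Fs) (a, V, pop L R Fs)"
proof -
  have "\<exists>zs. step lbody (a, V, (resume # cs, L, R) # Fs) (a, V, (Return None # zs, L, R) # Fs)"
    using assms by (simp add: resume_eq step_simps)
  then obtain zs where "step lbody (a, V, (resume # cs, L, R) # Fs) (a, V, (Return None # zs, L, R) # Fs)" ..
  moreover have "step lbody (a, V, (Return None # zs, L, R) # Fs) (a, V, pop L R Fs)"
    by (simp add: step_simps)
  ultimately show ?thesis by (auto intro: lsteps_step)
qed

lemma resume_continue:
  assumes "jj L \<noteq> bound L" "qo L (jj L) = shared V"
  shows "lsteps (a, V, (resume # cs, L, R) # Fs)
    (a, V\<lparr>glob := save L, terminate := False, shared := qi L (Suc (jj L))\<rparr>, (cs, L\<lparr>jj := Suc (jj L)\<rparr>, R) # Fs)"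
proof -
  let ?A = "Assume None (\<lambda>(V, L). qo L (jj L) = shared V)"
  let ?G = "setg (\<lambda>(V, L). V\<lparr>glob := save L\<rparr>)"
  let ?T = "setg (\<lambda>(V, L). V\<lparr>terminate := False\<rparr>)"
  let ?J = "setl (\<lambda>(V, L). L\<lparr>jj := jj L + 1\<rparr>)"
  let ?S = "setg (\<lambda>(V, L). V\<lparr>shared := qi L (jj L)\<rparr>)"
  let ?L = "L\<lparr>jj := Suc (jj L)\<rparr>" and ?V1 = "V\<lparr>glob := save L\<rparr>" and ?V2 = "V\<lparr>glob := save L, terminate := False\<rparr>"
  have "step lbody (a, V, (resume # cs, L, R) # Fs) (a, V, (?A # ?G # ?T # ?J # ?S # cs, L, R) # Fs)"
    using assms by (simp add: resume_eq step_simps)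
  moreover have "step lbody (a, V, (?A # ?G # ?T # ?J # ?S # cs, L, R) # Fs) (a, V, (?G # ?T # ?J # ?S # cs, L, R) # Fs)"
    using assms by (simp add: step_simps)
  moreover have "step lbody (a, V, (?G # ?T # ?J # ?S # cs, L, R) # Fs) (a, ?V1, (?T # ?J # ?S # cs, L, R) # Fs)"
    by (simp add: step_simps)
  moreover have "step lbody (a, ?V1, (?T # ?J # ?S # cs, L, R) # Fs) (a, ?V2, (?J # ?S # cs, L, R) # Fs)"
    by (simp add: step_simps)
  moreover have "step lbody (a, ?V2, (?J # ?S # cs, L, R) # Fs) (a, ?V2, (?S # cs, ?L, R) # Fs)"
    by (simp add: step_simps)
  moreover have "step lbody (a, ?V2, (?S # cs, ?L, R) # Fs) (a, ?V2\<lparr>shared := qi L (Suc (jj L))\<rparr>, (cs, ?L, R) # Fs)"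
    by (simp add: step_simps)
  ultimately show ?thesis by (auto intro: lsteps_step)
qed

text \<open>After \<open>n\<close> rounds, at the beginning of round \<open>Suc n\<close>. The
  entries of \<open>qi\<close> from \<open>Suc n\<close> on are still inputs; the earlier ones hold
  outputs, except in the last thread, which records none.\<close>

definition at_round where
  "at_round n lt b f g h y V Us \<longleftrightarrow> tracks (snd y) (fst y) V Us \<and> \<not> terminate V \<and> \<not> atom V \<and>
     shared V = f (Suc n) \<and> bound (top_locals Us) = b \<and> lst (top_locals Us) = lt \<and> jj (top_locals Us) = Suc n \<and>
     (\<forall>r \<in> {Suc n..b}. qi (top_locals Us) r = f r) \<and> (\<forall>r \<in> {1..<b}. qo (top_locals Us) r = h r) \<and>
     (\<not> lt \<longrightarrow> (\<forall>r \<in> {1..n}. qi (top_locals Us) r = g r))"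

text \<open>Here round \<open>Suc n\<close> has been run, but its output is still in the shared
  state and not yet in \<open>qi\<close>.\<close>

definition after_round where
  "after_round n lt b f g h y V Us \<longleftrightarrow> tracks (snd y) (fst y) V Us \<and> \<not> terminate V \<and> \<not> atom V \<and>
     shared V = g (Suc n) \<and> bound (top_locals Us) = b \<and> lst (top_locals Us) = lt \<and> jj (top_locals Us) = Suc n \<and>
     (\<forall>r \<in> {Suc n..b}. qi (top_locals Us) r = f r) \<and> (\<forall>r \<in> {1..<b}. qo (top_locals Us) r = h r) \<and>
     (\<not> lt \<longrightarrow> (\<forall>r \<in> {1..n}. qi (top_locals Us) r = g r))"

lemma at_round_run:
  assumes "at_round n lt b f g h y V Us" "mround M (f (Suc n)) y (g (Suc n)) z"
  obtains V' Us' where "lsteps (a, V, Us @ Fs) (a, V', Us' @ Fs)" "after_round n lt b f g h z V' Us'"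
proof -
  have "(step (body M))\<^sup>*\<^sup>* (atom V, (shared V, fst y), snd y) (False, (g (Suc n), fst z), snd z)"
    using assms unfolding at_round_def mround_def by simp
  from tracks_steps[OF this refl, of Us a Fs] assms(1) obtain V' Us' where
    "lsteps (a, V, Us @ Fs) (a, V', Us' @ Fs)" "tracks (snd z) (fst z) V' Us'" "\<not> atom V'"
    "shared V' = g (Suc n)" "\<not> terminate V'" "control (top_locals Us') = control (top_locals Us)"
    unfolding at_round_def by auto
  then show thesis
    using assms(1) by (intro that[of V' Us']) (auto simp: at_round_def after_round_def control_eq)
qed

lemma next_round_last:
  assumes "after_round n True b f g h y V Us" "Suc n < b" "g (Suc n) = h (Suc n)"
  obtains V' Us' where "lsteps (a, V, Us @ Fs) (a, V', Us' @ Fs)" "at_round (Suc n) True b f g h y V' Us'"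
proof -
  let ?T = "top_locals Us"
  have T: "\<not> terminate V" "\<not> atom V" "shared V = g (Suc n)" "bound ?T = b" "lst ?T" "jj ?T = Suc n"
    "\<forall>r \<in> {Suc n..b}. qi ?T r = f r" "\<forall>r \<in> {1..<b}. qo ?T r = h r"
    using assms(1) unfolding after_round_def by auto
  obtain fs where fs: "poised fs Us" "snd y = [] \<or> snd y = fs \<and> glob V = fst y"
    using assms(1) unfolding after_round_def tracks_def by auto
  obtain cs R Gs where sw: "lsteps (a, V, Us @ Fs) (a, V, (switch # loop # cs, ?T, R) # Gs @ Fs)"
    "\<And>L'. loc L' = loc ?T \<Longrightarrow> poised fs ((loop # cs, L', R) # Gs)"
    by (rule poised_switch[OF fs(1) T(1,2), of a Fs]) blast
  let ?L = "?T\<lparr>jj := Suc (jj ?T)\<rparr>"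
  let ?V = "V\<lparr>shared := qi ?T (Suc (jj ?T))\<rparr>"
  have "lsteps (a, V, (switch # loop # cs, ?T, R) # Gs @ Fs) (a, ?V, (loop # cs, ?L, R) # Gs @ Fs)"
    by (rule switch_last) (use T assms(2,3) in auto)
  from rtranclp_trans[OF sw(1) this] have "lsteps (a, V, Us @ Fs) (a, ?V, ((loop # cs, ?L, R) # Gs) @ Fs)" by simp
  moreover have "at_round (Suc n) True b f g h y ?V ((loop # cs, ?L, R) # Gs)"
    using T sw(2)[of ?L] fs(2) assms(2) unfolding at_round_def tracks_def by auto
  ultimately show thesis by (rule that)
qed

text \<open>Stops at the entry of the nested call because its outcome varies: it returns in
  \<open>next_round_call\<close> and \<open>linear_int_returns\<close>, and it fails in
  \<open>linear_int_violates\<close>.\<close>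

lemma call_rest:
  assumes "after_round n False b f g h y V Us"
  obtains cs R Gs L' fs where
    "lsteps (a, V, Us @ Fs) (a, V, (linear_int M, L', keep) # (resume # loop # cs, calling V (top_locals Us), R) # Gs @ Fs)"
    "\<And>L'. loc L' = loc (top_locals Us) \<Longrightarrow> poised fs ((loop # cs, L', R) # Gs)"
    "unwinding Gs" "Gs = [] \<Longrightarrow> R = keep" "snd y = [] \<or> snd y = fs \<and> glob V = fst y"
    "\<forall>r \<in> {1..Suc n}. qi L' r = g r" "\<forall>r \<in> {1..<b}. qo L' r = h r" "bound L' = Suc n"
proof -
  let ?T = "top_locals Us"
  have T: "\<not> terminate V" "\<not> atom V" "shared V = g (Suc n)" "\<not> lst ?T" "jj ?T = Suc n"
    "\<forall>r \<in> {1..<b}. qo ?T r = h r" "\<forall>r \<in> {1..n}. qi ?T r = g r"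
    using assms(1) unfolding after_round_def by auto
  obtain fs where fs: "poised fs Us" "snd y = [] \<or> snd y = fs \<and> glob V = fst y"
    using assms(1) unfolding after_round_def tracks_def by auto
  obtain cs R Gs where sw: "lsteps (a, V, Us @ Fs) (a, V, (switch # loop # cs, ?T, R) # Gs @ Fs)"
    "\<And>L'. loc L' = loc ?T \<Longrightarrow> poised fs ((loop # cs, L', R) # Gs)" "unwinding Gs" "Gs = [] \<Longrightarrow> R = keep"
    by (rule poised_switch[OF fs(1) T(1,2), of a Fs]) blast
  \<comment> \<open>Apart from \<open>qi\<close>, \<open>qo\<close> and \<open>bound\<close> the
    locals of the callee are arbitrary, so those of the caller are reused.\<close>
  let ?L' = "(calling V ?T)\<lparr>bound := jj ?T\<rparr>"
  have "lsteps (a, V, (switch # loop # cs, ?T, R) # Gs @ Fs)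
      (a, V, (linear_int M, ?L', keep) # (resume # loop # cs, calling V ?T, R) # Gs @ Fs)"
    by (rule switch_call) (use T in auto)
  from rtranclp_trans[OF sw(1) this] show thesis
    by (rule that[OF _ sw(2-4) fs(2)]) (use T in \<open>auto simp: le_Suc_eq\<close>)
qed

text \<open>The later threads replay rounds 1 to \<open>Suc n\<close>. They overwrite the global
  valuation, but \<open>resume\<close> restores it from \<open>save\<close>, and so the thread is
  tracked again.\<close>

lemma next_round_call:
  assumes "after_round n False b f g h y V Us" "Suc n < b" "returns g h (Suc n)"
  obtains V' Us' where "lsteps (a, V, Us @ Fs) (a, V', Us' @ Fs)" "at_round (Suc n) False b f g h y V' Us'"
proof -
  let ?T = "top_locals Us"
  have T: "\<not> terminate V" "\<not> atom V" "shared V = g (Suc n)" "bound ?T = b" "\<not> lst ?T" "jj ?T = Suc n"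
    "\<forall>r \<in> {Suc n..b}. qi ?T r = f r" "\<forall>r \<in> {1..<b}. qo ?T r = h r" "\<forall>r \<in> {1..n}. qi ?T r = g r"
    using assms(1) unfolding after_round_def by auto
  obtain cs R Gs L' fs where call:
    "lsteps (a, V, Us @ Fs) (a, V, (linear_int M, L', keep) # (resume # loop # cs, calling V ?T, R) # Gs @ Fs)"
    "\<And>L'. loc L' = loc ?T \<Longrightarrow> poised fs ((loop # cs, L', R) # Gs)"
    "snd y = [] \<or> snd y = fs \<and> glob V = fst y"
    "\<forall>r \<in> {1..Suc n}. qi L' r = g r" "\<forall>r \<in> {1..<b}. qo L' r = h r" "bound L' = Suc n"
    by (rule call_rest[OF assms(1), of a Fs], rule that)
  have "\<forall>r \<in> {1..<Suc n}. qo L' r = h r" using call(5) assms(2) by auto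
  then obtain V1 where V1: "lsteps (a, V, (linear_int M, L', keep) # (resume # loop # cs, calling V ?T, R) # Gs @ Fs)
      (a, V1, (resume # loop # cs, calling V ?T, R) # Gs @ Fs)" "shared V1 = h (Suc n)" "\<not> atom V1"
    using assms(3) call(4,6) T(1,2) unfolding returns_def by blast
  let ?L = "(calling V ?T)\<lparr>jj := Suc (jj (calling V ?T))\<rparr>"
  let ?V = "V1\<lparr>glob := save (calling V ?T), terminate := False, shared := qi (calling V ?T) (Suc (jj (calling V ?T)))\<rparr>"
  have "lsteps (a, V1, (resume # loop # cs, calling V ?T, R) # Gs @ Fs) (a, ?V, (loop # cs, ?L, R) # Gs @ Fs)"
    by (rule resume_continue) (use T V1(2) assms(2) in auto)
  from rtranclp_trans[OF call(1) rtranclp_trans[OF V1(1) this]]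
  have "lsteps (a, V, Us @ Fs) (a, ?V, ((loop # cs, ?L, R) # Gs) @ Fs)" by simp
  moreover have "at_round (Suc n) False b f g h y ?V ((loop # cs, ?L, R) # Gs)"
    using T V1(3) call(2)[of ?L] call(3) assms(2) unfolding at_round_def tracks_def by (auto simp: le_Suc_eq)
  ultimately show thesis by (rule that)
qed

text \<open>A thread that is not the last one makes a call with bound \<open>r\<close> after each
  round \<open>r\<close>, hence the hypothesis on all these bounds.\<close>

lemma advance:
  assumes "x \<in> thread_initial M" "\<forall>r \<in> {1..b}. qi L r = f r" "\<forall>r \<in> {1..<b}. qo L r = h r" "bound L = b"
    "\<not> terminate V" "\<not> atom V" "column (mround M) n f g x y" "Suc n \<le> b"
    "if lt then \<forall>r \<in> {1..n}. g r = h r else \<forall>r \<in> {1..n}. returns g h r"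
  shows "\<exists>V' Us. lsteps (a, V, (linear_int M, L, keep) # Fs) (a, V', Us @ Fs) \<and> at_round n lt b f g h y V' Us"
  using assms(7-9)
proof (induction n arbitrary: y)
  case 0
  obtain Us where Us: "lsteps (a, V, (linear_int M, L, keep) # Fs) (a, V\<lparr>glob := fst x, shared := qi L 1\<rparr>, Us @ Fs)"
    "suspended (snd x) Us" "snd x \<noteq> []" and "control (top_locals Us) = (qi L, qo L, bound L, lt, 1)"
    by (rule linear_int_start[OF assms(1)])
  then have ctl: "qi (top_locals Us) = qi L" "qo (top_locals Us) = qo L" "bound (top_locals Us) = bound L"
    "lst (top_locals Us) = lt" "jj (top_locals Us) = 1" by (simp_all add: control_def)
  have "at_round 0 lt b f g h y (V\<lparr>glob := fst x, shared := qi L 1\<rparr>) Us"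
    using assms(2-6) 0 suspended_poised[OF Us(2,3)] ctl unfolding at_round_def tracks_def by auto
  with Us(1) show ?case by blast
next
  case (Suc n)
  then obtain z where z: "column (mround M) n f g x z" "mround M (f (Suc n)) z (g (Suc n)) y" by auto
  have "if lt then \<forall>r \<in> {1..n}. g r = h r else \<forall>r \<in> {1..n}. returns g h r"
    using Suc.prems(3) by (auto split: if_splits)
  with Suc.IH[OF z(1)] Suc.prems(2) obtain V1 Us1 where 1: "lsteps (a, V, (linear_int M, L, keep) # Fs) (a, V1, Us1 @ Fs)"
    "at_round n lt b f g h z V1 Us1" by auto
  obtain V2 Us2 where 2: "lsteps (a, V1, Us1 @ Fs) (a, V2, Us2 @ Fs)" "after_round n lt b f g h y V2 Us2"
    by (rule at_round_run[OF 1(2) z(2)])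
  have "\<exists>V3 Us3. lsteps (a, V2, Us2 @ Fs) (a, V3, Us3 @ Fs) \<and> at_round (Suc n) lt b f g h y V3 Us3"
  proof (cases lt)
    case True
    with 2(2) Suc.prems have "after_round n True b f g h y V2 Us2" "Suc n < b" "g (Suc n) = h (Suc n)" by auto
    then obtain V3 Us3 where "lsteps (a, V2, Us2 @ Fs) (a, V3, Us3 @ Fs)" "at_round (Suc n) True b f g h y V3 Us3"
      by (rule next_round_last)
    with True show ?thesis by auto
  next
    case False
    with 2(2) Suc.prems have "after_round n False b f g h y V2 Us2" "Suc n < b" "returns g h (Suc n)" by auto
    then obtain V3 Us3 where "lsteps (a, V2, Us2 @ Fs) (a, V3, Us3 @ Fs)" "at_round (Suc n) False b f g h y V3 Us3"
      by (rule next_round_call)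
    with False show ?thesis by auto
  qed
  then obtain V3 Us3 where 3: "lsteps (a, V2, Us2 @ Fs) (a, V3, Us3 @ Fs)" "at_round (Suc n) lt b f g h y V3 Us3"
    by blast
  from rtranclp_trans[OF 1(1) rtranclp_trans[OF 2(1) 3(1)]] 3(2) show ?case by blast
qed

text \<open>Induction on the threads. The first one makes a call after each of its rounds, and the
  induction hypothesis, applied to truncations of the remaining interface, makes these calls return.
  With no thread remaining, \<open>last\<close> is guessed to be true.\<close>

lemma linear_int_returns:
  assumes "linear (mround M) b f h xs ys" "xs \<noteq> []" "set xs \<subseteq> thread_initial M" "1 \<le> b"
  shows "returns f h b"
  using assms
proof (induction xs arbitrary: b f ys)
  case Nil
  then show ?case by simp
next
  case (Cons x xs)
  obtain y ys' where "ys = y # ys'" using Cons.prems(1) by (cases ys) auto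
  with Cons.prems(1) obtain g where g: "column (mround M) b f g x y" "linear (mround M) b g h xs ys'" by auto
  obtain n where b: "b = Suc n" using Cons.prems(4) by (cases b) auto
  with g(1) obtain z where z: "column (mround M) n f g x z" "mround M (f (Suc n)) z (g (Suc n)) y" by auto
  have x: "x \<in> thread_initial M" using Cons.prems(3) by simp
  have rest: "returns g h r" if ne: "xs \<noteq> []" and r: "1 \<le> r" "r \<le> b" for r
  proof -
    obtain zs where "linear (mround M) r g h xs zs" using linear_mono[OF g(2) r(2)] by blast
    from Cons.IH[OF this] show ?thesis using ne r Cons.prems(3) by simp
  qed
  show ?case
    unfolding returns_def
  proof (intro allI impI)
    fix a and V :: "('s, 'g) lglobals" and L :: "('s, 'g, 'l) llocals"
      and Fs :: "(('s, 'g) lglobals, ('s, 'g, 'l) llocals, ('f, 'h) lname, (nat \<times> 'p) option) frame list"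
    assume L: "\<forall>r \<in> {1..b}. qi L r = f r" "\<forall>r \<in> {1..<b}. qo L r = h r" "bound L = b"
      "\<not> terminate V" "\<not> atom V" "Fs \<noteq> []"
    let ?lt = "xs = []"
    have last: "g r = h r" if "xs = []" "r \<in> {1..b}" for r
      using g(2) that by (cases ys') auto
    have "if ?lt then \<forall>r \<in> {1..n}. g r = h r else \<forall>r \<in> {1..n}. returns g h r"
      using last rest b by auto
    from advance[OF x L(1-5) z(1) _ this] b obtain V1 Us1 where
      1: "lsteps (a, V, (linear_int M, L, keep) # Fs) (a, V1, Us1 @ Fs)" "at_round n ?lt b f g h z V1 Us1" by blast
    obtain V2 Us2 where 2: "lsteps (a, V1, Us1 @ Fs) (a, V2, Us2 @ Fs)" "after_round n ?lt b f g h y V2 Us2"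
      by (rule at_round_run[OF 1(2) z(2)])
    let ?T = "top_locals Us2"
    have T: "\<not> terminate V2" "\<not> atom V2" "shared V2 = g b" "bound ?T = b" "lst ?T = (xs = [])" "jj ?T = b"
      using 2(2) b unfolding after_round_def by auto
    have "\<exists>V'. lsteps (a, V2, Us2 @ Fs) (a, V', Fs) \<and> shared V' = h b \<and> terminate V' \<and> \<not> atom V'"
    proof (cases "xs = []")
      case True
      obtain fs where fs: "poised fs Us2" using 2(2) unfolding after_round_def tracks_def by auto
      obtain cs R Gs where sw: "lsteps (a, V2, Us2 @ Fs) (a, V2, (switch # loop # cs, ?T, R) # Gs @ Fs)"
        "unwinding Gs" "Gs = [] \<Longrightarrow> R = keep"
        by (rule poised_switch[OF fs T(1,2), of a Fs]) blast
      let ?V = "V2\<lparr>terminate := True\<rparr>"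
      have "lsteps (a, V2, (switch # loop # cs, ?T, R) # Gs @ Fs) (a, ?V, pop ?T R (Gs @ Fs))"
        by (rule switch_terminate) (use T True in auto)
      note rtranclp_trans[OF sw(1) this]
      also have "lsteps (a, ?V, pop ?T R (Gs @ Fs)) (a, ?V, Fs)"
        by (rule unwind_steps) (use sw L(6) in auto)
      finally have "lsteps (a, V2, Us2 @ Fs) (a, ?V, Fs)" .
      moreover have "shared ?V = h b" using T(3) last[OF True] Cons.prems(4) by simp
      ultimately show ?thesis using T(2) by (intro exI[of _ ?V]) simp
    next
      case False
      with 2(2) have af: "after_round n False b f g h y V2 Us2" by simp
      obtain cs R Gs L' fs where call:
        "lsteps (a, V2, Us2 @ Fs) (a, V2, (linear_int M, L', keep) # (resume # loop # cs, calling V2 ?T, R) # Gs @ Fs)"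
        "unwinding Gs" "Gs = [] \<Longrightarrow> R = keep"
        "\<forall>r \<in> {1..Suc n}. qi L' r = g r" "\<forall>r \<in> {1..<b}. qo L' r = h r" "bound L' = Suc n"
        by (rule call_rest[OF af, of a Fs], rule that)
      have "returns g h b" using rest False Cons.prems(4) by simp
      then obtain V3 where V3: "lsteps (a, V2, (linear_int M, L', keep) # (resume # loop # cs, calling V2 ?T, R) # Gs @ Fs)
          (a, V3, (resume # loop # cs, calling V2 ?T, R) # Gs @ Fs)" "shared V3 = h b" "terminate V3" "\<not> atom V3"
        using call(4-6) T(1,2) unfolding returns_def b by blast
      have "lsteps (a, V3, (resume # loop # cs, calling V2 ?T, R) # Gs @ Fs) (a, V3, pop (calling V2 ?T) R (Gs @ Fs))"
        by (rule resume_return) (use T in auto)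
      note rtranclp_trans[OF call(1) rtranclp_trans[OF V3(1) this]]
      \<comment> \<open>\<open>terminate\<close> is still set by the nested call, so the frames of
        the calling thread unwind as well.\<close>
      also have "lsteps (a, V3, pop (calling V2 ?T) R (Gs @ Fs)) (a, V3, Fs)"
        by (rule unwind_steps) (use V3 call L(6) in auto)
      finally have "lsteps (a, V2, Us2 @ Fs) (a, V3, Fs)" .
      then show ?thesis using V3 by blast
    qed
    then obtain V' where V': "lsteps (a, V2, Us2 @ Fs) (a, V', Fs)" "shared V' = h b \<and> terminate V' \<and> \<not> atom V'"
      by blast
    from rtranclp_trans[OF 1(1) rtranclp_trans[OF 2(1) V'(1)]] V'(2)
    show "\<exists>V'. lsteps (a, V, (linear_int M, L, keep) # Fs) (a, V', Fs) \<and> shared V' = h b \<and> terminate V' \<and> \<not> atom V'"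
      by blast
  qed
qed

section \<open>Reaching a violated assertion\<close>

lemma poised_violation:
  assumes "tracks fs g V Us" "\<not> terminate V" "conf_violates (a0, (shared V, g), fs)"
  obtains c where "lsteps (a, V, Us @ Fs) c" "conf_violates c"
proof -
  have "fs \<noteq> []" using assms(3) by auto
  with assms(1) have g: "glob V = g" and "poised fs Us" unfolding tracks_def by auto
  then obtain cs r fs' X L Gs where fs: "fs = (cs, loc L, r) # fs'" "X = inserted \<or> X = [loop]"
     "Us = (X @ rest_code (fs' = []) cs, L, retn (fs' = []) r) # Gs"
    unfolding poised_def by blast
  from assms(3) obtain p e cs' where cs: "cs = Assert p e # cs'" "\<not> e ((shared V, g), loc L)"
    unfolding fs(1) by (cases cs; cases "hd cs") auto
  have "conf_violates (a, V, (rest_code (fs' = []) cs, L, retn (fs' = []) r) # Gs @ Fs)"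
    using cs g by (simp add: rd_def)
  moreover have "lsteps (a, V, Us @ Fs) (a, V, (rest_code (fs' = []) cs, L, retn (fs' = []) r) # Gs @ Fs)"
    unfolding fs(3) using inserted_skip[OF assms(2) fs(2)] by simp
  ultimately show thesis using that by blast
qed

text \<open>\<open>x\<close> fails in round \<open>Suc n\<close>; \<open>A\<close> and
  \<open>B\<close> are the threads before and after it. Induction on \<open>A\<close>: each of its
  threads completes \<open>n\<close> rounds with calls that return, then round \<open>Suc n\<close>,
  after which its call with bound \<open>Suc n\<close> runs into the violation.\<close>

lemma linear_int_violates:
  assumes "linear (mround M) (Suc n) f p A A'" "column (mround M) n p w x y" "linear (mround M) n w h B B'"
    "(step (body M))\<^sup>*\<^sup>* (False, (p (Suc n), fst y), snd y) (a1, (s1, g1), fs1)" "conf_violates (a1, (s1, g1), fs1)"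
    "set (A @ x # B) \<subseteq> thread_initial M"
    "\<forall>r \<in> {1..Suc n}. qi L r = f r" "\<forall>r \<in> {1..<Suc n}. qo L r = h r" "bound L = Suc n" "\<not> terminate V" "\<not> atom V"
  shows "\<exists>c. lsteps (a, V, (linear_int M, L, keep) # Fs) c \<and> conf_violates c"
  using assms(1,6-)
proof (induction A arbitrary: f A' V L Fs)
  case Nil
  then have f: "\<forall>r \<in> {1..Suc n}. f r = p r" by (cases A') auto
  \<comment> \<open>\<open>x\<close> guesses to be last exactly when \<open>B\<close> is empty;
    otherwise it calls the threads of \<open>B\<close> after each of its first \<open>n\<close>
    rounds.\<close>
  have B: "if B = [] then \<forall>r \<in> {1..n}. w r = h r else \<forall>r \<in> {1..n}. returns w h r"
  proof (cases "B = []")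
    case True
    then show ?thesis using assms(3) by (cases B') auto
  next
    case False
    have "returns w h r" if r: "r \<in> {1..n}" for r
    proof -
      obtain zs where "linear (mround M) r w h B zs" using linear_mono[OF assms(3), of r] r by auto
      then show ?thesis using False Nil.prems(2) r by (intro linear_int_returns) auto
    qed
    then show ?thesis using False by simp
  qed
  have "x \<in> thread_initial M" "\<forall>r \<in> {1..Suc n}. qi L r = p r" using Nil.prems f by auto
  from advance[OF this Nil.prems(4-7) assms(2) _ B, of a Fs] obtain V1 Us1 where
    1: "lsteps (a, V, (linear_int M, L, keep) # Fs) (a, V1, Us1 @ Fs)" "at_round n (B = []) (Suc n) p w h y V1 Us1" by blast
  have "(step (body M))\<^sup>*\<^sup>* (atom V1, (shared V1, fst y), snd y) (a1, (s1, g1), fs1)"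
    using assms(4) 1(2) unfolding at_round_def by simp
  from tracks_steps[OF this refl, of Us1 a Fs] 1(2) obtain V2 Us2 where
    2: "lsteps (a, V1, Us1 @ Fs) (a, V2, Us2 @ Fs)" "tracks fs1 g1 V2 Us2" "shared V2 = s1" "\<not> terminate V2"
    unfolding at_round_def by blast
  from assms(5) have "conf_violates (a1, (shared V2, g1), fs1)" using 2(3) by simp
  then obtain c where "lsteps (a, V2, Us2 @ Fs) c" "conf_violates c"
    by (rule poised_violation[OF 2(2,4)])
  with rtranclp_trans[OF 1(1) rtranclp_trans[OF 2(1)]] show ?case by blast
next
  case (Cons z A)
  obtain z' A1' where "A' = z' # A1'" using Cons.prems(1) by (cases A') auto
  with Cons.prems(1) obtain g where g: "column (mround M) (Suc n) f g z z'" "linear (mround M) (Suc n) g p A A1'" by auto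
  from g(1) obtain z1 where z1: "column (mround M) n f g z z1" "mround M (f (Suc n)) z1 (g (Suc n)) z'" by auto
  obtain A2 where "linear (mround M) n g p A A2" using linear_mono[OF g(2), of n] by auto
  \<comment> \<open>All threads after \<open>z\<close>, the failing one included, have an interface
    for the first \<open>n\<close> rounds; this makes the calls after these rounds return.\<close>
  then have lin: "linear (mround M) n g h (A @ [x] @ B) (A2 @ [y] @ B')"
    using assms(2,3) by (intro linear_append) (auto simp: linear_single simp del: linear.simps)
  have "returns g h r" if r: "r \<in> {1..n}" for r
  proof -
    obtain zs where "linear (mround M) r g h (A @ [x] @ B) zs" using linear_mono[OF lin, of r] r by auto
    then show ?thesis using Cons.prems(2) r by (intro linear_int_returns) auto
  qed
  then have ret: "if False then \<forall>r \<in> {1..n}. g r = h r else \<forall>r \<in> {1..n}. returns g h r" by simp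
  have "z \<in> thread_initial M" using Cons.prems(2) by simp
  from advance[OF this Cons.prems(3-7) z1(1) _ ret, of a Fs] obtain V1 Us1 where
    1: "lsteps (a, V, (linear_int M, L, keep) # Fs) (a, V1, Us1 @ Fs)" "at_round n False (Suc n) f g h z1 V1 Us1" by blast
  obtain V2 Us2 where 2: "lsteps (a, V1, Us1 @ Fs) (a, V2, Us2 @ Fs)" "after_round n False (Suc n) f g h z' V2 Us2"
    by (rule at_round_run[OF 1(2) z1(2)])
  obtain cs R Gs L' fs where call:
    "lsteps (a, V2, Us2 @ Fs) (a, V2, (linear_int M, L', keep) # (resume # loop # cs, calling V2 (top_locals Us2), R) # Gs @ Fs)"
    "\<forall>r \<in> {1..Suc n}. qi L' r = g r" "\<forall>r \<in> {1..<Suc n}. qo L' r = h r" "bound L' = Suc n"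
    by (rule call_rest[OF 2(2), of a Fs], rule that)
  have V2: "\<not> terminate V2" "\<not> atom V2" using 2(2) unfolding after_round_def by auto
  have "set (A @ x # B) \<subseteq> thread_initial M" using Cons.prems(2) by simp
  from Cons.IH[OF g(2) this call(2-4) V2] obtain c where
    "lsteps (a, V2, (linear_int M, L', keep) # (resume # loop # cs, calling V2 (top_locals Us2), R) # Gs @ Fs) c" "conf_violates c"
    by blast
  with rtranclp_trans[OF 1(1) rtranclp_trans[OF 2(1) rtranclp_trans[OF call(1)]]] show ?case by blast
qed

section \<open>Forward simulation of the initialization and of the main loop\<close>

lemma init_step_forward:
  assumes "step (sbody I) (a', shared V, fs) (a1, s1, fs1)" "init_frames fs Fs"
  shows "\<exists>a2 Fs1. step lbody (a, V, Fs @ [F0]) (a2, V\<lparr>shared := s1\<rparr>, Fs1 @ [F0]) \<and> init_frames fs1 Fs1"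
proof -
  have "fs \<noteq> []" using assms(1) by (auto simp: step_simps)
  then obtain cs l r fs' where fs: "fs = (cs, l, r) # fs'" by (cases fs) auto
  obtain L Gs where Fs: "Fs = (map init_com cs, L, retn (fs' = []) r) # Gs" "loc L = l" "init_frames fs' Gs"
    using assms(2) by (auto simp: fs)
  note st = assms(1)[unfolded fs]
  let ?R = "retn (fs' = []) r"
  have frame: ?thesis
    if "step lbody (a, V, (map init_com cs, L, ?R) # Gs @ [F0]) (a2, V\<lparr>shared := s1\<rparr>, (map init_com cs1, L1, ?R) # Gs @ [F0])"
      "fs1 = (cs1, loc L1, r) # fs'" for a2 cs1 L1
    using that Fs(3) by (intro exI[of _ a2] exI[of _ "(map init_com cs1, L1, ?R) # Gs"]) (simp add: Fs(1))
  have pop: ?thesis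
    if "step lbody (a, V, (map init_com cs, L, ?R) # Gs @ [F0]) (a, V, pop L ?R (Gs @ [F0]))"
      "fs1 = pop l r fs'" "s1 = shared V"
  proof (cases fs')
    case Nil
    obtain c0 L0 R0 where "F0 = (c0, L0, R0)" by (cases F0)
    with Nil Fs have "pop L ?R (Gs @ [F0]) = [] @ [F0]" by (simp add: retn_def keep_def)
    with that Nil show ?thesis by (intro exI[of _ a] exI[of _ "[]"]) (simp add: Fs(1))
  next
    case (Cons F1 fs2)
    obtain cs2 l2 r2 where F1: "F1 = (cs2, l2, r2)" by (cases F1)
    obtain L2 Gs2 where Gs: "Gs = (map init_com cs2, L2, retn (fs2 = []) r2) # Gs2" "loc L2 = l2" "init_frames fs2 Gs2"
      using Fs(3) by (auto simp: Cons F1)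
    let ?Us = "(map init_com cs2, L\<lparr>loc := r (loc L) (loc L2)\<rparr>, retn (fs2 = []) r2) # Gs2"
    have "pop L ?R (Gs @ [F0]) = ?Us @ [F0]" by (simp add: Gs(1) Cons retn_def)
    with that Gs Fs(2) show ?thesis by (intro exI[of _ a] exI[of _ ?Us]) (simp add: Fs(1) Cons F1)
  qed
  show ?thesis
  proof (cases cs)
    case Nil
    with st show ?thesis by (intro pop) (auto simp: step_simps)
  next
    case (Cons c cs')
    show ?thesis
    proof (cases c)
      case (Update p u)
      from st obtain l1 where 1: "(s1, l1) \<in> u (shared V, loc L)" "fs1 = (cs', l1, r) # fs'"
        unfolding Cons Update step_simps Fs(2) by blast
      then have "(V\<lparr>shared := s1\<rparr>, L\<lparr>loc := l1\<rparr>) \<in> wr_init (V, L) ` u (rd_init (V, L))"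
        by (force simp: wr_init_def rd_init_def)
      then show ?thesis using 1
        by (intro frame[of a cs' "L\<lparr>loc := l1\<rparr>"]) (auto simp: Cons Update step_simps)
    next
      case (Assume p e)
      with st show ?thesis
        by (intro frame[of a cs' L]) (auto simp: Cons step_simps rd_init_def Fs(2))
    next
      case (Assert p e)
      with st show ?thesis
        by (intro frame[of a cs' L]) (auto simp: Cons step_simps rd_init_def Fs(2))
    next
      case (Ite p e xs ys)
      from st consider "may_eval e (shared V, loc L) True" "s1 = shared V" "fs1 = (xs @ cs', loc L, r) # fs'"
        | "may_eval e (shared V, loc L) False" "s1 = shared V" "fs1 = (ys @ cs', loc L, r) # fs'"
        unfolding Cons Ite step_simps Fs(2) by auto
      then show ?thesis
      proof cases
        case 1
        then show ?thesis
          by (intro frame[of a "xs @ cs'" L]) (simp_all add: Cons Ite step_simps rd_init_def)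
      next
        case 2
        then show ?thesis
          by (intro frame[of a "ys @ cs'" L]) (simp_all add: Cons Ite step_simps rd_init_def)
      qed
    next
      case (While p e xs)
      from st consider "may_eval e (shared V, loc L) True" "s1 = shared V" "fs1 = (xs @ While p e xs # cs', loc L, r) # fs'"
        | "may_eval e (shared V, loc L) False" "s1 = shared V" "fs1 = (cs', loc L, r) # fs'"
        unfolding Cons While step_simps Fs(2) by auto
      then show ?thesis
      proof cases
        case 1
        then show ?thesis
          by (intro frame[of a "xs @ While p e xs # cs'" L]) (simp_all add: Cons While step_simps rd_init_def)
      next
        case 2
        then show ?thesis
          by (intro frame[of a cs' L]) (simp_all add: Cons While step_simps rd_init_def)
      qed
    next
      case (BeginAtomic p)
      with st show ?thesis
        by (intro frame[of True cs' L]) (auto simp: Cons step_simps Fs(2))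
    next
      case (EndAtomic p)
      with st show ?thesis
        by (intro frame[of False cs' L]) (auto simp: Cons step_simps Fs(2))
    next
      case (Call p m args res)
      from st obtain l1 where l1: "l1 \<in> args (shared V, loc L)"
        and c': "s1 = shared V" "fs1 = (sbody I m, l1, res) # (cs', loc L, r) # fs'"
        unfolding Cons Call step_simps Fs(2) by auto
      let ?Us = "(map init_com (sbody I m), L\<lparr>loc := l1\<rparr>, retn False res) #
          (map init_com cs', L, ?R) # Gs"
      have "step lbody (a, V, Fs @ [F0]) (a, V\<lparr>shared := s1\<rparr>, ?Us @ [F0])"
        using l1 c'(1) by (auto simp: Fs(1) Cons Call step_simps lift_call_def rd_init_def retn_def)
      moreover have "init_frames fs1 ?Us" using c'(2) Fs(3) by simp
      ultimately show ?thesis by blast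
    next
      case (Return p)
      with st show ?thesis by (intro pop) (auto simp: Cons step_simps)
    qed
  qed
qed

lemma init_steps_forward:
  assumes "(step (sbody I))\<^sup>*\<^sup>* (a', shared V, fs) c" "c = (a1, s1, fs1)" "init_frames fs Fs" "\<not> atom V"
  shows "\<exists>a2 V1 Fs1. lsteps (a, V, Fs @ [F0]) (a2, V1, Fs1 @ [F0]) \<and> init_frames fs1 Fs1 \<and> shared V1 = s1 \<and> \<not> atom V1"
  using assms(1,2)
proof (induction arbitrary: a1 s1 fs1 rule: rtranclp_induct)
  case base
  then show ?case using assms(3,4) by (intro exI[of _ a] exI[of _ V] exI[of _ Fs]) simp
next
  case (step c1 c2)
  obtain a2 s2 fs2 where c1: "c1 = (a2, s2, fs2)" by (cases c1)
  from step.IH[OF c1] obtain b V2 Fs2 where 2: "lsteps (a, V, Fs @ [F0]) (b, V2, Fs2 @ [F0])"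
    "init_frames fs2 Fs2" "shared V2 = s2" "\<not> atom V2" by blast
  have "step (sbody I) (a2, shared V2, fs2) (a1, s1, fs1)"
    using step.hyps(2) unfolding c1 step.prems 2(3) .
  from init_step_forward[OF this 2(2)] obtain b1 Fs1 where
    1: "step lbody (b, V2, Fs2 @ [F0]) (b1, V2\<lparr>shared := s1\<rparr>, Fs1 @ [F0])" "init_frames fs1 Fs1" by blast
  from rtranclp.rtrancl_into_rtrancl[OF 2(1) 1(1)] 1(2) 2(4) show ?case
    by (intro exI[of _ b1] exI[of _ "V2\<lparr>shared := s1\<rparr>"] exI[of _ Fs1]) simp
qed

definition lazy_reachable where
  "lazy_reachable c \<longleftrightarrow> (\<exists>V L. lsteps (False, V, [(lazy_main k I, L, keep)]) c)"

lemma lazy_reachable_steps: "lazy_reachable c \<Longrightarrow> lsteps c c' \<Longrightarrow> lazy_reachable c'"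
  unfolding lazy_reachable_def by (blast intro: rtranclp_trans)

lemma init_reached:
  assumes "seq_reachable I (a1, s1, fs1)"
  obtains a V Fs L where "lazy_reachable (a, V, Fs @ [(drop 3 (lazy_main k I), L, keep)])"
    "init_frames fs1 Fs" "shared V = s1" "\<not> atom V" "cnt L = 1"
proof -
  obtain v l where vl: "(v, l) \<in> sinits I" "(step (sbody I))\<^sup>*\<^sup>* (False, v, [(sbody I (smain I), l, keep)]) (a1, s1, fs1)"
    using assms unfolding seq_reachable_def seq_initial_def by auto
  \<comment> \<open>The lazy program starts with arbitrary values, so the shared part is taken from
    the given run of the initialization block.\<close>
  let ?V = "\<lparr>shared = v, glob = undefined, atom = False, terminate = False\<rparr> :: ('s, 'g) lglobals"
  let ?L = "undefined :: ('s, 'g, 'l) llocals"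
  let ?L1 = "?L\<lparr>cnt := 1\<rparr>" and ?L' = "?L\<lparr>loc := l\<rparr>"
  let ?F0 = "(drop 3 (lazy_main k I), ?L1, keep)"
  have "step lbody (False, ?V, [(lazy_main k I, ?L, keep)]) (False, ?V, [(drop 1 (lazy_main k I), ?L1, keep)])"
    by (simp add: lazy_main_eq step_simps)
  moreover have "step lbody (False, ?V, [(drop 1 (lazy_main k I), ?L1, keep)]) (False, ?V, [(drop 2 (lazy_main k I), ?L1, keep)])"
    by (simp add: lazy_main_eq step_simps)
  moreover have "step lbody (False, ?V, [(drop 2 (lazy_main k I), ?L1, keep)])
     (False, ?V, [(map init_com (sbody I (smain I)), ?L', keep)] @ [?F0])"
    using vl(1) by (simp add: lazy_main_eq step_simps)
  ultimately have "lsteps (False, ?V, [(lazy_main k I, ?L, keep)]) (False, ?V, [(map init_com (sbody I (smain I)), ?L', keep)] @ [?F0])"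
    by (blast intro: lsteps_step)
  then have 1: "lazy_reachable (False, ?V, [(map init_com (sbody I (smain I)), ?L', keep)] @ [?F0])"
    unfolding lazy_reachable_def by blast
  have "(step (sbody I))\<^sup>*\<^sup>* (False, shared ?V, [(sbody I (smain I), l, keep)]) (a1, s1, fs1)"
    using vl(2) by simp
  from init_steps_forward[OF this refl, of "[(map init_com (sbody I (smain I)), ?L', keep)]" False ?F0]
  obtain a2 V1 Fs1 where 2: "lsteps (False, ?V, [(map init_com (sbody I (smain I)), ?L', keep)] @ [?F0]) (a2, V1, Fs1 @ [?F0])"
    "init_frames fs1 Fs1" "shared V1 = s1" "\<not> atom V1"
    by (auto simp: retn_def)
  show thesis by (rule that[OF lazy_reachable_steps[OF 1 2(1)] 2(2-4)]) simp
qed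

lemma init_violation:
  assumes "seq_reachable I c" "conf_violates c"
  obtains c' where "lazy_reachable c'" "conf_violates c'"
proof -
  obtain a1 s1 fs1 where c: "c = (a1, s1, fs1)" by (cases c)
  obtain a V Fs L where 1: "lazy_reachable (a, V, Fs @ [(drop 3 (lazy_main k I), L, keep)])"
    "init_frames fs1 Fs" "shared V = s1"
    using init_reached[OF assms(1)[unfolded c]] by metis
  obtain p e cs l r fs where fs1: "fs1 = (Assert p e # cs, l, r) # fs" "\<not> e (s1, l)"
    using assms(2) unfolding c by (cases "(a1, s1, fs1)" rule: conf_violates.cases) auto
  have "conf_violates (a, V, Fs @ [(drop 3 (lazy_main k I), L, keep)])"
    using 1(2,3) fs1 by (auto simp: rd_init_def)
  with 1(1) that show thesis by blast
qed

lemma returnsD: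
  assumes "returns g h b" "\<forall>r \<in> {1..b}. qi L r = g r" "\<forall>r \<in> {1..<b}. qo L r = h r" "bound L = b"
    "\<not> terminate V" "\<not> atom V" "Fs \<noteq> []"
  obtains V' where "lsteps (a, V, (linear_int M, L, keep) # Fs) (a, V', Fs)" "shared V' = h b" "terminate V'" "\<not> atom V'"
  using assms unfolding returns_def by blast

lemma main_iteration:
  assumes "cnt L \<le> k"
  shows "lsteps (a, V, [([main_loop k], L, keep)])
    (a, V\<lparr>terminate := False\<rparr>, (linear_int M, L\<lparr>qo := (\<lambda>r. qi L (r + 1)), bound := cnt L\<rparr>, keep) #
      [(drop 2 (main_body k) @ [main_loop k], L, keep)])"
proof -
  let ?V = "V\<lparr>terminate := False\<rparr>" and ?L' = "L\<lparr>qo := (\<lambda>r. qi L (r + 1)), bound := cnt L\<rparr>"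
  let ?m = "\<lambda>i. drop i (main_body k) @ [main_loop k]"
  have "step lbody (a, V, [([main_loop k], L, keep)]) (a, V, [(?m 0, L, keep)])"
    using assms by (simp add: step_simps)
  moreover have "step lbody (a, V, [(?m 0, L, keep)]) (a, ?V, [(?m 1, L, keep)])"
    by (simp add: step_simps)
  moreover have "step lbody (a, ?V, [(?m 1, L, keep)]) (a, ?V, (linear_int M, ?L', keep) # [(?m 2, L, keep)])"
    by (simp add: step_simps)
  ultimately show ?thesis
    by (blast intro: lsteps_step)
qed

text \<open>The passage with counter \<open>r\<close> replays rounds 1 to \<open>r\<close> and
  returns the shared state in which round \<open>r + 1\<close> begins, which is stored in
  \<open>qi\<close>. At least one thread is required because \<open>linear_int\<close> always starts
  one.\<close>

lemma main_rounds:
  assumes "init_final I (q 1)" "set xs \<subseteq> thread_initial M" "xs \<noteq> []"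
    "linear (mround M) n q (\<lambda>r. q (Suc r)) xs ys" "Suc n \<le> k"
  shows "\<exists>a V L. lazy_reachable (a, V, [([main_loop k], L, keep)]) \<and> cnt L = Suc n \<and> \<not> atom V \<and>
    (\<forall>r \<in> {1..Suc n}. qi L r = q r)"
  using assms(4,5)
proof (induction n arbitrary: ys)
  case 0
  obtain a1 where "seq_reachable I (a1, q 1, [])" using assms(1) unfolding init_final_def by blast
  then obtain a V Fs L where 1: "lazy_reachable (a, V, Fs @ [(drop 3 (lazy_main k I), L, keep)])"
    "Fs = []" "shared V = q 1" "\<not> atom V" "cnt L = 1"
    by (rule init_reached) simp
  let ?L = "L\<lparr>qi := (qi L)(1 := shared V)\<rparr>"
  have "step lbody (a, V, Fs @ [(drop 3 (lazy_main k I), L, keep)]) (a, V, [([main_loop k], ?L, keep)])"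
    using 1(2) by (simp add: lazy_main_eq step_simps)
  then have "lazy_reachable (a, V, [([main_loop k], ?L, keep)])"
    using lazy_reachable_steps[OF 1(1)] by blast
  moreover have "cnt ?L = Suc 0 \<and> \<not> atom V \<and> (\<forall>r \<in> {1..Suc 0}. qi ?L r = q r)" using 1 by simp
  ultimately show ?case by blast
next
  case (Suc n)
  obtain zs where zs: "linear (mround M) n q (\<lambda>r. q (Suc r)) xs zs" using linear_mono[OF Suc.prems(1), of n] by auto
  have "Suc n \<le> k" using Suc.prems(2) by simp
  from Suc.IH[OF zs this] obtain a V L where
    1: "lazy_reachable (a, V, [([main_loop k], L, keep)])" "cnt L = Suc n" "\<not> atom V" "\<forall>r \<in> {1..Suc n}. qi L r = q r"
    by blast
  let ?V = "V\<lparr>terminate := False\<rparr>" and ?L' = "L\<lparr>qo := (\<lambda>r. qi L (r + 1)), bound := cnt L\<rparr>"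
  let ?m = "\<lambda>i. drop i (main_body k) @ [main_loop k]"
  have ret: "returns q (\<lambda>r. q (Suc r)) (Suc n)"
    by (rule linear_int_returns[OF Suc.prems(1) assms(3,2)]) simp
  obtain V1 where V1: "lsteps (a, ?V, (linear_int M, ?L', keep) # [(?m 2, L, keep)]) (a, V1, [(?m 2, L, keep)])"
    "shared V1 = q (Suc (Suc n))" "\<not> atom V1"
    by (rule returnsD[OF ret, of ?L' ?V "[(?m 2, L, keep)]" a]) (use 1(2-4) in auto)
  let ?L1 = "L\<lparr>cnt := cnt L + 1\<rparr>" and ?L2 = "L\<lparr>cnt := cnt L + 1, qi := (qi L)(cnt L + 1 := shared V1)\<rparr>"
  have "lsteps (a, V, [([main_loop k], L, keep)]) (a, ?V, (linear_int M, ?L', keep) # [(?m 2, L, keep)])"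
    by (rule main_iteration) (use 1(2) Suc.prems(2) in simp)
  note steps = rtranclp_trans[OF this V1(1)]
  have s1: "step lbody (a, V1, [(?m 2, L, keep)]) (a, V1, [(?m 3, ?L1, keep)])"
    by (simp add: step_simps)
  have s2: "step lbody (a, V1, [(?m 3, ?L1, keep)]) (a, V1, [([setl (\<lambda>(V, L). L\<lparr>qi := (qi L)(cnt L := shared V)\<rparr>), main_loop k], ?L1, keep)])"
    using 1(2) Suc.prems(2) by (simp add: step_simps)
  have s3: "step lbody (a, V1, [([setl (\<lambda>(V, L). L\<lparr>qi := (qi L)(cnt L := shared V)\<rparr>), main_loop k], ?L1, keep)]) (a, V1, [([main_loop k], ?L2, keep)])"
    by (simp add: step_simps)
  from steps s1 s2 s3 have "lsteps (a, V, [([main_loop k], L, keep)]) (a, V1, [([main_loop k], ?L2, keep)])"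
    by (rule rtranclp.rtrancl_into_rtrancl[OF rtranclp.rtrancl_into_rtrancl[OF rtranclp.rtrancl_into_rtrancl]])
  with lazy_reachable_steps[OF 1(1)] have "lazy_reachable (a, V1, [([main_loop k], ?L2, keep)])" by blast
  moreover have "cnt ?L2 = Suc (Suc n) \<and> \<not> atom V1 \<and> (\<forall>r \<in> {1..Suc (Suc n)}. qi ?L2 r = q r)"
    using 1 V1 by (simp add: atLeastAtMostSuc_conv)
  ultimately show ?case by blast
qed

text \<open>All threads, the failing one included, complete \<open>n\<close> rounds, which brings
  the main loop to the counter \<open>Suc n\<close>; the violation occurs in that passage.\<close>

lemma lazy_complete:
  assumes "Suc n \<le> k" "init_final I (q 1)"
    "linear (mround M) (Suc n) q p A A'" "column (mround M) n p w x y" "linear (mround M) n w (\<lambda>r. q (Suc r)) B B'"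
    "(step (body M))\<^sup>*\<^sup>* (False, (p (Suc n), fst y), snd y) (a1, (s1, g1), fs1)" "conf_violates (a1, (s1, g1), fs1)"
    "set (A @ x # B) \<subseteq> thread_initial M"
  obtains c where "lazy_reachable c" "conf_violates c"
proof -
  obtain A2 where "linear (mround M) n q p A A2" using linear_mono[OF assms(3), of n] by auto
  then have lin: "linear (mround M) n q (\<lambda>r. q (Suc r)) (A @ [x] @ B) (A2 @ [y] @ B')"
    using assms(4,5) by (intro linear_append) (auto simp: linear_single simp del: linear.simps)
  have "set (A @ [x] @ B) \<subseteq> thread_initial M" using assms(8) by simp
  from main_rounds[OF assms(2) this _ lin assms(1)] obtain a V L where
    1: "lazy_reachable (a, V, [([main_loop k], L, keep)])" "cnt L = Suc n" "\<not> atom V" "\<forall>r \<in> {1..Suc n}. qi L r = q r"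
    by blast
  let ?V = "V\<lparr>terminate := False\<rparr>" and ?L' = "L\<lparr>qo := (\<lambda>r. qi L (r + 1)), bound := cnt L\<rparr>"
  let ?m = "\<lambda>i. drop i (main_body k) @ [main_loop k]"
  have 2: "lsteps (a, V, [([main_loop k], L, keep)]) (a, ?V, (linear_int M, ?L', keep) # [(?m 2, L, keep)])"
    by (rule main_iteration) (use 1(2) assms(1) in simp)
  have L': "\<forall>r \<in> {1..Suc n}. qi ?L' r = q r" "\<forall>r \<in> {1..<Suc n}. qo ?L' r = q (Suc r)" "bound ?L' = Suc n"
    "\<not> terminate ?V" "\<not> atom ?V" using 1(2-4) by auto
  from linear_int_violates[OF assms(3-8) L'] obtain c where
    "lsteps (a, ?V, (linear_int M, ?L', keep) # [(?m 2, L, keep)]) c" "conf_violates c" by blast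
  with that lazy_reachable_steps[OF 1(1) rtranclp_trans[OF 2]] show thesis by blast
qed

end

section \<open>Lazy programs and parameterized programs\<close>

lemma lazy_program_eq:
  "sbody (lazy_program k \<P>) = lazy.lbody (merge (procs \<P>)) (init \<P>) k"
  by (simp add: lazy_program_def lazy.lbody_def fun_eq_iff)

lemma seq_reachable_lazy:
  "seq_reachable (lazy_program k \<P>) c \<longleftrightarrow> lazy.lazy_reachable (merge (procs \<P>)) (init \<P>) k c"
  unfolding seq_reachable_def seq_initial_def lazy.lazy_reachable_def lazy_program_eq
  by (auto simp: lazy_program_def lazy.lbody_simps)

text \<open>The next statement of an undecided thread is one of those added by \<open>merge\<close>;
  hence a visible configuration belongs to a thread that has chosen its process.\<close>

lemma unpicked_invisible:
  assumes "unpicked Ps fs"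
  shows "\<not> conf_violates (a, v, fs)" "fs = (c # cs, l, r) # fs' \<Longrightarrow> label c = None"
proof -
  from assms consider l where "fs = [(picks Ps (length Ps), l, keep)]"
    | l i where "i < length Ps" "fs = [(picks Ps i, l, keep)]"
    | l n where "n < length Ps" "fs = [(pick Ps n, l, keep)]"
    unfolding unpicked_def le_less by blast
  note cases = this
  show "\<not> conf_violates (a, v, fs)"
    by (cases rule: cases) (simp_all add: picks_simps)
  show "label c = None" if "fs = (c # cs, l, r) # fs'"
    by (cases rule: cases) (use that in \<open>auto simp: picks_simps\<close>)
qed

text \<open>Undecided threads before or after the active one are dropped, whereas the active one has
  decided by assumption, possibly only in its interrupted round.\<close>

lemma witness_execution:
  assumes "lazy.witness (merge (procs \<P>)) (init \<P>) k a s g fs" "\<not> unpicked (procs \<P>) fs"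
  obtains w pm i ts fs' where "execution \<P> w (Running pm i a s ts)" "k_round_schedule k (length pm) w"
    "ts ! i = (g, fs')" "fs = map (mframe (pm ! i)) fs'"
proof -
  let ?M = "merge (procs \<P>)"
  obtain j q p w xs ys x y zs zs' where *: "Suc j \<le> k" "init_final (init \<P>) (q 1)"
     "set xs \<subseteq> thread_initial ?M" "x \<in> thread_initial ?M" "set zs \<subseteq> thread_initial ?M"
     "linear (mround ?M) (Suc j) q p xs ys" "column (mround ?M) j p w x y"
     "linear (mround ?M) j w (\<lambda>r. q (Suc r)) zs zs'"
     "(step (body ?M))\<^sup>*\<^sup>* (False, (p (Suc j), fst y), snd y) (a, (s, g), fs)"
    using assms(1) unfolding lazy.witness_def by blast
  obtain ps ps' where ps: "set ps \<subseteq> pinitial \<P>" "linear (pround \<P>) (Suc j) q p ps ps'"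
    by (rule linear_unmerge[OF *(3,6)])
  obtain rs rs' where rs: "set rs \<subseteq> pinitial \<P>" "linear (pround \<P>) j w (\<lambda>r. q (Suc r)) rs rs'"
    by (rule linear_unmerge[OF *(5,8)])
  have "\<exists>n x0 g0 fs0 fs'. x0 \<in> pinitial \<P> \<and> column (pround \<P>) j p w x0 (n, g0, fs0) \<and>
    (step (body (procs \<P> ! n)))\<^sup>*\<^sup>* (False, (p (Suc j), g0), fs0) (a, (s, g), fs') \<and> fs = map (mframe n) fs'"
    using column_unmerge[OF *(4,7)]
  proof (elim disjE conjE bexE exE)
    assume 1: "unpicked (procs \<P>) (snd y)" "\<forall>r \<in> {1..j}. p r = w r"
    from unpicked_steps[OF *(9) 1(1) refl] assms(2) obtain n g0 fs0 fs' where
      2: "n < length (procs \<P>)" "(g0, fs0) \<in> thread_initial (procs \<P> ! n)"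
       "(step (body (procs \<P> ! n)))\<^sup>*\<^sup>* (False, (p (Suc j), g0), fs0) (a, (s, g), fs')" "fs = map (mframe n) fs'"
      by blast
    \<comment> \<open>The process was chosen in the interrupted round; the real thread idles in the
      rounds before.\<close>
    have "column (pround \<P>) j p w (n, g0, fs0) (n, g0, fs0)" using column_idle 1(2) by blast
    moreover have "(n, g0, fs0) \<in> pinitial \<P>" using 2 by (simp add: pinitial_def)
    ultimately show ?thesis using 2 by blast
  next
    fix x0 z
    assume 1: "x0 \<in> pinitial \<P>" "column (pround \<P>) j p w x0 z" "y = mthread z"
    obtain n g0 fs0 where z: "z = (n, g0, fs0)" by (cases z)
    have "(step (body ?M))\<^sup>*\<^sup>* (False, (p (Suc j), g0), map (mframe n) fs0) (a, (s, g), fs)"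
      using *(9) unfolding 1(3) z by simp
    then obtain fs' where "fs = map (mframe n) fs'"
      "(step (body (procs \<P> ! n)))\<^sup>*\<^sup>* (False, (p (Suc j), g0), fs0) (a, (s, g), fs')"
      unfolding steps_mframe by blast
    then show ?thesis using 1(1,2) unfolding z by blast
  qed
  then obtain n x0 g0 fs0 fs' where x0: "x0 \<in> pinitial \<P>" "column (pround \<P>) j p w x0 (n, g0, fs0)"
    "(step (body (procs \<P> ! n)))\<^sup>*\<^sup>* (False, (p (Suc j), g0), fs0) (a, (s, g), fs')" "fs = map (mframe n) fs'"
    by blast
  obtain v pm i ts where "execution \<P> v (Running pm i a s ts)" "k_round_schedule k (length pm) v"
    "pm ! i = n" "ts ! i = (g, fs')"
    by (rule execution_of_linear[OF *(2) ps(1) x0(1) rs(1) ps(2) x0(2) rs(2) x0(3) *(1)])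
  then show thesis using that x0(4) by blast
qed

lemma conf_violates_mframe:
  "conf_violates (a, v, map (mframe n) fs) \<longleftrightarrow> conf_violates (a, v, fs)"
proof (cases fs)
  case (Cons F fs')
  obtain cs l r where F: "F = (cs, l, r)" by (cases F)
  show ?thesis
  proof (cases cs)
    case Nil
    then show ?thesis by (simp add: Cons F)
  next
    case (Cons c cs')
    then show ?thesis by (cases c) (simp_all add: \<open>fs = F # fs'\<close> F)
  qed
qed simp

lemma lazy_violation_sound:
  assumes "seq_violation (lazy_program k \<P>)"
  shows "k_round_violation k \<P>"
proof -
  obtain c where c: "lazy.lazy_reachable (merge (procs \<P>)) (init \<P>) k c" "conf_violates c"
    using assms unfolding seq_violation_def seq_reachable_lazy by blast
  from c(1) obtain V L where "(step (lazy.lbody (merge (procs \<P>)) (init \<P>) k))\<^sup>*\<^sup>*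
      (False, V, [(lazy_main k (init \<P>), L, keep)]) c"
    unfolding lazy.lazy_reachable_def by blast
  from lazy.lazy_violation[OF this c(2)] show ?thesis
  proof (elim disjE exE conjE)
    assume "seq_violation (init \<P>)"
    then obtain c' where "execution \<P> [] (Initializing c')" "conf_violates c'"
      unfolding seq_violation_def by (auto simp: execution_Initializing)
    \<comment> \<open>A violation during initialization precedes all activations and fits the empty
      schedule over no threads.\<close>
    moreover have "k_round_schedule k 0 []" by (auto simp: k_round_schedule_def)
    ultimately show ?thesis
      unfolding k_round_violation_def by (metis num_threads.simps(1) violates.simps(1))
  next
    fix a s g fs
    assume wit: "lazy.witness (merge (procs \<P>)) (init \<P>) k a s g fs" and v: "conf_violates (a, (s, g), fs)"
    then have "\<not> unpicked (procs \<P>) fs" using unpicked_invisible(1) by blast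
    then obtain w pm i ts fs' where 1: "execution \<P> w (Running pm i a s ts)" "k_round_schedule k (length pm) w"
      "ts ! i = (g, fs')" "fs = map (mframe (pm ! i)) fs'"
      by (rule witness_execution[OF wit])
    have "violates (Running pm i a s ts)" using v 1(3,4) by (simp add: conf_violates_mframe)
    then show ?thesis
      using 1(1,2) unfolding k_round_violation_def by (metis num_threads.simps(2))
  qed
qed

lemma lazy_program_lazy: "is_lazy \<P> (lazy_program k \<P>)"
  unfolding is_lazy_def
proof (intro allI impI, elim conjE)
  fix c x
  assume c: "seq_reachable (lazy_program k \<P>) c" "simulated c = Some x"
  from c(1) obtain V L where steps: "(step (lazy.lbody (merge (procs \<P>)) (init \<P>) k))\<^sup>*\<^sup>*
      (False, V, [(lazy_main k (init \<P>), L, keep)]) c"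
    unfolding seq_reachable_lazy lazy.lazy_reachable_def by blast
  obtain a s g c1 cs l r fs p where wit: "lazy.witness (merge (procs \<P>)) (init \<P>) k a s g ((c1 # cs, l, r) # fs)"
    and p: "label c1 = Some p" "x = (p, g, l, s)"
    by (rule lazy.lazy_simulated[OF steps c(2)])
  have "\<not> unpicked (procs \<P>) ((c1 # cs, l, r) # fs)" using unpicked_invisible(2) p(1) by fastforce
  then obtain w pm i ts fs' where 1: "execution \<P> w (Running pm i a s ts)" "ts ! i = (g, fs')"
    "(c1 # cs, l, r) # fs = map (mframe (pm ! i)) fs'"
    by (rule witness_execution[OF wit])
  from 1(3) obtain F fs1 where F: "fs' = F # fs1" "mframe (pm ! i) F = (c1 # cs, l, r)" by (cases fs') auto
  obtain c0 cs0 where "F = (c0 # cs0, l, r)" "c1 = mcom (pm ! i) c0"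
    using F(2) by (cases F) auto
  with p F(1) 1(2) have "localized (Running pm i a s ts) = Some x"
    by (cases c0) auto
  with 1(1) show "localized_reachable \<P> x" unfolding localized_reachable_def by blast
qed

text \<open>When the assertion fails, the threads before the active one have run one round more than
  those after it. The complete rounds are translated to merged threads and split at the active one;
  the extra row and the partial run are translated separately.\<close>

lemma lazy_violation_complete:
  assumes "k_round_violation k \<P>"
  shows "seq_violation (lazy_program k \<P>)"
proof -
  let ?M = "merge (procs \<P>)"
  obtain v \<sigma> where ex: "execution \<P> v \<sigma>" "k_round_schedule k (num_threads \<sigma>) v" "violates \<sigma>"
    using assms unfolding k_round_violation_def by blast
  have "\<exists>c. lazy.lazy_reachable ?M (init \<P>) k c \<and> conf_violates c"
  proof (cases \<sigma>)
    case (Initializing c)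
    with ex have "seq_reachable (init \<P>) c" "conf_violates c" by (auto simp: execution_Initializing)
    then show ?thesis by (rule lazy.init_violation) blast
  next
    case (Running pm i a s ts)
    obtain ord where "distinct ord" "set ord = {..<length pm}" "prefix v (concat (replicate k ord))"
      using ex(2) unfolding Running k_round_schedule_def by auto
    from execution_in_round[OF ex(1)[unfolded Running] this]
    obtain j q X Y n g0 fs0 Z u Y' g fs where
      *: "Suc j \<le> k" "init_final (init \<P>) (q 1)" "set X \<subseteq> pinitial \<P>"
      "linear (pround \<P>) j q (\<lambda>r. q (Suc r)) X (Y @ (n, g0, fs0) # Z)"
      "row (pround \<P>) (q (Suc j)) u Y Y'"
      "(step (body (procs \<P> ! n)))\<^sup>*\<^sup>* (False, (u, g0), fs0) (a, (s, g), fs)" and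
      i: "i = ord ! length Y" "length Y < length ord" and
      m: "map (\<lambda>t. (pm ! t, ts ! t)) ord = Y' @ (n, g, fs) # Z"
      unfolding in_round_def by blast
    have "map (\<lambda>t. (pm ! t, ts ! t)) ord ! length Y = (pm ! i, ts ! i)" using i by simp
    then have ti: "ts ! i = (g, fs)" unfolding m using row_length[OF *(5)] by (simp add: nth_append)
    have viol: "conf_violates (a, (s, g), map (mframe n) fs)"
      using ex(3) by (simp add: Running ti conf_violates_mframe)
    obtain xs ys where 1: "set xs \<subseteq> thread_initial ?M" "linear (mround ?M) j q (\<lambda>r. q (Suc r)) xs ys"
      "list_all2 (merged \<P>) ys (Y @ (n, g0, fs0) # Z)"
      by (rule linear_merge[OF *(3,4)])
    from 1(3) obtain y1 y z1 where ys: "ys = y1 @ y # z1" "list_all2 (merged \<P>) y1 Y" "merged \<P> y (n, g0, fs0)"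
      by (auto simp: list_all2_append2 list_all2_Cons2)
    define A where "A = take (length y1) xs"
    have len: "length xs = length ys" using linear_length[OF 1(2)] by simp
    obtain x B where xs: "xs = A @ [x] @ B" "length A = length y1"
    proof (rule that[of "xs ! length y1" "drop (Suc (length y1)) xs"])
      show "xs = A @ [xs ! length y1] @ drop (Suc (length y1)) xs"
        unfolding A_def using len by (simp add: ys(1) id_take_nth_drop[symmetric])
    qed (use len in \<open>simp add: A_def ys(1)\<close>)
    have "linear (mround ?M) j q (\<lambda>r. q (Suc r)) (A @ [x] @ B) (y1 @ [y] @ z1)"
      using 1(2) by (simp add: xs(1) ys(1))
    then obtain p w where 2: "linear (mround ?M) j q p A y1"
      "linear (mround ?M) j p w [x] [y]" "linear (mround ?M) j w (\<lambda>r. q (Suc r)) B z1"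
      using xs(2) by (metis linear_appendE length_Cons list.size(3))
    obtain y1' where y1': "row (mround ?M) (q (Suc j)) u y1 y1'"
      by (rule row_merge[OF *(5) ys(2)])
    \<comment> \<open>\<open>p\<close> matters in the first \<open>j\<close> rounds so far; entry
      \<open>Suc j\<close> becomes the shared state in which the active thread enters the
      interrupted round.\<close>
    let ?p = "p(Suc j := u)"
    have "linear (mround ?M) j q ?p A y1" by (rule linear_cong[OF 2(1)]) auto
    then have 3: "linear (mround ?M) (Suc j) q ?p A y1'" using y1' by (auto simp: linear_Suc)
    have 4: "column (mround ?M) j ?p w x y"
      using 2(2) unfolding linear_single by (rule column_cong) auto
    have 5: "(step (body ?M))\<^sup>*\<^sup>* (False, (?p (Suc j), fst y), snd y) (a, (s, g), map (mframe n) fs)"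
      using merged_run[OF ys(3) *(6)] by simp
    have "set (A @ x # B) \<subseteq> thread_initial ?M" using 1(1) xs(1) by simp
    from lazy.lazy_complete[OF *(1,2) 3 4 2(3) 5 viol this] show ?thesis by blast
  qed
  then show ?thesis unfolding seq_violation_def seq_reachable_lazy .
qed

theorem theorem1:
  fixes \<P> :: "('s, 'g, 'l, 'f, 'p) par_program" and k :: nat
  assumes "k > 0"
  shows "(k_round_violation k \<P> \<longleftrightarrow> seq_violation (lazy_program k \<P>)) \<and>
         is_lazy \<P> (lazy_program k \<P>)"
  using lazy_violation_sound lazy_violation_complete lazy_program_lazy by blast

end
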